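(* Fix $\beta>0$. Then for almost every initial data $\alpha(0)=\{\alpha_n(0)\}_{n\in\mathbb Z}$ chosen according to the white noise measure $$d\mu^\beta_{wn}=\prod_{n\in\mathbb Z}\frac{1+2\beta}{\pi}\,\frac{d\mathrm{Area}(\alpha_n)}{(1+|\alpha_n|^2)^{2+2\beta}}$$ (a product probability measure on $\mathbb C^{\mathbb Z}$) there exists a unique global good solution $\alpha:\mathbb Z\times\mathbb R\to\mathbb C$, with this initial data, to the Ablowitz--Ladik system $$i\tfrac{d}{dt}\alpha_n=-(1+|\alpha_n|^2)\,[\alpha_{n+1}+\alpha_{n-1}]+2\alpha_n,\qquad n\in\mathbb Z .$$
   Context: $\langle n\rangle=(1+n^2)^{1/2}$, and $d\mathrm{Area}$ is Lebesgue measure on $\mathbb C\cong\mathbb R^2$. A global (classical) solution $\alpha:\mathbb Z\times\mathbb R\to\mathbb C$ of the Ablowitz--Ladik system is called a good solution if both of the following hold: $$\int_{-T}^T\sum_{n\in\mathbb Z}\langle n\rangle^{-q}|\alpha_n(t)|^{2p}\,dt<\infty\quad\text{for some }p>q>1\text{ and all }T>0,$$ $$\sup_{|t|\le T}\sum_{n\in\mathbb Z}e^{-c\langle n\rangle}|\alpha_n(t)|^2<\infty\quad\text{for some }c>0\text{ and all }T>0.$$ *)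

theory Defs
  imports "HOL-Probability.Probability"
begin

definition single_site :: "real \<Rightarrow> complex measure" where
  "single_site \<beta> =
     density lborel
       (\<lambda>z. ennreal ((1 + 2 * \<beta>) / pi * (1 / (1 + (cmod z)\<^sup>2) powr (2 + 2 * \<beta>))))"

definition white_noise :: "real \<Rightarrow> (int \<Rightarrow> complex) measure" where
  "white_noise \<beta> = (\<Pi>\<^sub>M n\<in>UNIV. single_site \<beta>)"

definition japanese_bracket :: "int \<Rightarrow> real" where
  "japanese_bracket n = sqrt (1 + (real_of_int n)\<^sup>2)"

text \<open>Since the right-hand side is continuous along any pointwise differentiable solution,
  such a solution is automatically of class C1 in time.\<close>

definition AL_solution :: "(int \<Rightarrow> real \<Rightarrow> complex) \<Rightarrow> bool" where
  "AL_solution \<alpha> \<longleftrightarrow>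
     (\<forall>n t. \<alpha> n differentiable (at t) \<and>
        \<i> * vector_derivative (\<alpha> n) (at t) =
          - (1 + complex_of_real ((cmod (\<alpha> n t))\<^sup>2)) * (\<alpha> (n + 1) t + \<alpha> (n - 1) t)
          + 2 * \<alpha> n t)"

text \<open>Integrals and sums of nonnegative quantities are taken in the extended nonnegative reals;
  a sum over the integers is the integral against counting measure.\<close>

definition good_solution :: "(int \<Rightarrow> real \<Rightarrow> complex) \<Rightarrow> bool" where
  "good_solution \<alpha> \<longleftrightarrow>
     AL_solution \<alpha> \<and>
     (\<exists>p q :: real. p > q \<and> q > 1 \<and>
        (\<forall>T>0. (\<integral>\<^sup>+ t\<in>{-T..T}.
            (\<integral>\<^sup>+ n. ennreal (japanese_bracket n powr (- q) * cmod (\<alpha> n t) powr (2 * p))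
               \<partial>count_space UNIV) \<partial>lborel) < \<infinity>)) \<and>
     (\<exists>c::real. c > 0 \<and>
        (\<forall>T>0. (SUP t\<in>{-T..T}.
            (\<integral>\<^sup>+ n. ennreal (exp (- c * japanese_bracket n) * (cmod (\<alpha> n t))\<^sup>2)
               \<partial>count_space UNIV)) < \<infinity>))"

text \<open>The following two facts confirm the normalisation of the measure, which is needed for the
  infinite product to be meaningful.\<close>

lemma prob_space_single_site:
  assumes "\<beta> > 0"
  shows "prob_space (single_site \<beta>)"
proof -
  define s where "s = 1 + 2 * \<beta>"
  have s: "s > 1" using assms by (simp add: s_def)
  let ?f = "\<lambda>v. (s + 1) * v powr (- (s + 2))"
  have dens: "ennreal (1 / (1 + (cmod z)\<^sup>2) powr (s + 1)) =
      (\<integral>\<^sup>+ v. ennreal (?f v) * indicator {1 + (cmod z)\<^sup>2 ..} v \<partial>lborel)" for z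
  proof -
    have pos: "1 + (cmod z)\<^sup>2 > 0" by (simp add: add_pos_nonneg)
    have "(\<integral>\<^sup>+ v. ennreal (?f v) * indicator {1 + (cmod z)\<^sup>2 ..} v \<partial>lborel) =
        ennreal (0 - (- ((1 + (cmod z)\<^sup>2) powr (- (s + 1)))))"
    proof (rule nn_integral_FTC_atLeast)
      show "?f \<in> borel_measurable borel" by measurable
      fix x :: real assume "1 + (cmod z)\<^sup>2 \<le> x"
      then have x: "x > 0" using pos by linarith
      show "((\<lambda>v. - (v powr (- (s + 1)))) has_real_derivative ?f x) (at x)"
        using x by (auto intro!: derivative_eq_intros simp: algebra_simps)
      show "0 \<le> ?f x" using s by simp
    next
      have "((\<lambda>v::real. v powr (- (s + 1))) \<longlongrightarrow> 0) at_top"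
        using s by (intro tendsto_neg_powr filterlim_ident) auto
      then show "((\<lambda>v::real. - (v powr (- (s + 1)))) \<longlongrightarrow> 0) at_top"
        using tendsto_minus by fastforce
    qed
    then show ?thesis using pos by (simp only: powr_minus_divide) simp
  qed
  have disc: "(\<integral>\<^sup>+ z. indicator {1 + (cmod z)\<^sup>2 ..} v \<partial>lborel) =
      ennreal (pi * (v - 1)) * indicator {1..} v" for v :: real
  proof (cases "v \<ge> 1")
    case True
    have "1 + (cmod z)\<^sup>2 \<le> v \<longleftrightarrow> cmod z \<le> sqrt (v - 1)" for z
      using real_sqrt_le_iff[of "(cmod z)\<^sup>2" "v - 1"] by auto
    then have "indicator {1 + (cmod z)\<^sup>2 ..} v = (indicator (cball 0 (sqrt (v - 1))) z :: ennreal)" for z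
      by (simp add: indicator_def)
    then have "(\<integral>\<^sup>+ z. indicator {1 + (cmod z)\<^sup>2 ..} v \<partial>lborel) =
        emeasure lborel (cball (0::complex) (sqrt (v - 1)))"
      by simp
    also have "\<dots> = ennreal (pi * (v - 1))"
      using True by (subst emeasure_cball) (simp_all add: unit_ball_vol_2)
    finally show ?thesis using True by simp
  next
    case False
    then have "indicator {1 + (cmod z)\<^sup>2 ..} v = (0 :: ennreal)" for z
      by (auto simp: indicator_def) (smt (verit) zero_le_power2)
    then show ?thesis using False by simp
  qed
  have "(\<integral>\<^sup>+ z. ennreal (1 / (1 + (cmod z)\<^sup>2) powr (s + 1)) \<partial>lborel) =
      (\<integral>\<^sup>+ z. \<integral>\<^sup>+ v. ennreal (?f v) * indicator {1 + (cmod z)\<^sup>2 ..} v \<partial>lborel \<partial>lborel)"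
    by (simp only: dens)
  also have "\<dots> =
      (\<integral>\<^sup>+ v. \<integral>\<^sup>+ z. ennreal (?f v) * indicator {1 + (cmod z)\<^sup>2 ..} v \<partial>lborel \<partial>lborel)"
    unfolding indicator_def atLeast_iff by (rule lborel_pair.Fubini') measurable
  also have "\<dots> = (\<integral>\<^sup>+ v. ennreal (?f v * (pi * (v - 1))) * indicator {1..} v \<partial>lborel)"
  proof (rule nn_integral_cong)
    fix v :: real
    have "(\<integral>\<^sup>+ z. ennreal (?f v) * indicator {1 + (cmod z)\<^sup>2 ..} v \<partial>lborel) =
        ennreal (?f v) * (\<integral>\<^sup>+ z. indicator {1 + (cmod z)\<^sup>2 ..} v \<partial>lborel)"
      unfolding indicator_def atLeast_iff by (rule nn_integral_cmult) measurable
    also have "\<dots> = ennreal (?f v * (pi * (v - 1))) * indicator {1..} v"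
      unfolding disc using s
      by (auto simp: indicator_def ennreal_mult[symmetric])
    finally show "(\<integral>\<^sup>+ z. ennreal (?f v) * indicator {1 + (cmod z)\<^sup>2 ..} v \<partial>lborel) =
        ennreal (?f v * (pi * (v - 1))) * indicator {1..} v" .
  qed
  also have "\<dots> = ennreal (0 - pi * (1 powr (- (s + 1)) - (s + 1) / s * 1 powr (- s)))"
  proof (rule nn_integral_FTC_atLeast[where
        F = "\<lambda>v. pi * (v powr (- (s + 1)) - (s + 1) / s * v powr (- s))"])
    show "(\<lambda>v. ?f v * (pi * (v - 1))) \<in> borel_measurable borel" by measurable
    fix x :: real assume x: "1 \<le> x"
    have "- s - 1 = 1 + - (s + 2)" by simp
    then have base: "x powr (- s - 1) = x * x powr (- (s + 2))"
      using x by (simp only: powr_mult_base[of x "- (s + 2)"])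
    have "((\<lambda>v. pi * (v powr (- (s + 1)) - (s + 1) / s * v powr (- s))) has_real_derivative
        pi * (- (s + 1) * x powr (- (s + 1) - 1) - (s + 1) / s * (- s * x powr (- s - 1)))) (at x)"
      using x by (intro DERIV_cmult DERIV_diff has_real_derivative_powr) auto
    moreover have "pi * (- (s + 1) * x powr (- (s + 1) - 1) - (s + 1) / s * (- s * x powr (- s - 1)))
        = ?f x * (pi * (x - 1))"
    proof -
      have e: "- (s + 1) - 1 = - (s + 2)" by simp
      show ?thesis unfolding base e using s by (simp add: field_simps)
    qed
    ultimately show "((\<lambda>v. pi * (v powr (- (s + 1)) - (s + 1) / s * v powr (- s)))
        has_real_derivative ?f x * (pi * (x - 1))) (at x)" by (simp only:)
    show "0 \<le> ?f x * (pi * (x - 1))" using s x by simp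
  next
    have "((\<lambda>v. pi * (v powr (- (s + 1)) - (s + 1) / s * v powr (- s)))
        \<longlongrightarrow> pi * (0 - (s + 1) / s * 0)) at_top"
      using s by (intro tendsto_intros tendsto_neg_powr filterlim_ident) auto
    then show "((\<lambda>v. pi * (v powr (- (s + 1)) - (s + 1) / s * v powr (- s))) \<longlongrightarrow> 0) at_top"
      by simp
  qed
  also have "\<dots> = ennreal (pi / s)"
    using s by (simp add: field_simps)
  finally have total:
    "(\<integral>\<^sup>+ z. ennreal (1 / (1 + (cmod z)\<^sup>2) powr (s + 1)) \<partial>lborel) = ennreal (pi / s)" .
  have "emeasure (single_site \<beta>) (space (single_site \<beta>)) =
      (\<integral>\<^sup>+ z. ennreal (s / pi * (1 / (1 + (cmod z)\<^sup>2) powr (s + 1))) \<partial>lborel)"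
    unfolding single_site_def s_def by (subst emeasure_density) (simp_all add: add.commute)
  also have "\<dots> = (\<integral>\<^sup>+ z. ennreal (s / pi) * ennreal (1 / (1 + (cmod z)\<^sup>2) powr (s + 1)) \<partial>lborel)"
    using s by (intro nn_integral_cong ennreal_mult) auto
  also have "\<dots> = ennreal (s / pi) * ennreal (pi / s)"
    by (subst nn_integral_cmult) (measurable, simp only: total)
  also have "\<dots> = 1"
    using s by (subst ennreal_mult[symmetric]) auto
  finally show ?thesis by (rule prob_spaceI)
qed

lemma prob_space_white_noise: "\<beta> > 0 \<Longrightarrow> prob_space (white_noise \<beta>)"
  unfolding white_noise_def by (intro prob_space_PiM prob_space_single_site)

end

(*
  The substitution alpha_n = exp(-2it) gamma_n turns the system into
  gamma_n' = i (1 + |gamma_n|^2) (gamma_{n+1} + gamma_{n-1}).  The truncation of this system to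
  |n| <= N is global because prod (1 + |gamma_n|^2) is conserved.  Its flow is the limit of
  Gauss-Seidel sweeps of Euler steps, each of which moves a single real coordinate; such a step
  preserves dArea / (1 + |z|^2) up to a relative error quadratic in the step size, and the remaining
  density is a power of the conserved product.  In the limit the truncated flows do not increase
  white-noise moments of single sites.  Hence, for p = 1 + beta, the space-time integral in the
  definition of good solutions is bounded in expectation uniformly in N, and the time integral of
  max over |n| <= L of |gamma_n|^2 grows sublinearly in L almost surely.  Propagating a difference of
  two solutions from distance L gains a factor (C L^r)^L / L! with r < 1, which beats any exponential
  bound at distance L.  This gives uniqueness, and convergence of the truncated solutions
  along N = 2^k.
*)
theory Submission
  imports Defs
begin

section \<open>Ordinary differential equations in Banach spaces\<close>

text \<open>Under the single-site law \<open>|z|^(2p)\<close> is integrable exactly for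
  \<open>p < 1 + 2\<beta>\<close>, so exponents with \<open>1 < q < q + \<delta> < p\<close> have
  room. Moving one real coordinate at a time reduces invariance to Fubini and a one-dimensional
  quadratic substitution, in place of a multivariate Jacobian for the flow. The field is cubic, so
  it is clipped above the level of the conserved product, which makes it Lipschitz without affecting
  the trajectory. In infinite volume the maximum over a box of size L is not bounded in L, so a
  sup-norm Gronwall argument fails. Splitting \<open>|\<gamma>|^2\<close> at a threshold
  \<open>\<theta>\<close> bounds its time integral by a multiple of
  \<open>\<theta> + \<theta>^(1-p) L^(q+\<delta>)\<close>; the two terms balance at
  \<open>\<theta> = L^r\<close>, \<open>r = (q+\<delta>)/p < 1\<close>. The \<open>\<delta>\<close>
  is the price of turning expectation bounds into almost sure bounds at all scales, and
  \<open>N^(-\<delta>)\<close> is summable along \<open>N = 2^k\<close> for every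
  \<open>\<delta> > 0\<close>. This loss would spoil the space-time bound of the limit, so that
  bound comes separately from a liminf over the scales.\<close>

lemma antiderivative_UNIV:
  fixes f :: "real \<Rightarrow> 'a::banach"
  assumes "continuous_on UNIV f"
  obtains F where "F 0 = x" "\<And>t. (F has_vector_derivative f t) (at t)"
proof -
  \<comment> \<open>At most one of the two integrals is nonzero: the interval on the wrong side of 0
    is empty or a point. Near a given time both agree with an integral started at \<open>-T\<close>,
    up to a constant.\<close>
  define F where "F t = x + (integral {0..t} f - integral {t..0} f)" for t :: real
  have int: "f integrable_on {a..b}" for a b
    by (rule integrable_continuous_interval) (rule continuous_on_subset[OF assms], simp)
  have F0: "F 0 = x" by (simp add: F_def)
  have "(F has_vector_derivative f t) (at t)" for t
  proof -
    define T where "T = \<bar>t\<bar> + 1"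
    have t: "t \<in> {-T<..<T}" by (auto simp: T_def)
    have F: "x + (integral {-T..s} f - integral {-T..0} f) = F s" if "s \<in> {-T<..<T}" for s
    proof (cases "s \<ge> 0")
      case True
      have "integral {-T..0} f + integral {0..s} f = integral {-T..s} f"
        using True that t by (intro Henstock_Kurzweil_Integration.integral_combine int) auto
      moreover have "integral {s..0} f = 0" using True by (cases "s = 0") auto
      ultimately show ?thesis by (simp add: F_def algebra_simps)
    next
      case False
      have "integral {-T..s} f + integral {s..0} f = integral {-T..0} f"
        using False that by (intro Henstock_Kurzweil_Integration.integral_combine int) auto
      then show ?thesis using False by (simp add: F_def algebra_simps)
    qed
    have "((\<lambda>s. integral {-T..s} f) has_vector_derivative f t) (at t within {-T..T})"
      using t by (intro integral_has_vector_derivative continuous_on_subset[OF assms]) auto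
    then have "((\<lambda>s. integral {-T..s} f) has_vector_derivative f t) (at t within {-T<..<T})"
      by (rule has_vector_derivative_within_subset) auto
    then have "((\<lambda>s. integral {-T..s} f) has_vector_derivative f t) (at t)"
      using at_within_open[OF t open_greaterThanLessThan] by simp
    then have "((\<lambda>s. x + (integral {-T..s} f - integral {-T..0} f)) has_vector_derivative f t) (at t)"
      by (auto intro!: derivative_eq_intros)
    then show "(F has_vector_derivative f t) (at t)"
      by (rule has_vector_derivative_transform_within_open[where S="{-T<..<T}"]) (use t F in auto)
  qed
  with F0 show ?thesis by (rule that)
qed

text \<open>The passage to the limit in a differential equation, needed for the Picard iterates and
  again for the truncated solutions. Convergence of the derivatives on bounded intervals is enough,
  since differentiability is local.\<close>

lemma has_vector_derivative_uniform_limit: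
  fixes f :: "nat \<Rightarrow> real \<Rightarrow> 'a::banach"
  assumes der: "\<And>k t. (f k has_vector_derivative g k t) (at t)"
    and unif: "\<And>T. uniform_limit {-T..T} g h sequentially"
    and lim: "\<And>t. (\<lambda>k. f k t) \<longlonglongrightarrow> F t"
  shows "(F has_vector_derivative h t) (at t)"
proof -
  define T where "T = \<bar>t\<bar> + 1"
  let ?S = "{-T<..<T}"
  have t: "t \<in> ?S" by (auto simp: T_def)
  have "\<exists>G. \<forall>x\<in>?S. (\<lambda>n. f n x) \<longlonglongrightarrow> G x \<and> (G has_derivative (\<lambda>y. y *\<^sub>R h x)) (at x within ?S)"
  proof (rule has_derivative_sequence)
    show "(f n has_derivative (\<lambda>y. y *\<^sub>R g n x)) (at x within ?S)" for n x
      using der[of n x] unfolding has_vector_derivative_def by (rule has_derivative_at_withinI)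
    fix e :: real assume e: "e > 0"
    have "\<forall>\<^sub>F n in sequentially. \<forall>x\<in>{-T..T}. dist (g n x) (h x) < e"
      using unif[of T] e by (auto simp: uniform_limit_iff)
    then show "\<forall>\<^sub>F n in sequentially. \<forall>x\<in>?S. \<forall>y. norm (y *\<^sub>R g n x - y *\<^sub>R h x) \<le> e * norm y"
    proof (rule eventually_mono, intro ballI allI)
      fix n x y assume *: "\<forall>x\<in>{-T..T}. dist (g n x) (h x) < e" "x \<in> ?S"
      then have "norm (g n x - h x) \<le> e" by (simp add: dist_norm less_imp_le)
      then show "norm (y *\<^sub>R g n x - y *\<^sub>R h x) \<le> e * norm y"
        by (simp add: scaleR_diff_right[symmetric] mult_left_mono mult.commute[of e])
    qed
  qed (use t lim in auto)
  then obtain G where G: "\<And>x. x \<in> ?S \<Longrightarrow> (\<lambda>n. f n x) \<longlonglongrightarrow> G x"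
      "(G has_derivative (\<lambda>y. y *\<^sub>R h t)) (at t within ?S)" using t by blast
  have "G x = F x" if "x \<in> ?S" for x
    using LIMSEQ_unique[OF G(1)[OF that] lim] .
  then have "(F has_vector_derivative h t) (at t within ?S)"
    using G(2) t unfolding has_vector_derivative_def
    by (metis has_derivative_transform)
  then show ?thesis using at_within_open[OF t open_greaterThanLessThan] by simp
qed

text \<open>Mean value inequality with a scalar majorant. Choosing \<open>\<phi>\<close> of the form
  power over factorial yields the factorial gains in the Picard iteration and in the comparison of
  two solutions.\<close>

lemma norm_le_if_vector_derivative_le:
  fixes f :: "real \<Rightarrow> 'a::real_normed_vector"
  assumes "0 \<le> t"
    and "\<And>s. \<lbrakk>0 \<le> s; s \<le> t\<rbrakk> \<Longrightarrow> (f has_vector_derivative f' s) (at s)"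
    and "\<And>s. \<lbrakk>0 \<le> s; s \<le> t\<rbrakk> \<Longrightarrow> (\<phi> has_real_derivative \<phi>' s) (at s)"
    and "\<And>s. \<lbrakk>0 \<le> s; s \<le> t\<rbrakk> \<Longrightarrow> norm (f' s) \<le> \<phi>' s"
  shows "norm (f t - f 0) \<le> \<phi> t - \<phi> 0"
proof (cases "t = 0")
  case False
  then have "0 < t" using assms(1) by simp
  then show ?thesis
  proof (rule differentiable_bound_general[where f'=f' and \<phi>'=\<phi>'])
    show "continuous_on {0..t} f"
      using assms(2) by (intro continuous_at_imp_continuous_on) (meson atLeastAtMost_iff has_vector_derivative_continuous)
    show "continuous_on {0..t} \<phi>"
      using assms(3) by (intro continuous_at_imp_continuous_on) (meson atLeastAtMost_iff DERIV_isCont)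
  qed (use assms in \<open>auto simp: has_real_derivative_iff_has_vector_derivative\<close>)
qed simp

text \<open>With \<open>c = -1\<close> this reduces negative times to positive ones.\<close>

lemma has_vector_derivative_scale_arg:
  assumes "(u has_vector_derivative d) (at (c * s))"
  shows "((\<lambda>t. u (c * t)) has_vector_derivative c *\<^sub>R d) (at s)"
proof -
  have "((*) c has_vector_derivative c) (at s)"
    using DERIV_cmult_Id[of c s UNIV] by (simp add: has_real_derivative_iff_has_vector_derivative)
  from vector_diff_chain_at[OF this assms] show ?thesis by (simp add: o_def)
qed

text \<open>No contraction on short intervals is needed: the k-th increment of the iteration is at
  most \<open>b k t\<close>, and the factorial in it makes the increments summable on every bounded
  interval at once.\<close>

lemma picard_global:
  fixes G :: "'a::banach \<Rightarrow> 'a"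
  assumes L: "\<And>x y. norm (G x - G y) \<le> L * norm (x - y)"
  obtains u where "u 0 = x" "\<And>t. (u has_vector_derivative G (u t)) (at t)"
proof -
  have L0: "0 \<le> \<bar>L\<bar>" by simp
  have L': "norm (G x - G y) \<le> \<bar>L\<bar> * norm (x - y)" for x y
    using L[of x y] by (smt (verit) mult_right_mono norm_ge_zero)
  have contG: "continuous_on UNIV G"
    by (rule lipschitz_on_continuous_on[where L="\<bar>L\<bar>"])
       (auto intro!: lipschitz_onI simp: dist_norm L')
  have "\<exists>F. F 0 = x \<and> (\<forall>t. (F has_vector_derivative G (v t)) (at t))"
    if "continuous_on UNIV v" for v :: "real \<Rightarrow> 'a"
    using antiderivative_UNIV[of "\<lambda>t. G (v t)" x] continuous_on_compose2[OF contG that] by (metis UNIV_I subsetI)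
  then obtain P where P: "\<And>v. continuous_on UNIV v \<Longrightarrow> P v 0 = x"
      "\<And>v t. continuous_on UNIV v \<Longrightarrow> (P v has_vector_derivative G (v t)) (at t)"
    by metis
  define u where "u k = (P ^^ k) (\<lambda>t. x)" for k
  have contu: "continuous_on UNIV (u k)" for k
  proof (induction k)
    case 0 then show ?case by (simp add: u_def)
  next
    case (Suc k)
    have "isCont (P (u k)) t" for t using P(2)[OF Suc] by (rule has_vector_derivative_continuous)
    then show ?case by (simp add: u_def continuous_at_imp_continuous_on)
  qed
  have u0: "u 0 t = x" for t by (simp add: u_def)
  have uS: "(u (Suc k) has_vector_derivative G (u k t)) (at t)" "u (Suc k) 0 = x" for k t
    using P[OF contu[of k]] by (auto simp: u_def)
  define K where "K = norm (G x)"
  define b where "b k t = K * \<bar>L\<bar>^k * t^Suc k / fact (Suc k)" for k and t :: real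
  have bder: "((\<lambda>t. b (Suc k) t) has_real_derivative \<bar>L\<bar> * b k t) (at t)" for k t
  proof -
    have fr: "real (Suc m) / fact (Suc m) = 1 / (fact m :: real)" for m
      by (simp only: fact_Suc of_nat_mult) simp
    have "((\<lambda>t. b (Suc k) t) has_real_derivative K * \<bar>L\<bar>^Suc k * (real (Suc (Suc k)) * t^Suc k) / fact (Suc (Suc k))) (at t)"
      unfolding b_def by (intro DERIV_cdivide DERIV_cmult DERIV_pow[THEN DERIV_cong]) simp
    also have "K * \<bar>L\<bar>^Suc k * (real (Suc (Suc k)) * t^Suc k) / fact (Suc (Suc k)) = 
        K * \<bar>L\<bar>^Suc k * t^Suc k * (real (Suc (Suc k)) / fact (Suc (Suc k)))" by simp
    also have "\<dots> = \<bar>L\<bar> * b k t" unfolding fr b_def by simp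
    finally show ?thesis .
  qed
  have diff: "norm (u (Suc k) (\<sigma> * t) - u k (\<sigma> * t)) \<le> b k t" if "t \<ge> 0" "\<bar>\<sigma>\<bar> = 1" for k t \<sigma>
    using that(1)
  proof (induction k arbitrary: t)
    case 0
    have "norm (u (Suc 0) (\<sigma> * t) - u (Suc 0) (\<sigma> * 0)) \<le> K * t - K * 0"
    proof (rule norm_le_if_vector_derivative_le[OF 0, where f'="\<lambda>s. \<sigma> *\<^sub>R G x" and \<phi>'="\<lambda>s. K"])
      fix s
      show "((\<lambda>t. u (Suc 0) (\<sigma> * t)) has_vector_derivative \<sigma> *\<^sub>R G x) (at s)"
        using has_vector_derivative_scale_arg[OF uS(1)[of 0 "\<sigma> * s"]] by (simp add: u0)
      show "((\<lambda>s. K * s) has_real_derivative K) (at s)" by (rule DERIV_cmult_Id)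
    qed (simp add: K_def that(2))
    then show ?case using uS(2)[of 0] by (simp add: u0 b_def)
  next
    case (Suc k)
    have "norm ((u (Suc (Suc k)) (\<sigma> * t) - u (Suc k) (\<sigma> * t)) - (u (Suc (Suc k)) (\<sigma> * 0) - u (Suc k) (\<sigma> * 0))) \<le> b (Suc k) t - b (Suc k) 0"
    proof (rule norm_le_if_vector_derivative_le[OF Suc.prems, where f'="\<lambda>s. \<sigma> *\<^sub>R (G (u (Suc k) (\<sigma> * s)) - G (u k (\<sigma> * s)))"
         and \<phi>'="\<lambda>s. \<bar>L\<bar> * b k s"])
      fix s :: real assume s: "0 \<le> s" "s \<le> t"
      have "((\<lambda>t. u (Suc k) (\<sigma> * t)) has_vector_derivative \<sigma> *\<^sub>R G (u k (\<sigma> * s))) (at s)" for k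
        by (rule has_vector_derivative_scale_arg[OF uS(1)])
      then show "((\<lambda>t. u (Suc (Suc k)) (\<sigma> * t) - u (Suc k) (\<sigma> * t)) has_vector_derivative \<sigma> *\<^sub>R (G (u (Suc k) (\<sigma> * s)) - G (u k (\<sigma> * s)))) (at s)"
        unfolding scaleR_diff_right by (intro has_vector_derivative_diff)
      show "norm (\<sigma> *\<^sub>R (G (u (Suc k) (\<sigma> * s)) - G (u k (\<sigma> * s)))) \<le> \<bar>L\<bar> * b k s"
        using L'[of "u (Suc k) (\<sigma> * s)" "u k (\<sigma> * s)"] mult_left_mono[OF Suc.IH[OF s(1)] L0] that(2) by auto
    qed (rule bder)
    then show ?case using uS(2) by (simp add: b_def)
  qed
  have b_sum: "summable (\<lambda>k. b k T)" for T
  proof -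
    have "summable (\<lambda>k. K * \<bar>T\<bar> * ((\<bar>L\<bar> * \<bar>T\<bar>)^k /\<^sub>R fact k))"
      by (intro summable_mult summable_exp_generic)
    then show ?thesis
    proof (rule summable_comparison_test')
      fix k :: nat
      have f: "(fact k :: real) \<le> fact (Suc k)" by (simp add: fact_mono)
      have "norm (b k T) = (K * \<bar>L\<bar>^k * \<bar>T\<bar>^Suc k) / fact (Suc k)"
        by (simp add: b_def K_def abs_mult power_abs del: fact_Suc)
      also have "\<dots> \<le> (K * \<bar>L\<bar>^k * \<bar>T\<bar>^Suc k) / fact k"
        by (intro divide_left_mono f) (auto simp: K_def)
      finally show "norm (b k T) \<le> K * \<bar>T\<bar> * ((\<bar>L\<bar> * \<bar>T\<bar>)^k /\<^sub>R fact k)"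
        by (simp add: power_mult_distrib field_simps)
    qed
  qed
  have diffT: "norm (u (Suc k) t - u k t) \<le> b k T" if "t \<in> {-T..T}" for k t T
  proof -
    have "norm (u (Suc k) t - u k t) \<le> b k \<bar>t\<bar>"
      using diff[of "\<bar>t\<bar>" 1 k] diff[of "\<bar>t\<bar>" "-1" k] by (cases "t \<ge> 0") auto
    also have "\<dots> \<le> b k T"
      using that unfolding b_def K_def by (intro divide_right_mono mult_left_mono power_mono) auto
    finally show ?thesis .
  qed
  have tele: "x + (\<Sum>i<k. u (Suc i) t - u i t) = u k t" for k t
    using sum_lessThan_telescope[of "\<lambda>i. u i t" k] by (simp add: u0)
  define U where "U t = x + suminf (\<lambda>i. u (Suc i) t - u i t)" for t
  have unif: "uniform_limit {-T..T} u U sequentially" for T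
  proof -
    have "uniform_limit {-T..T} (\<lambda>n t. \<Sum>i<n. u (Suc i) t - u i t) (\<lambda>t. suminf (\<lambda>i. u (Suc i) t - u i t)) sequentially"
      by (rule Weierstrass_m_test[OF diffT b_sum])
    then have "uniform_limit {-T..T} (\<lambda>n t. x + (\<Sum>i<n. u (Suc i) t - u i t)) (\<lambda>t. x + suminf (\<lambda>i. u (Suc i) t - u i t)) sequentially"
      by (intro uniform_limit_intros)
    then show ?thesis unfolding tele U_def[symmetric] by simp
  qed
  have lim: "(\<lambda>k. u k t) \<longlonglongrightarrow> U t" for t
    by (rule tendsto_uniform_limitI[OF unif[of "\<bar>t\<bar>"]]) (simp, linarith)
  have unifG: "uniform_limit {-T..T} (\<lambda>k t. G (u k t)) (\<lambda>t. G (U t)) sequentially" for T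
  proof (rule uniform_limitI)
    fix e :: real assume "e > 0"
    then have "e / (\<bar>L\<bar> + 1) > 0" by simp
    then have "\<forall>\<^sub>F k in sequentially. \<forall>t\<in>{-T..T}. dist (u k t) (U t) < e / (\<bar>L\<bar> + 1)"
      using unif[of T] by (auto simp: uniform_limit_iff)
    then show "\<forall>\<^sub>F k in sequentially. \<forall>t\<in>{-T..T}. dist (G (u k t)) (G (U t)) < e"
    proof (rule eventually_mono, intro ballI)
      fix k t assume "\<forall>t\<in>{-T..T}. dist (u k t) (U t) < e / (\<bar>L\<bar> + 1)" "t \<in> {-T..T}"
      then have *: "norm (u k t - U t) * (\<bar>L\<bar> + 1) < e" by (simp add: dist_norm field_simps)
      have "dist (G (u k t)) (G (U t)) \<le> \<bar>L\<bar> * norm (u k t - U t)" by (simp add: dist_norm L')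
      also have "\<dots> \<le> norm (u k t - U t) * (\<bar>L\<bar> + 1)" by (simp add: algebra_simps)
      finally show "dist (G (u k t)) (G (U t)) < e" using * by simp
    qed
  qed
  show ?thesis
  proof
    show "(U has_vector_derivative G (U t)) (at t)" for t
    proof (rule has_vector_derivative_uniform_limit[where f="\<lambda>k. u (Suc k)"])
      show "(\<lambda>k. u (Suc k) t) \<longlonglongrightarrow> U t" for t using lim by (rule LIMSEQ_Suc)
    qed (use uS unifG in auto)
    have "(\<lambda>k. u (Suc k) 0) \<longlonglongrightarrow> U 0" using lim by (rule LIMSEQ_Suc)
    then show "U 0 = x" using uS(2) by (simp add: LIMSEQ_const_iff)
  qed
qed

section \<open>Convergence of Gauss-Seidel sweeps of Euler steps\<close>

definition euler_step :: "real \<Rightarrow> ('a \<Rightarrow> 'a) \<Rightarrow> 'a \<Rightarrow> 'a::real_normed_vector" where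
  "euler_step h V x = x + h *\<^sub>R V x"

lemma norm_sum_list_le:
  fixes f :: "'b \<Rightarrow> 'a::real_normed_vector"
  assumes "\<And>V. V \<in> set Vs \<Longrightarrow> norm (f V) \<le> K"
  shows "norm (\<Sum>V\<leftarrow>Vs. f V) \<le> real (length Vs) * K"
  using assms
proof (induction Vs)
  case (Cons V Vs)
  have "norm (f V + (\<Sum>V\<leftarrow>Vs. f V)) \<le> norm (f V) + norm (\<Sum>V\<leftarrow>Vs. f V)" by (rule norm_triangle_ineq)
  with Cons.IH Cons.prems[of V] Cons.prems show ?case by (simp add: algebra_simps) (smt (verit))
qed simp

context
  fixes Vs :: "('a::banach \<Rightarrow> 'a) list" and K L h :: real
  assumes h: "0 \<le> h"
    and K: "0 \<le> K" "\<And>V x. V \<in> set Vs \<Longrightarrow> norm (V x) \<le> K"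
    and L: "0 \<le> L" "\<And>V x y. V \<in> set Vs \<Longrightarrow> norm (V x - V y) \<le> L * norm (x - y)"
begin

lemma norm_euler_field_diff_le:
  assumes "set Ws \<subseteq> set Vs"
  shows "norm ((\<Sum>V\<leftarrow>Ws. V x) - (\<Sum>V\<leftarrow>Ws. V y)) \<le> real (length Ws) * (L * norm (x - y))"
proof -
  have "norm (\<Sum>V\<leftarrow>Ws. V x - V y) \<le> real (length Ws) * (L * norm (x - y))"
    using assms L(2) by (intro norm_sum_list_le) auto
  then show ?thesis by (simp add: sum_list_subtractf)
qed

text \<open>Successive steps differ from one simultaneous step only because each field is evaluated
  at a displaced point. Every earlier step displaces it by at most \<open>h * K\<close>, so each
  ordered pair of fields costs at most \<open>h^2 K L\<close>.\<close>

lemma euler_sweep_consistency: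
  assumes "set Ws \<subseteq> set Vs"
  shows "norm (fold (euler_step h) Ws x - x - h *\<^sub>R (\<Sum>V\<leftarrow>Ws. V x)) \<le> h\<^sup>2 * (real (length Ws))\<^sup>2 * (K * L)"
  using assms
proof (induction Ws arbitrary: x)
  case (Cons V Ws)
  let ?y = "euler_step h V x" and ?F = "\<lambda>x. \<Sum>V\<leftarrow>Ws. V x"
  have 1: "norm (fold (euler_step h) Ws ?y - ?y - h *\<^sub>R ?F ?y) \<le> h\<^sup>2 * (real (length Ws))\<^sup>2 * (K * L)"
    using Cons.prems by (intro Cons.IH) auto
  have "norm (?F ?y - ?F x) \<le> real (length Ws) * (L * norm (?y - x))"
    using Cons.prems by (intro norm_euler_field_diff_le) auto
  also have "norm (?y - x) \<le> h * K"
    using Cons.prems h K(2)[of V x] by (simp add: euler_step_def mult_left_mono)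
  finally have "norm (?F ?y - ?F x) \<le> real (length Ws) * (L * (h * K))"
    using L(1) by (simp add: mult_left_mono)
  then have 2: "norm (h *\<^sub>R (?F ?y - ?F x)) \<le> h * (real (length Ws) * (L * (h * K)))"
    using h by (simp add: mult_left_mono)
  have "fold (euler_step h) (V # Ws) x - x - h *\<^sub>R (\<Sum>V\<leftarrow>V # Ws. V x) =
      (fold (euler_step h) Ws ?y - ?y - h *\<^sub>R ?F ?y) + h *\<^sub>R (?F ?y - ?F x)"
    by (simp add: euler_step_def algebra_simps)
  also have "norm \<dots> \<le> h\<^sup>2 * (real (length Ws))\<^sup>2 * (K * L) + h * (real (length Ws) * (L * (h * K)))"
    using norm_triangle_ineq 1 2 by (smt (verit))
  also have "\<dots> = h\<^sup>2 * (K * L) * ((real (length Ws))\<^sup>2 + real (length Ws))"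
    by (simp add: algebra_simps power2_eq_square)
  also have "\<dots> \<le> h\<^sup>2 * (K * L) * (real (length (V # Ws)))\<^sup>2"
    using K L(1) by (intro mult_left_mono) (auto simp: power2_eq_square algebra_simps)
  finally show ?case by (simp add: algebra_simps)
qed simp

text \<open>Discrete Gronwall argument. One half of the local error \<open>2 m^2 K L h^2\<close> is
  the inconsistency of a sweep, the other half the Taylor remainder of the exact solution; a sweep
  amplifies an existing error by at most \<open>1 + h m L\<close>, up to that local error.\<close>

lemma euler_sweep_error:
  fixes u :: "real \<Rightarrow> 'a"
  defines "m \<equiv> real (length Vs)"
  assumes u: "\<And>t. (u has_vector_derivative (\<Sum>V\<leftarrow>Vs. V (u t))) (at t)"
  shows "norm ((fold (euler_step h) Vs ^^ j) (u 0) - u (real j * h))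
    \<le> real j * (2 * m\<^sup>2 * (K * L) * h\<^sup>2) * (1 + h * (m * L)) ^ j"
proof (induction j)
  case (Suc j)
  let ?F = "\<lambda>x. \<Sum>V\<leftarrow>Vs. V x" and ?s = "real j * h" and ?x = "(fold (euler_step h) Vs ^^ j) (u 0)"
  have m: "m \<ge> 0" by (simp add: m_def)
  have FK: "norm (?F x) \<le> m * K" for x unfolding m_def by (intro norm_sum_list_le K)
  have FL: "norm (?F x - ?F y) \<le> m * (L * norm (x - y))" for x y
    unfolding m_def by (rule norm_euler_field_diff_le) simp
  have us: "((\<lambda>r. u (?s + r)) has_vector_derivative ?F (u (?s + r))) (at r)" for r
  proof -
    have "((\<lambda>r. ?s + r) has_vector_derivative 1) (at r)" by (auto intro!: derivative_eq_intros)
    from vector_diff_chain_at[OF this, where g=u and g'="?F (u (?s + r))"] u show ?thesis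
      by (simp add: o_def)
  qed
  have u1: "norm (u (?s + r) - u ?s) \<le> r * (m * K)" if "0 \<le> r" for r
  proof -
    have "norm (u (?s + r) - u (?s + 0)) \<le> (m * K) * r - (m * K) * 0"
      by (rule norm_le_if_vector_derivative_le[OF that us DERIV_cmult_Id]) (rule FK)
    then show ?thesis by (simp add: mult.commute)
  qed
  have u2: "norm (u (?s + h) - u ?s - h *\<^sub>R ?F (u ?s)) \<le> h\<^sup>2 * m\<^sup>2 * (K * L)"
  proof -
    have "norm ((u (?s + h) - h *\<^sub>R ?F (u ?s)) - (u (?s + 0) - 0 *\<^sub>R ?F (u ?s)))
        \<le> (m * (L * (h * (m * K)))) * h - (m * (L * (h * (m * K)))) * 0"
    proof (rule norm_le_if_vector_derivative_le[OF h _ DERIV_cmult_Id])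
      fix r :: real assume r: "0 \<le> r" "r \<le> h"
      show "((\<lambda>r. u (?s + r) - r *\<^sub>R ?F (u ?s)) has_vector_derivative ?F (u (?s + r)) - ?F (u ?s)) (at r)"
        using us[of r] by (auto intro!: derivative_eq_intros)
      have "norm (?F (u (?s + r)) - ?F (u ?s)) \<le> m * (L * norm (u (?s + r) - u ?s))" by (rule FL)
      also have "norm (u (?s + r) - u ?s) \<le> r * (m * K)" using u1 r by simp
      also have "r * (m * K) \<le> h * (m * K)" using r m K by (intro mult_right_mono) auto
      finally show "norm (?F (u (?s + r)) - ?F (u ?s)) \<le> m * (L * (h * (m * K)))"
        using m L(1) by (simp add: mult_left_mono)
    qed
    then show ?thesis by (simp add: algebra_simps power2_eq_square)
  qed
  have c: "norm (fold (euler_step h) Vs ?x - ?x - h *\<^sub>R ?F ?x) \<le> h\<^sup>2 * m\<^sup>2 * (K * L)"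
    unfolding m_def by (rule euler_sweep_consistency) simp
  define e where "e = norm (?x - u ?s)"
  define E where "E = 2 * m\<^sup>2 * (K * L) * h\<^sup>2"
  define q where "q = 1 + h * (m * L)"
  have E0: "E \<ge> 0" using K L(1) by (simp add: E_def)
  have q1: "q \<ge> 1" using h m L(1) by (simp add: q_def)
  have "real (Suc j) * h = ?s + h" by (simp add: algebra_simps)
  then have "(fold (euler_step h) Vs ^^ Suc j) (u 0) - u (real (Suc j) * h) =
      (fold (euler_step h) Vs ?x - ?x - h *\<^sub>R ?F ?x) - (u (?s + h) - u ?s - h *\<^sub>R ?F (u ?s))
      + ((?x - u ?s) + h *\<^sub>R (?F ?x - ?F (u ?s)))"
    by (simp add: algebra_simps)
  also have "norm \<dots> \<le> (h\<^sup>2 * m\<^sup>2 * (K * L) + h\<^sup>2 * m\<^sup>2 * (K * L)) + (e + h * (m * (L * e)))"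
  proof -
    have tri: "norm (a - b + (c + d)) \<le> (norm a + norm b) + (norm c + norm d)" for a b c d :: 'a
      by (rule order_trans[OF norm_triangle_ineq add_mono[OF norm_triangle_ineq4 norm_triangle_ineq]])
    have "norm (h *\<^sub>R (?F ?x - ?F (u ?s))) \<le> h * (m * (L * e))"
      using FL h by (simp add: e_def mult_left_mono)
    then show ?thesis
      by (intro order_trans[OF tri] add_mono u2 c) (simp_all add: e_def)
  qed
  also have "\<dots> = E + q * e" by (simp add: E_def q_def algebra_simps)
  also have "\<dots> \<le> E * q ^ Suc j + q * (real j * E * q ^ j)"
    using Suc.IH q1 E0 unfolding e_def[symmetric] E_def[symmetric] q_def[symmetric]
    by (intro add_mono mult_left_mono) (auto simp: mult_le_cancel_left1 one_le_power simp del: power_Suc)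
  also have "\<dots> = real (Suc j) * E * q ^ Suc j" by (simp add: algebra_simps)
  finally show ?case by (simp add: E_def q_def)
qed simp

end

text \<open>The bound covers all intermediate numbers \<open>j\<close> of sweeps, not only
  \<open>j = k\<close>, because the whole discrete trajectory must later be kept inside the region
  where clipping is inactive.\<close>

lemma euler_sweep_converges:
  fixes Vs :: "('a::banach \<Rightarrow> 'a) list" and u :: "real \<Rightarrow> 'a"
  assumes K: "0 \<le> K" "\<And>V x. V \<in> set Vs \<Longrightarrow> norm (V x) \<le> K"
    and L: "0 \<le> L" "\<And>V x y. V \<in> set Vs \<Longrightarrow> norm (V x - V y) \<le> L * norm (x - y)"
    and u: "\<And>t. (u has_vector_derivative (\<Sum>V\<leftarrow>Vs. V (u t))) (at t)"
    and t: "0 \<le> t"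
  obtains C where "0 \<le> C" "\<And>k j. \<lbrakk>0 < k; j \<le> k\<rbrakk> \<Longrightarrow>
    norm ((fold (euler_step (t / real k)) Vs ^^ j) (u 0) - u (real j * (t / real k))) \<le> C / real k"
proof
  define m where "m = real (length Vs)"
  define D where "D = 2 * m\<^sup>2 * (K * L)"
  define C where "C = D * t\<^sup>2 * exp (t * (m * L))"
  have D0: "0 \<le> D" using K L(1) by (simp add: D_def)
  then show "0 \<le> C" by (simp add: C_def)
  fix k j :: nat assume k: "0 < k" "j \<le> k"
  let ?h = "t / real k"
  have a0: "0 \<le> ?h * (m * L)" using t L(1) by (simp add: m_def)
  have "norm ((fold (euler_step ?h) Vs ^^ j) (u 0) - u (real j * ?h))
     \<le> real j * (D * ?h\<^sup>2) * (1 + ?h * (m * L)) ^ j"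
    unfolding D_def m_def using t by (intro euler_sweep_error K L u) auto
  also have "\<dots> \<le> real k * (D * ?h\<^sup>2) * exp (t * (m * L))"
  proof (rule mult_mono)
    have "(1 + ?h * (m * L)) ^ j \<le> exp (?h * (m * L)) ^ j"
      using a0 by (intro power_mono) auto
    also have "\<dots> = exp (real j * (?h * (m * L)))" by (rule exp_of_nat_mult[symmetric])
    also have "real j * (?h * (m * L)) \<le> real k * (?h * (m * L))"
      using k a0 by (intro mult_right_mono) auto
    also have "\<dots> = t * (m * L)" using k by simp
    finally show "(1 + ?h * (m * L)) ^ j \<le> exp (t * (m * L))" by simp
  qed (use k D0 a0 in \<open>auto intro!: mult_right_mono\<close>)
  also have "\<dots> = C / real k" using k by (simp add: C_def power2_eq_square)
  finally show "norm ((fold (euler_step ?h) Vs ^^ j) (u 0) - u (real j * ?h)) \<le> C / real k" .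
qed

section \<open>Shears of the plane and the single-site measure\<close>

lemma measurable_Complex[measurable (raw)]:
  assumes "f \<in> borel_measurable M" "g \<in> borel_measurable M"
  shows "(\<lambda>x. Complex (f x) (g x)) \<in> borel_measurable M"
  unfolding Complex_eq using assms by measurable

lemma lborel_complex: "(lborel :: complex measure) = distr (lborel \<Otimes>\<^sub>M lborel) borel (\<lambda>(x, y). Complex x y)"
proof (rule lborel_eqI)
  fix l u :: complex assume le: "\<And>b. b \<in> Basis \<Longrightarrow> l \<bullet> b \<le> u \<bullet> b"
  have *: "Re l \<le> Re u" "Im l \<le> Im u" using le[of 1] le[of \<i>] by (auto simp: Basis_complex_def)
  have "(\<lambda>(x, y). Complex x y) -` box l u = {Re l<..<Re u} \<times> {Im l<..<Im u}"
    by (auto simp: in_box_complex_iff)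
  then have "emeasure (distr (lborel \<Otimes>\<^sub>M lborel) borel (\<lambda>(x, y). Complex x y)) (box l u) =
      emeasure (lborel \<Otimes>\<^sub>M lborel) ({Re l<..<Re u} \<times> {Im l<..<Im u})"
    by (subst emeasure_distr) (auto simp: space_pair_measure)
  also have "\<dots> = (\<Prod>b\<in>Basis. (u - l) \<bullet> b)"
    using * by (subst lborel.emeasure_pair_measure_Times)
      (auto simp: Basis_complex_def ennreal_mult[symmetric])
  finally show "emeasure (distr (lborel \<Otimes>\<^sub>M lborel) borel (\<lambda>(x, y). Complex x y)) (box l u) = (\<Prod>b\<in>Basis. (u - l) \<bullet> b)" .
qed simp

text \<open>Both orders of integration are provided so that the coordinate moved by a shear, real or
  imaginary, can be made the inner variable.\<close>

lemma nn_integral_lborel_complex: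
  assumes [measurable]: "f \<in> borel_measurable borel"
  shows "(\<integral>\<^sup>+z. f z \<partial>(lborel :: complex measure)) = (\<integral>\<^sup>+x. \<integral>\<^sup>+y. f (Complex x y) \<partial>lborel \<partial>lborel)"
    and "(\<integral>\<^sup>+z. f z \<partial>(lborel :: complex measure)) = (\<integral>\<^sup>+y. \<integral>\<^sup>+x. f (Complex x y) \<partial>lborel \<partial>lborel)"
proof -
  show *: "(\<integral>\<^sup>+z. f z \<partial>(lborel :: complex measure)) = (\<integral>\<^sup>+x. \<integral>\<^sup>+y. f (Complex x y) \<partial>lborel \<partial>lborel)"
    by (subst lborel_complex, subst nn_integral_distr) (auto simp: lborel.nn_integral_fst[symmetric])
  also have "\<dots> = (\<integral>\<^sup>+y. \<integral>\<^sup>+x. f (Complex x y) \<partial>lborel \<partial>lborel)"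
    by (rule lborel_pair.Fubini') measurable
  finally show "(\<integral>\<^sup>+z. f z \<partial>(lborel :: complex measure)) = (\<integral>\<^sup>+y. \<integral>\<^sup>+x. f (Complex x y) \<partial>lborel \<partial>lborel)" .
qed

text \<open>On the interval \<open>|y| \<le> 1/(4|v|)\<close> the derivative \<open>1 + 2vy\<close>
  is at least 1/2, so the map is an increasing bijection onto an interval; enlarging that interval
  to the whole line gives the inequality. In the application \<open>r\<close> is 1 plus the square
  of the coordinate at rest.\<close>

lemma nn_integral_quadratic_substitution_le:
  fixes h :: "real \<Rightarrow> ennreal"
  assumes [measurable]: "h \<in> borel_measurable borel"
  shows "(\<integral>\<^sup>+y. h (y + v * (r + y\<^sup>2)) * ennreal (1 + 2 * v * y) * indicator {y. 4 * \<bar>v\<bar> * \<bar>y\<bar> \<le> 1} y \<partial>lborel)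
    \<le> (\<integral>\<^sup>+y. h y \<partial>lborel)"
proof (cases "v = 0")
  case False
  define b where "b = 1 / (4 * \<bar>v\<bar>)"
  have b: "b > 0" using False by (simp add: b_def)
  have set: "4 * \<bar>v\<bar> * \<bar>y\<bar> \<le> 1 \<longleftrightarrow> y \<in> {-b..b}" for y
  proof -
    have "4 * \<bar>v\<bar> * \<bar>y\<bar> \<le> 1 \<longleftrightarrow> \<bar>y\<bar> \<le> b" using False by (simp add: b_def field_simps)
    then show ?thesis by (auto simp: abs_le_iff)
  qed
  have "(\<integral>\<^sup>+y. h (y + v * (r + y\<^sup>2)) * ennreal (1 + 2 * v * y) * indicator {-b..b} y \<partial>lborel) =
    (\<integral>\<^sup>+y. h y * indicator {-b + v * (r + (-b)\<^sup>2)..b + v * (r + b\<^sup>2)} y \<partial>lborel)"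
  proof (rule nn_integral_substitution_aux[symmetric])
    fix y assume "y \<in> {-b..b}"
    then have y: "4 * \<bar>v\<bar> * \<bar>y\<bar> \<le> 1" using set by blast
    show "((\<lambda>y. y + v * (r + y\<^sup>2)) has_real_derivative 1 + 2 * v * y) (at y)"
      by (auto intro!: derivative_eq_intros)
    show "0 \<le> 1 + 2 * v * y"
      using y abs_ge_minus_self[of "v * y"] by (simp add: abs_mult)
  qed (use b in \<open>auto intro!: continuous_intros\<close>)
  also have "\<dots> \<le> (\<integral>\<^sup>+y. h y \<partial>lborel)"
    by (intro nn_integral_mono) (auto simp: indicator_def)
  finally show ?thesis unfolding indicator_def mem_Collect_eq set .
qed simp

definition site_density :: "real \<Rightarrow> complex \<Rightarrow> real" where
  "site_density \<beta> z = (1 + 2 * \<beta>) / pi * (1 / (1 + (cmod z)\<^sup>2) powr (2 + 2 * \<beta>))"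

lemma single_site_eq: "single_site \<beta> = density lborel (\<lambda>z. ennreal (site_density \<beta> z))"
  by (simp add: single_site_def site_density_def)

lemma measurable_site_density[measurable]: "site_density \<beta> \<in> borel_measurable borel"
  unfolding site_density_def by measurable

lemma sets_single_site[simp, measurable_cong]: "sets (single_site \<beta>) = sets borel"
  by (simp add: single_site_def)

lemma space_single_site[simp]: "space (single_site \<beta>) = UNIV"
  by (simp add: single_site_def)

definition coord :: "bool \<Rightarrow> complex \<Rightarrow> real" where
  "coord d z = (if d then Re z else Im z)"

definition direction :: "bool \<Rightarrow> complex" where
  "direction d = (if d then 1 else \<i>)"

text \<open>An Euler step of one coordinate with \<open>v\<close> equal to step size times speed.
  The factor \<open>1 + |z|^2\<close> makes it quadratic in the moved coordinate.\<close>

definition shear :: "bool \<Rightarrow> real \<Rightarrow> complex \<Rightarrow> complex" where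
  "shear d v z = z + complex_of_real (v * (1 + (cmod z)\<^sup>2)) * direction d"

text \<open>The weight is the ratio of densities times the Jacobian; the cutoff keeps the step in the range where
  the quadratic map of the moved coordinate is injective.\<close>

definition shear_weight :: "real \<Rightarrow> bool \<Rightarrow> real \<Rightarrow> complex \<Rightarrow> real" where
  "shear_weight \<beta> d v z = (if 4 * \<bar>v\<bar> * \<bar>coord d z\<bar> \<le> 1
     then (1 + 2 * v * coord d z) * ((1 + (cmod z)\<^sup>2) / (1 + (cmod (shear d v z))\<^sup>2)) powr (2 + 2 * \<beta>) else 0)"

lemma measurable_coord[measurable]: "coord d \<in> borel_measurable borel"
  unfolding coord_def by (cases d) auto

lemma measurable_shear[measurable (raw)]:
  assumes [measurable]: "v \<in> borel_measurable M" "z \<in> borel_measurable M"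
  shows "(\<lambda>x. shear d (v x) (z x)) \<in> borel_measurable M"
  unfolding shear_def by measurable

lemma measurable_shear_weight[measurable (raw)]:
  assumes [measurable]: "v \<in> borel_measurable M" "z \<in> borel_measurable M"
  shows "(\<lambda>x. shear_weight \<beta> d (v x) (z x)) \<in> borel_measurable M"
  unfolding shear_weight_def by measurable

lemma shear_weight_nonneg: "0 \<le> shear_weight \<beta> d v z"
proof -
  have "0 \<le> 1 + 2 * v * c" if "4 * \<bar>v\<bar> * \<bar>c\<bar> \<le> 1" for c
    using that abs_ge_minus_self[of "v * c"] by (simp add: abs_mult)
  then show ?thesis by (auto simp: shear_weight_def)
qed

text \<open>The powers of \<open>1 + |z|^2\<close> in the weight exchange the density at
  \<open>z\<close> for the density at the image point; what remains is the Jacobian of the moved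
  coordinate, cut off.\<close>

lemma shear_weight_density:
  "site_density \<beta> z * shear_weight \<beta> d v z =
    site_density \<beta> (shear d v z) * ((1 + 2 * v * coord d z) * indicator {y. 4 * \<bar>v\<bar> * \<bar>y\<bar> \<le> 1} (coord d z))"
proof -
  have "1 + (cmod z)\<^sup>2 > 0" "1 + (cmod (shear d v z))\<^sup>2 > 0" by (simp_all add: add_pos_nonneg)
  then show ?thesis
    by (auto simp: site_density_def shear_weight_def powr_divide field_simps)
qed

text \<open>Over Lebesgue measure the claim is the quadratic substitution on each line parallel to
  the moved coordinate.\<close>

lemma nn_integral_shear_le:
  assumes [measurable]: "f \<in> borel_measurable borel" and \<beta>: "\<beta> > 0"
  shows "(\<integral>\<^sup>+z. f (shear d v z) * ennreal (shear_weight \<beta> d v z) \<partial>single_site \<beta>) \<le> (\<integral>\<^sup>+z. f z \<partial>single_site \<beta>)"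
proof -
  define h where "h z = f z * ennreal (site_density \<beta> z)" for z
  have [measurable]: "h \<in> borel_measurable borel" unfolding h_def by measurable
  define g where "g z = h (shear d v z) * ennreal (1 + 2 * v * coord d z) * indicator {y. 4 * \<bar>v\<bar> * \<bar>y\<bar> \<le> 1} (coord d z)" for z
  have [measurable]: "g \<in> borel_measurable borel" unfolding g_def by measurable
  have dens: "0 \<le> site_density \<beta> z" for z using \<beta> by (simp add: site_density_def)
  have "(\<integral>\<^sup>+z. f (shear d v z) * ennreal (shear_weight \<beta> d v z) \<partial>single_site \<beta>) =
      (\<integral>\<^sup>+z. f (shear d v z) * (ennreal (site_density \<beta> z) * ennreal (shear_weight \<beta> d v z)) \<partial>lborel)"
    unfolding single_site_eq by (subst nn_integral_density) (auto simp: ac_simps)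
  also have "\<dots> = (\<integral>\<^sup>+z. g z \<partial>lborel)"
  proof (intro nn_integral_cong)
    fix z
    have "ennreal (site_density \<beta> z) * ennreal (shear_weight \<beta> d v z) =
      ennreal (site_density \<beta> (shear d v z)) * ennreal ((1 + 2 * v * coord d z) * indicator {y. 4 * \<bar>v\<bar> * \<bar>y\<bar> \<le> 1} (coord d z))"
      by (simp only: ennreal_mult'[OF dens, symmetric] shear_weight_density)
    then show "f (shear d v z) * (ennreal (site_density \<beta> z) * ennreal (shear_weight \<beta> d v z)) = g z"
      by (auto simp: g_def h_def indicator_def ac_simps)
  qed
  \<comment> \<open>The direction \<open>d\<close> decides which coordinate is integrated
    first.\<close>
  also have "\<dots> \<le> (\<integral>\<^sup>+z. h z \<partial>lborel)"
  proof (cases d)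
    case False
    have "g (Complex x y) = h (Complex x (y + v * ((1 + x\<^sup>2) + y\<^sup>2))) * ennreal (1 + 2 * v * y) * indicator {y. 4 * \<bar>v\<bar> * \<bar>y\<bar> \<le> 1} y" for x y
    proof -
      have "shear d v (Complex x y) = Complex x (y + v * ((1 + x\<^sup>2) + y\<^sup>2))"
        using False by (simp add: complex_eq_iff shear_def direction_def cmod_power2)
      then show ?thesis using False by (simp add: g_def coord_def)
    qed
    then show ?thesis
      unfolding nn_integral_lborel_complex(1)[OF \<open>g \<in> _\<close>] nn_integral_lborel_complex(1)[OF \<open>h \<in> _\<close>]
      by (simp only:) (intro nn_integral_mono nn_integral_quadratic_substitution_le, measurable)
  next
    case True
    have "g (Complex x y) = h (Complex (x + v * ((1 + y\<^sup>2) + x\<^sup>2)) y) * ennreal (1 + 2 * v * x) * indicator {y. 4 * \<bar>v\<bar> * \<bar>y\<bar> \<le> 1} x" for x y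
    proof -
      have "shear d v (Complex x y) = Complex (x + v * ((1 + y\<^sup>2) + x\<^sup>2)) y"
        using True by (simp add: complex_eq_iff shear_def direction_def cmod_power2 algebra_simps)
      then show ?thesis using True by (simp add: g_def coord_def)
    qed
    then show ?thesis
      unfolding nn_integral_lborel_complex(2)[OF \<open>g \<in> _\<close>] nn_integral_lborel_complex(2)[OF \<open>h \<in> _\<close>]
      by (simp only:) (intro nn_integral_mono nn_integral_quadratic_substitution_le[where h="\<lambda>x. h (Complex x _)"], measurable)
  qed
  also have "\<dots> = (\<integral>\<^sup>+z. f z \<partial>single_site \<beta>)"
    unfolding single_site_eq h_def by (subst nn_integral_density) (auto simp: ac_simps)
  finally show ?thesis .
qed

lemma nn_integral_one_plus_abs_powr_finite:
  fixes a :: real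
  assumes a: "a > 1"
  shows "(\<integral>\<^sup>+x. ennreal ((1 + \<bar>x\<bar>) powr (- a)) \<partial>lborel) < \<infinity>"
proof -
  define g where "g x = ennreal ((1 + x) powr (- a)) * indicator {0..} x" for x :: real
  have [measurable]: "g \<in> borel_measurable borel" unfolding g_def by measurable
  define c where "c = 1 - a"
  have c: "c < 0" using a by (simp add: c_def)
  have "(\<integral>\<^sup>+x. g x \<partial>lborel) = ennreal (0 - (1 / c) * (1 + 0) powr c)"
    unfolding g_def
  proof (rule nn_integral_FTC_atLeast)
    fix x :: real assume "0 \<le> x"
    then have "((\<lambda>x. (1 / c) * (1 + x) powr c) has_real_derivative (1 / c) * (c * (1 + x) powr (c - 1))) (at x)"
      by (auto intro!: derivative_eq_intros)
    then show "((\<lambda>x. (1 / c) * (1 + x) powr c) has_real_derivative (1 + x) powr (- a)) (at x)"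
      using c by (simp add: c_def)
  next
    have "((\<lambda>x::real. (1 + x) powr c) \<longlongrightarrow> 0) at_top"
      using c by (intro tendsto_neg_powr filterlim_tendsto_add_at_top[OF tendsto_const filterlim_ident]) auto
    then show "((\<lambda>x::real. (1 / c) * (1 + x) powr c) \<longlongrightarrow> 0) at_top"
      by (rule tendsto_mult_right_zero)
  qed auto
  then have fin: "(\<integral>\<^sup>+x. g x \<partial>lborel) < \<infinity>" by simp
  have neg: "(\<integral>\<^sup>+x. g (- x) \<partial>lborel) = (\<integral>\<^sup>+x. g x \<partial>lborel)"
    using nn_integral_real_affine[of g "-1" 0] by simp
  have "(\<integral>\<^sup>+x. ennreal ((1 + \<bar>x\<bar>) powr (- a)) \<partial>lborel) \<le> (\<integral>\<^sup>+x. g x + g (- x) \<partial>lborel)"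
    by (intro nn_integral_mono) (auto simp: g_def indicator_def abs_if)
  also have "\<dots> = (\<integral>\<^sup>+x. g x \<partial>lborel) + (\<integral>\<^sup>+x. g x \<partial>lborel)"
    by (subst nn_integral_add) (auto simp: neg)
  finally show ?thesis using fin by (simp add: order_le_less_trans)
qed

text \<open>The density times the moment decays like \<open>(1 + |z|^2)^(-1-\<beta>)\<close>. The
  inequality \<open>(1+|x|)(1+|y|) \<le> 2(1+x^2+y^2)\<close> bounds this by a product of two
  one-dimensional functions, each integrable since \<open>1 + \<beta> > 1\<close>.\<close>

lemma single_site_moment_finite:
  assumes \<beta>: "\<beta> > 0"
  shows "(\<integral>\<^sup>+z. ennreal ((1 + (cmod z)\<^sup>2) powr (1 + \<beta>)) \<partial>single_site \<beta>) < \<infinity>"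
proof -
  let ?a = "1 + \<beta>"
  define C where "C = (1 + 2 * \<beta>) / pi * 2 powr ?a"
  have C: "C \<ge> 0" using \<beta> by (simp add: C_def)
  let ?g = "\<lambda>x. ennreal ((1 + \<bar>x\<bar>) powr (- ?a))"
  have bound: "site_density \<beta> z * (1 + (cmod z)\<^sup>2) powr ?a \<le> C * ((1 + \<bar>Re z\<bar>) powr (- ?a) * (1 + \<bar>Im z\<bar>) powr (- ?a))" for z
  proof -
    let ?s = "1 + (cmod z)\<^sup>2" and ?p = "(1 + \<bar>Re z\<bar>) * (1 + \<bar>Im z\<bar>)"
    have s: "?s > 0" by (simp add: add_pos_nonneg)
    define x y where "x = \<bar>Re z\<bar>" "y = \<bar>Im z\<bar>"
    have s_eq: "?s = 1 + x\<^sup>2 + y\<^sup>2" by (simp add: cmod_power2 x_y_def)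
    have "2 * (x * y) \<le> x\<^sup>2 + y\<^sup>2" using sum_squares_bound[of x y] by (simp only: mult.assoc)
    then have "1 + x + y + x * y \<le> 2 * (1 + x\<^sup>2 + y\<^sup>2)"
      using sum_squares_bound[of x 1, simplified] sum_squares_bound[of y 1, simplified]
        zero_le_power2[of x] zero_le_power2[of y] by (simp only: distrib_left)
    moreover have "(1 + x) * (1 + y) = 1 + x + y + x * y" by (simp add: algebra_simps)
    ultimately have p: "?p \<le> 2 * ?s"
      unfolding s_eq x_y_def[symmetric] by simp
    have "(1 / ?s powr (2 + 2 * \<beta>)) * ?s powr ?a = ?s powr (- ?a)"
      using s by (simp add: powr_minus_divide powr_add[symmetric] field_simps)
    then have "site_density \<beta> z * ?s powr ?a = (1 + 2 * \<beta>) / pi * ?s powr (- ?a)"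
      unfolding site_density_def by (simp only: mult.assoc)
    also have "\<dots> \<le> (1 + 2 * \<beta>) / pi * (?p / 2) powr (- ?a)"
      using p \<beta> by (intro mult_left_mono powr_mono2') auto
    also have "(?p / 2) powr (- ?a) = 2 powr ?a * ((1 + \<bar>Re z\<bar>) powr (- ?a) * (1 + \<bar>Im z\<bar>) powr (- ?a))"
    proof -
      have "(?p / 2) powr (- ?a) = ?p powr (- ?a) / 2 powr (- ?a)" by (rule powr_divide)
      moreover have "?p powr (- ?a) = (1 + \<bar>Re z\<bar>) powr (- ?a) * (1 + \<bar>Im z\<bar>) powr (- ?a)"
        by (rule powr_mult)
      moreover have "(2::real) powr (- ?a) = 1 / 2 powr ?a" by (rule powr_minus_divide)
      ultimately show ?thesis by simp
    qed
    finally show ?thesis by (simp only: C_def mult.assoc)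
  qed
  have dens: "0 \<le> site_density \<beta> z" for z using \<beta> by (simp add: site_density_def)
  have "(\<integral>\<^sup>+z. ennreal ((1 + (cmod z)\<^sup>2) powr ?a) \<partial>single_site \<beta>) =
      (\<integral>\<^sup>+z. ennreal (site_density \<beta> z * (1 + (cmod z)\<^sup>2) powr ?a) \<partial>lborel)"
    unfolding single_site_eq
    by (subst nn_integral_density) (measurable, simp only: ennreal_mult'[OF dens])
  also have "\<dots> \<le> (\<integral>\<^sup>+z. ennreal C * (?g (Re z) * ?g (Im z)) \<partial>lborel)"
  proof (intro nn_integral_mono)
    fix z
    show "ennreal (site_density \<beta> z * (1 + (cmod z)\<^sup>2) powr ?a) \<le> ennreal C * (?g (Re z) * ?g (Im z))"
      using ennreal_leI[OF bound[of z]] C by (simp add: ennreal_mult)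
  qed
  also have "\<dots> = ennreal C * ((\<integral>\<^sup>+x. ?g x \<partial>lborel) * (\<integral>\<^sup>+x. ?g x \<partial>lborel))"
    by (subst nn_integral_lborel_complex) (simp_all add: nn_integral_cmult nn_integral_multc)
  also have "\<dots> < \<infinity>"
    using nn_integral_one_plus_abs_powr_finite[of ?a] \<beta> by (simp add: ennreal_mult_less_top)
  finally show ?thesis .
qed

section \<open>White noise and the resampling of one site\<close>

lemma sets_white_noise[measurable_cong]: "sets (white_noise \<beta>) = sets (\<Pi>\<^sub>M n\<in>UNIV. borel)"
  unfolding white_noise_def by (intro sets_PiM_cong) simp_all

lemma space_white_noise[simp]: "space (white_noise \<beta>) = UNIV"
  unfolding white_noise_def by (simp add: space_PiM)

lemma measurable_white_noise_component[measurable]: "(\<lambda>a. a n) \<in> borel_measurable (white_noise \<beta>)"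
  unfolding white_noise_def using measurable_component_singleton[of n UNIV "\<lambda>_. single_site \<beta>"]
  by (simp cong: measurable_cong_sets)

lemma measurable_white_noise_fun_upd:
  assumes "f \<in> M \<rightarrow>\<^sub>M white_noise \<beta>" "g \<in> borel_measurable M"
  shows "(\<lambda>x. (f x)(n := g x)) \<in> M \<rightarrow>\<^sub>M white_noise \<beta>"
  unfolding white_noise_def
proof (rule measurable_fun_upd)
  show "f \<in> M \<rightarrow>\<^sub>M Pi\<^sub>M UNIV (\<lambda>_. single_site \<beta>)" using assms(1) by (simp add: white_noise_def)
  show "g \<in> M \<rightarrow>\<^sub>M single_site \<beta>" using assms(2) by (simp cong: measurable_cong_sets)
qed simp

text \<open>The law is unchanged when one coordinate is replaced by an independent copy. This is the
  form of Fubini that lets a single-site inequality act under the infinite product.\<close>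

lemma nn_integral_white_noise_resample:
  assumes \<beta>: "\<beta> > 0" and [measurable]: "F \<in> borel_measurable (white_noise \<beta>)"
  shows "(\<integral>\<^sup>+a. F a \<partial>white_noise \<beta>) = (\<integral>\<^sup>+a. \<integral>\<^sup>+z. F (a(n := z)) \<partial>single_site \<beta> \<partial>white_noise \<beta>)"
proof -
  interpret S: prob_space "single_site \<beta>" using \<beta> by (rule prob_space_single_site)
  interpret W: prob_space "white_noise \<beta>" using \<beta> by (rule prob_space_white_noise)
  interpret P: pair_sigma_finite "single_site \<beta>" "white_noise \<beta>" ..
  have [measurable]: "(\<lambda>(z, a). a(n := z)) \<in> single_site \<beta> \<Otimes>\<^sub>M white_noise \<beta> \<rightarrow>\<^sub>M white_noise \<beta>"
    unfolding case_prod_beta by (rule measurable_white_noise_fun_upd) measurable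
  have "white_noise \<beta> = distr (single_site \<beta> \<Otimes>\<^sub>M white_noise \<beta>) (white_noise \<beta>) (\<lambda>(z, a). a(n := z))"
    using distr_pair_PiM_eq_PiM[of UNIV "\<lambda>_. single_site \<beta>" n] prob_space_single_site[OF \<beta>]
    by (simp add: white_noise_def)
  then have "(\<integral>\<^sup>+a. F a \<partial>white_noise \<beta>) = (\<integral>\<^sup>+a. F a \<partial>distr (single_site \<beta> \<Otimes>\<^sub>M white_noise \<beta>) (white_noise \<beta>) (\<lambda>(z, a). a(n := z)))"
    by simp
  also have "\<dots> = (\<integral>\<^sup>+p. F ((snd p)(n := fst p)) \<partial>(single_site \<beta> \<Otimes>\<^sub>M white_noise \<beta>))"
    by (subst nn_integral_distr) (auto simp: case_prod_beta)
  also have "\<dots> = (\<integral>\<^sup>+a. \<integral>\<^sup>+z. F (a(n := z)) \<partial>single_site \<beta> \<partial>white_noise \<beta>)"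
  proof -
    have "(\<lambda>p. F ((snd p)(n := fst p))) \<in> borel_measurable (single_site \<beta> \<Otimes>\<^sub>M white_noise \<beta>)"
      using measurable_compose[OF \<open>(\<lambda>(z, a). a(n := z)) \<in> _\<close> assms(2)] by (simp add: case_prod_beta)
    from P.nn_integral_snd[OF this] show ?thesis by simp
  qed
  finally show ?thesis .
qed

lemma nn_integral_white_noise_component:
  assumes \<beta>: "\<beta> > 0" and [measurable]: "f \<in> borel_measurable borel"
  shows "(\<integral>\<^sup>+a. f (a n) \<partial>white_noise \<beta>) = (\<integral>\<^sup>+z. f z \<partial>single_site \<beta>)"
proof -
  interpret W: prob_space "white_noise \<beta>" using \<beta> by (rule prob_space_white_noise)
  show ?thesis by (subst nn_integral_white_noise_resample[OF \<beta>, of _ n]) (auto simp: W.emeasure_space_1[simplified])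
qed

lemma nn_integral_white_noise_prod:
  assumes \<beta>: "\<beta> > 0" and [measurable]: "f \<in> borel_measurable borel" and "finite I"
  shows "(\<integral>\<^sup>+a. (\<Prod>n\<in>I. f (a n) :: ennreal) \<partial>white_noise \<beta>) = (\<integral>\<^sup>+z. f z \<partial>single_site \<beta>) ^ card I"
  using \<open>finite I\<close>
proof induction
  case empty
  interpret W: prob_space "white_noise \<beta>" using \<beta> by (rule prob_space_white_noise)
  show ?case using W.emeasure_space_1 by simp
next
  case (insert n I)
  have eq: "(\<Prod>m\<in>I. f ((a(n := z)) m)) = (\<Prod>m\<in>I. f (a m))" for a z
    using insert.hyps by (intro prod.cong) auto
  have "(\<integral>\<^sup>+a. (\<Prod>m\<in>insert n I. f (a m)) \<partial>white_noise \<beta>) =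
      (\<integral>\<^sup>+a. \<integral>\<^sup>+z. f z * (\<Prod>m\<in>I. f (a m)) \<partial>single_site \<beta> \<partial>white_noise \<beta>)"
    using insert.hyps by (subst nn_integral_white_noise_resample[OF \<beta>, of _ n]) (simp_all add: eq del: fun_upd_apply, simp)
  also have "\<dots> = (\<integral>\<^sup>+a. (\<integral>\<^sup>+z. f z \<partial>single_site \<beta>) * (\<Prod>m\<in>I. f (a m)) \<partial>white_noise \<beta>)"
    by (intro nn_integral_cong nn_integral_multc) (simp cong: measurable_cong_sets)
  also have "\<dots> = (\<integral>\<^sup>+z. f z \<partial>single_site \<beta>) * (\<integral>\<^sup>+a. (\<Prod>m\<in>I. f (a m)) \<partial>white_noise \<beta>)"
    by (intro nn_integral_cmult) measurable
  finally show ?case using insert by simp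
qed

section \<open>Single-coordinate moves and their weights\<close>

text \<open>A move updates the real or the imaginary part of one site; its speed does not depend on the value there.\<close>

definition neighbours :: 
"nat \<Rightarrow> (int \<Rightarrow> complex) \<Rightarrow> int \<Rightarrow> complex" where
  "neighbours N a n = (if \<bar>n + 1\<bar> \<le> int N then a (n + 1) else 0) + (if \<bar>n - 1\<bar> \<le> int N then a (n - 1) else 0)"

definition speed :: "nat \<Rightarrow> int \<times> bool \<Rightarrow> (int \<Rightarrow> complex) \<Rightarrow> real" where
  "speed N s a = coord (snd s) (\<i> * neighbours N a (fst s))"

definition move :: "nat \<Rightarrow> real \<Rightarrow> int \<times> bool \<Rightarrow> (int \<Rightarrow> complex) \<Rightarrow> (int \<Rightarrow> complex)" where
  "move N h s a = a(fst s := shear (snd s) (h * speed N s a) (a (fst s)))"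

definition move_weight :: "real \<Rightarrow> nat \<Rightarrow> real \<Rightarrow> int \<times> bool \<Rightarrow> (int \<Rightarrow> complex) \<Rightarrow> real" where
  "move_weight \<beta> N h s a = shear_weight \<beta> (snd s) (h * speed N s a) (a (fst s))"

fun path_weight :: "real \<Rightarrow> nat \<Rightarrow> real \<Rightarrow> (int \<times> bool) list \<Rightarrow> (int \<Rightarrow> complex) \<Rightarrow> real" where
  "path_weight \<beta> N h [] a = 1"
| "path_weight \<beta> N h (s # ss) a = move_weight \<beta> N h s a * path_weight \<beta> N h ss (move N h s a)"

lemma measurable_speed[measurable]: "speed N s \<in> borel_measurable (white_noise \<beta>)"
  unfolding speed_def neighbours_def by measurable

lemma measurable_move[measurable]: "move N h s \<in> white_noise \<beta> \<rightarrow>\<^sub>M white_noise \<beta>"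
  unfolding move_def by (rule measurable_white_noise_fun_upd) measurable

lemma measurable_move_weight[measurable]: "move_weight \<beta> N h s \<in> borel_measurable (white_noise \<beta>')"
  unfolding move_weight_def by measurable

lemma measurable_fold_move[measurable]: "fold (move N h) ss \<in> white_noise \<beta> \<rightarrow>\<^sub>M white_noise \<beta>"
proof (induction ss)
  case (Cons s ss)
  then show ?case using measurable_comp[OF measurable_move Cons] by (simp add: comp_def)
qed (simp add: id_def)

lemma measurable_path_weight[measurable]: "path_weight \<beta> N h ss \<in> borel_measurable (white_noise \<beta>')"
  by (induction ss) (simp_all add: fun_eq_iff[symmetric])

lemma path_weight_nonneg: "0 \<le> path_weight \<beta> N h ss a"
  by (induction ss arbitrary: a) (auto simp: move_weight_def shear_weight_nonneg)

text \<open>A site is not its own neighbour. Hence with all other sites frozen a move is a shear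
  whose \<open>v\<close> is constant.\<close>

lemma speed_fun_upd: "speed N s (a(fst s := z)) = speed N s a"
  unfolding speed_def neighbours_def by auto

text \<open>Resample the moved site: in the inner integral the speed is a constant, and the shear
  inequality applies for each configuration of the other sites.\<close>

lemma nn_integral_move_le:
  assumes \<beta>: "\<beta> > 0" and [measurable]: "F \<in> borel_measurable (white_noise \<beta>)"
  shows "(\<integral>\<^sup>+a. F (move N h s a) * ennreal (move_weight \<beta> N h s a) \<partial>white_noise \<beta>) \<le> (\<integral>\<^sup>+a. F a \<partial>white_noise \<beta>)"
proof -
  have meas: "(\<lambda>z. F (a(fst s := z))) \<in> borel_measurable borel" for a
  proof -
    have "(\<lambda>z. a(fst s := z)) \<in> borel \<rightarrow>\<^sub>M white_noise \<beta>"
      by (rule measurable_white_noise_fun_upd) auto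
    from measurable_compose[OF this assms(2)] show ?thesis .
  qed
  have "(\<integral>\<^sup>+a. F (move N h s a) * ennreal (move_weight \<beta> N h s a) \<partial>white_noise \<beta>) =
     (\<integral>\<^sup>+a. \<integral>\<^sup>+z. F (a(fst s := shear (snd s) (h * speed N s a) z)) * ennreal (shear_weight \<beta> (snd s) (h * speed N s a) z)
       \<partial>single_site \<beta> \<partial>white_noise \<beta>)"
    by (subst nn_integral_white_noise_resample[OF \<beta>, of _ "fst s"])
       (simp_all add: move_def move_weight_def speed_fun_upd, (subst move_def[symmetric] move_weight_def[symmetric])+, measurable)
  also have "\<dots> \<le> (\<integral>\<^sup>+a. \<integral>\<^sup>+z. F (a(fst s := z)) \<partial>single_site \<beta> \<partial>white_noise \<beta>)"
    by (intro nn_integral_mono nn_integral_shear_le[OF meas \<beta>])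
  also have "\<dots> = (\<integral>\<^sup>+a. F a \<partial>white_noise \<beta>)"
    by (rule nn_integral_white_noise_resample[symmetric]) fact+
  finally show ?thesis .
qed

text \<open>The remaining path together with its weight is again a measurable nonnegative function,
  so the single-move inequality can peel off the first move.\<close>

lemma nn_integral_path_le:
  assumes \<beta>: "\<beta> > 0" and [measurable]: "F \<in> borel_measurable (white_noise \<beta>)"
  shows "(\<integral>\<^sup>+a. F (fold (move N h) ss a) * ennreal (path_weight \<beta> N h ss a) \<partial>white_noise \<beta>) \<le> (\<integral>\<^sup>+a. F a \<partial>white_noise \<beta>)"
proof (induction ss)
  case (Cons s ss)
  let ?g = "\<lambda>a. F (fold (move N h) ss a) * ennreal (path_weight \<beta> N h ss a)"
  have "(\<integral>\<^sup>+a. F (fold (move N h) (s # ss) a) * ennreal (path_weight \<beta> N h (s # ss) a) \<partial>white_noise \<beta>) =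
     (\<integral>\<^sup>+a. ?g (move N h s a) * ennreal (move_weight \<beta> N h s a) \<partial>white_noise \<beta>)"
    by (intro nn_integral_cong) (simp add: ennreal_mult path_weight_nonneg move_weight_def shear_weight_nonneg ac_simps)
  also have "\<dots> \<le> (\<integral>\<^sup>+a. ?g a \<partial>white_noise \<beta>)"
    by (rule nn_integral_move_le[OF \<beta>]) measurable
  finally show ?case using Cons by simp
qed simp

section \<open>The truncated system\<close>

definition velocity :: "nat \<Rightarrow> int \<times> bool \<Rightarrow> (int \<Rightarrow> complex) \<Rightarrow> complex" where
  "velocity N s a = complex_of_real (speed N s a * (1 + (cmod (a (fst s)))\<^sup>2)) * direction (snd s)"

lemma move_eq_velocity: "move N h s a = a(fst s := a (fst s) + h *\<^sub>R velocity N s a)"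
  by (simp add: move_def velocity_def shear_def scaleR_conv_of_real mult.assoc)

lemma norm_direction[simp]: "cmod (direction d) = 1"
  by (simp add: direction_def)

lemma abs_coord_le: "\<bar>coord d z\<bar> \<le> cmod z"
  by (simp add: coord_def abs_Re_le_cmod abs_Im_le_cmod)

lemma coord_diff: "coord d z - coord d w = coord d (z - w)"
  by (simp add: coord_def)

lemma norm_neighbours_le:
  assumes "\<And>n. \<bar>n\<bar> \<le> int N \<Longrightarrow> cmod (a n) \<le> R" "0 \<le> R"
  shows "cmod (neighbours N a n) \<le> 2 * R"
proof -
  have *: "cmod (if \<bar>m\<bar> \<le> int N then a m else 0) \<le> R" for m using assms by simp
  show ?thesis
    using order_trans[OF norm_triangle_ineq add_mono[OF *[of "n + 1"] *[of "n - 1"]]]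
    unfolding neighbours_def by simp
qed

lemma abs_speed_le:
  assumes "\<And>n. \<bar>n\<bar> \<le> int N \<Longrightarrow> cmod (a n) \<le> R" "0 \<le> R"
  shows "\<bar>speed N s a\<bar> \<le> 2 * R"
proof -
  have "\<bar>speed N s a\<bar> \<le> cmod (\<i> * neighbours N a (fst s))"
    unfolding speed_def by (rule abs_coord_le)
  also have "\<dots> \<le> 2 * R"
    unfolding norm_mult using norm_neighbours_le[OF assms] by simp
  finally show ?thesis .
qed

lemma abs_speed_diff_le:
  assumes "\<And>n. cmod (a n - b n) \<le> D"
  shows "\<bar>speed N s a - speed N s b\<bar> \<le> 2 * D"
proof -
  have D: "0 \<le> D" using assms[of 0] norm_ge_zero order_trans by blast
  have "\<bar>speed N s a - speed N s b\<bar> \<le> cmod (\<i> * neighbours N a (fst s) - \<i> * neighbours N b (fst s))"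
    unfolding speed_def coord_diff by (rule abs_coord_le)
  also have "\<dots> = cmod (neighbours N a (fst s) - neighbours N b (fst s))"
    by (simp add: right_diff_distrib[symmetric] norm_mult del: right_diff_distrib)
  also have "neighbours N a (fst s) - neighbours N b (fst s) = neighbours N (\<lambda>n. a n - b n) (fst s)"
    by (simp add: neighbours_def)
  also have "cmod \<dots> \<le> 2 * D"
    using assms D by (intro norm_neighbours_le)
  finally show ?thesis .
qed

lemma norm_velocity_le:
  assumes "\<And>n. cmod (a n) \<le> R"
  shows "cmod (velocity N s a) \<le> 2 * R * (1 + R\<^sup>2)"
proof -
  have R: "0 \<le> R" using assms[of 0] norm_ge_zero order_trans by blast
  have "cmod (velocity N s a) = \<bar>speed N s a\<bar> * (1 + (cmod (a (fst s)))\<^sup>2)"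
    by (simp add: velocity_def norm_mult abs_mult del: of_real_mult of_real_add)
  also have "\<dots> \<le> (2 * R) * (1 + R\<^sup>2)"
    using assms R by (intro mult_mono abs_speed_le add_mono power_mono) auto
  finally show ?thesis .
qed

text \<open>The difference of two products is split into (change of speed) times (1 + |a|^2) plus
  speed times (change of |.|^2); the two summands of the constant come from these terms.\<close>

lemma norm_velocity_diff_le:
  assumes a: "\<And>n. cmod (a n) \<le> R" and b: "\<And>n. cmod (b n) \<le> R" and D: "\<And>n. cmod (a n - b n) \<le> D"
  shows "cmod (velocity N s a - velocity N s b) \<le> (2 * (1 + R\<^sup>2) + 4 * R\<^sup>2) * D"
proof -
  have R: "0 \<le> R" using a[of 0] norm_ge_zero order_trans by blast
  have D0: "0 \<le> D" using D[of 0] norm_ge_zero order_trans by blast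
  let ?n = "fst s"
  let ?p = "1 + (cmod (a ?n))\<^sup>2" and ?q = "1 + (cmod (b ?n))\<^sup>2"
  have "velocity N s a - velocity N s b = complex_of_real (speed N s a * ?p - speed N s b * ?q) * direction (snd s)"
    by (simp add: velocity_def algebra_simps)
  then have "cmod (velocity N s a - velocity N s b) = \<bar>speed N s a * ?p - speed N s b * ?q\<bar>"
    by (simp add: norm_mult del: of_real_mult of_real_add of_real_diff)
  also have "\<dots> = \<bar>(speed N s a - speed N s b) * ?p + speed N s b * (?p - ?q)\<bar>"
    by (simp add: algebra_simps)
  also have "\<dots> \<le> \<bar>speed N s a - speed N s b\<bar> * ?p + \<bar>speed N s b\<bar> * \<bar>?p - ?q\<bar>"
    by (rule order_trans[OF abs_triangle_ineq]) (simp add: abs_mult)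
  also have "\<dots> \<le> (2 * D) * (1 + R\<^sup>2) + (2 * R) * (2 * R * D)"
  proof (intro add_mono mult_mono abs_speed_diff_le abs_speed_le D b power_mono a)
    have "?p - ?q = (cmod (a ?n) - cmod (b ?n)) * (cmod (a ?n) + cmod (b ?n))"
      by (simp add: power2_eq_square algebra_simps)
    then have "\<bar>?p - ?q\<bar> = \<bar>cmod (a ?n) - cmod (b ?n)\<bar> * (cmod (a ?n) + cmod (b ?n))"
      by (simp add: abs_mult)
    also have "\<dots> \<le> D * (R + R)"
      using a b D D0 norm_triangle_ineq3[of "a ?n" "b ?n"] by (intro mult_mono add_mono) (auto intro: order_trans)
    finally show "\<bar>?p - ?q\<bar> \<le> 2 * R * D" by (simp add: algebra_simps)
  qed (use R D0 in auto)
  finally show ?thesis by (simp add: algebra_simps power2_eq_square)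
qed

section \<open>Bounded sequences as a Banach space, and the clipped fields\<close>

lemma bcontfun_int_iff: "f \<in> bcontfun \<longleftrightarrow> bounded (range f)" for f :: "int \<Rightarrow> complex"
  by (simp add: bcontfun_def continuous_on_discrete)

definition single :: "int \<Rightarrow> complex \<Rightarrow> int \<Rightarrow>\<^sub>C complex" where
  "single n z = Bcontfun (\<lambda>m. if m = n then z else 0)"

lemma apply_single[simp]: "apply_bcontfun (single n z) m = (if m = n then z else 0)"
proof -
  have "range (\<lambda>m. if m = n then z else 0) \<subseteq> {z, 0}" by auto
  then have "(\<lambda>m. if m = n then z else 0) \<in> bcontfun"
    unfolding bcontfun_int_iff by (rule bounded_subset[rotated]) auto
  then show ?thesis by (simp add: single_def Bcontfun_inverse)
qed

text \<open>White-noise configurations are arbitrary functions on the integers; finite support is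
  what brings them into the Banach space of bounded sequences.\<close>

definition truncate :: "nat \<Rightarrow> (int \<Rightarrow> complex) \<Rightarrow> int \<Rightarrow>\<^sub>C complex" where
  "truncate N a = Bcontfun (\<lambda>m. if \<bar>m\<bar> \<le> int N then a m else 0)"

lemma apply_truncate[simp]: "apply_bcontfun (truncate N a) m = (if \<bar>m\<bar> \<le> int N then a m else 0)"
proof -
  have "range (\<lambda>m. if \<bar>m\<bar> \<le> int N then a m else 0) \<subseteq> insert 0 (a ` {- int N..int N})"
    by (force simp: abs_le_iff)
  then have "(\<lambda>m. if \<bar>m\<bar> \<le> int N then a m else 0) \<in> bcontfun"
    unfolding bcontfun_int_iff by (rule bounded_subset[rotated]) (intro finite_imp_bounded finite.insertI finite_imageI finite_atLeastAtMost_int)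
  then show ?thesis by (simp add: truncate_def Bcontfun_inverse)
qed

lemma norm_single_le: "norm (single n z) \<le> cmod z"
  by (rule norm_bound) auto

lemma single_diff: "single n z - single n w = single n (z - w)"
  by (rule bcontfun_eqI) simp

lemma norm_apply_le: "cmod (apply_bcontfun x n) \<le> norm x"
  by (rule norm_bounded)

lemma bounded_linear_apply: "bounded_linear (\<lambda>x :: int \<Rightarrow>\<^sub>C complex. apply_bcontfun x n)"
  by (rule bounded_linear_intro[where K=1]) (simp_all add: norm_apply_le)

text \<open>Projection onto a convex set is nonexpansive. Clipped fields are therefore globally
  bounded and Lipschitz, as the Picard and Euler results require.\<close>

definition clip :: "real \<Rightarrow> complex \<Rightarrow> complex" where
  "clip R = closest_point (cball 0 R)"

lemma norm_clip_le: "0 \<le> R \<Longrightarrow> cmod (clip R z) \<le> R"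
  using closest_point_in_set[of "cball 0 R" z] by (simp add: clip_def)

lemma clip_eq: "cmod z \<le> R \<Longrightarrow> clip R z = z"
  by (simp add: clip_def closest_point_self)

lemma norm_clip_diff_le: "0 \<le> R \<Longrightarrow> cmod (clip R z - clip R w) \<le> cmod (z - w)"
  using closest_point_lipschitz[of "cball 0 R" z w] by (simp add: clip_def dist_norm)

definition clipped_field :: "nat \<Rightarrow> real \<Rightarrow> int \<times> bool \<Rightarrow> (int \<Rightarrow>\<^sub>C complex) \<Rightarrow> int \<Rightarrow>\<^sub>C complex" where
  "clipped_field N R s x = single (fst s) (velocity N s (\<lambda>m. clip R (apply_bcontfun x m)))"

lemma norm_clipped_field_le:
  assumes "0 \<le> R"
  shows "norm (clipped_field N R s x) \<le> 2 * R * (1 + R\<^sup>2)"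
  unfolding clipped_field_def
  by (rule order_trans[OF norm_single_le norm_velocity_le]) (rule norm_clip_le[OF assms])

lemma norm_clipped_field_diff_le:
  assumes "0 \<le> R"
  shows "norm (clipped_field N R s x - clipped_field N R s y) \<le> (2 * (1 + R\<^sup>2) + 4 * R\<^sup>2) * norm (x - y)"
  unfolding clipped_field_def single_diff
proof (rule order_trans[OF norm_single_le norm_velocity_diff_le])
  fix n
  show "cmod (clip R (apply_bcontfun x n) - clip R (apply_bcontfun y n)) \<le> norm (x - y)"
    using norm_clip_diff_le[OF assms] norm_apply_le[of "x - y" n] by (force intro: order_trans)
qed (simp_all add: norm_clip_le assms)

definition sites :: "nat \<Rightarrow> (int \<times> bool) list" where
  "sites N = List.product [- int N..int N] [True, False]"

lemma set_sites: "s \<in> set (sites N) \<longleftrightarrow> \<bar>fst s\<bar> \<le> int N"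
  by (cases s) (auto simp: sites_def)

lemma neighbours_cong:
  assumes "\<And>m. \<bar>m\<bar> \<le> int N \<Longrightarrow> a m = b m"
  shows "neighbours N a n = neighbours N b n"
  using assms by (simp add: neighbours_def)

lemma velocity_cong:
  assumes "\<And>m. \<bar>m\<bar> \<le> int N \<Longrightarrow> a m = b m" "\<bar>fst s\<bar> \<le> int N"
  shows "velocity N s a = velocity N s b"
  using assms neighbours_cong[of N a b "fst s"] by (simp add: velocity_def speed_def)

text \<open>The two speeds at a site are the real and the imaginary part of \<open>\<i>\<close>
  times the neighbour sum, so the two moves of a site together realise its equation.\<close>

lemma velocity_sum: "velocity N (n, True) a + velocity N (n, False) a =
    \<i> * (1 + complex_of_real ((cmod (a n))\<^sup>2)) * neighbours N a n"
  by (simp add: velocity_def speed_def coord_def direction_def complex_eq_iff)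

lemma apply_sum_list: "apply_bcontfun (\<Sum>V\<leftarrow>Vs. f V) m = (\<Sum>V\<leftarrow>Vs. apply_bcontfun (f V) m)"
  by (induction Vs) simp_all

lemma sum_clipped_fields:
  "apply_bcontfun (\<Sum>s\<leftarrow>sites N. clipped_field N R s x) m = (if \<bar>m\<bar> \<le> int N then
    \<i> * (1 + complex_of_real ((cmod (clip R (apply_bcontfun x m)))\<^sup>2)) * neighbours N (\<lambda>n. clip R (apply_bcontfun x n)) m else 0)"
proof -
  let ?a = "\<lambda>n. clip R (apply_bcontfun x n)"
  have "apply_bcontfun (\<Sum>s\<leftarrow>sites N. clipped_field N R s x) m =
      (\<Sum>s\<in>set (sites N). if m = fst s then velocity N s ?a else 0)"
    unfolding apply_sum_list by (subst sum_list_distinct_conv_sum_set)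
      (auto simp: clipped_field_def sites_def distinct_product)
  also have "set (sites N) = {- int N..int N} \<times> {True, False}" by (simp add: sites_def)
  also have "(\<Sum>s\<in>{- int N..int N} \<times> {True, False}. if m = fst s then velocity N s ?a else 0) =
      (\<Sum>n\<in>{- int N..int N}. if m = n then velocity N (n, True) ?a + velocity N (n, False) ?a else 0)"
    unfolding sum.cartesian_product' by (intro sum.cong) auto
  also have "\<dots> = (if m \<in> {- int N..int N} then velocity N (m, True) ?a + velocity N (m, False) ?a else 0)"
    by (subst sum.delta') auto
  finally show ?thesis unfolding velocity_sum by (auto simp: abs_le_iff)
qed

text \<open>Completeness of \<open>bcontfun\<close> asks for a metric domain. Distinct integers are
  at distance at least 1, so this metric induces the discrete topology, for which all bounded
  sequences are continuous.\<close>

instantiation int :: metric_space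
begin

definition dist_int :: "int \<Rightarrow> int \<Rightarrow> real" where
  "dist_int x y = real_of_int \<bar>x - y\<bar>"

definition uniformity_int :: "(int \<times> int) filter" where
  "uniformity_int = (INF e\<in>{0 <..}. principal {(x, y). dist x y < e})"

instance
proof
  show unif: "uniformity = (INF e\<in>{0 <..}. principal {(x :: int, y). dist x y < e})"
    by (rule uniformity_int_def)
  fix U :: "int set"
  have "eventually (\<lambda>(x', y). x' = x \<longrightarrow> y \<in> U) uniformity" if "x \<in> U" for x
    unfolding unif
    by (rule eventually_INF1[of 1]) (use that in \<open>auto simp: eventually_principal dist_int_def simp del: of_int_abs of_int_diff\<close>)
  then show "open U \<longleftrightarrow> (\<forall>x\<in>U. eventually (\<lambda>(x', y). x' = x \<longrightarrow> y \<in> U) uniformity)"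
    using discrete_topology_class.open_discrete[of U] by blast
qed (auto simp: dist_int_def)

end

instance bcontfun :: (metric_space, banach) banach ..

text \<open>Multiplication by \<open>\<i>\<close> is antisymmetric for the real inner product, so
  \<open>z n\<close> against \<open>\<i> * z (n - 1)\<close> is \<open>- g (n - 1)\<close> and the
  sum telescopes. The two boundary currents vanish with \<open>z\<close> outside the box.\<close>

lemma inner_i_mult_neighbour_sum:
  fixes z :: "int \<Rightarrow> complex"
  assumes z: "\<And>m. \<bar>m\<bar> > int N \<Longrightarrow> z m = 0"
  shows "(\<Sum>n\<in>{- int N..int N}. z n \<bullet> (\<i> * (z (n + 1) + z (n - 1)))) = 0"
proof -
  define g where "g n = z n \<bullet> (\<i> * z (n + 1))" for n
  have "z n \<bullet> (\<i> * (z (n + 1) + z (n - 1))) = g n - g (n - 1)" for n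
    by (simp add: g_def inner_complex_def algebra_simps)
  moreover have "(\<Sum>n\<in>{- int M..int M}. g n - g (n - 1)) = g (int M) - g (- int M - 1)" for M
  proof (induction M)
    case (Suc M)
    have "{- int (Suc M)..int (Suc M)} = insert (int M + 1) (insert (- int M - 1) {- int M..int M})" by auto
    then have "(\<Sum>n\<in>{- int (Suc M)..int (Suc M)}. g n - g (n - 1)) =
        (g (int M + 1) - g (int M)) + ((g (- int M - 1) - g (- int M - 2)) + (\<Sum>n\<in>{- int M..int M}. g n - g (n - 1)))"
      by (simp add: algebra_simps)
    then show ?case unfolding Suc by (simp add: algebra_simps)
  qed simp
  ultimately show ?thesis using z[of "int N + 1"] z[of "- int N - 1"] by (simp add: g_def)
qed

text \<open>Besides being conserved, this is the quantity in the law: on the box, white noise has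
  density proportional to \<open>mass^(-(2+2\<beta>))\<close>.\<close>

definition mass :: "nat \<Rightarrow> (int \<Rightarrow> complex) \<Rightarrow> real" where
  "mass N a = (\<Prod>n\<in>{- int N..int N}. 1 + (cmod (a n))\<^sup>2)"

lemma mass_factor_le: "\<bar>n\<bar> \<le> int N \<Longrightarrow> 1 + (cmod (a n))\<^sup>2 \<le> mass N a"
  unfolding mass_def
  by (rule order_trans[OF _ prod_mono2[of "{- int N..int N}" "{n}"]]) (auto simp: add_nonneg_nonneg)

lemma mass_ge_1: "1 \<le> mass N a"
  unfolding mass_def by (rule prod_ge_1) simp

lemma norm_le_mass:
  assumes "\<bar>n\<bar> \<le> int N"
  shows "cmod (a n) \<le> mass N a"
proof (rule power2_le_imp_le)
  have "(cmod (a n))\<^sup>2 \<le> mass N a" using mass_factor_le[OF assms, of a] by simp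
  also have "\<dots> \<le> (mass N a)\<^sup>2" using mass_ge_1[of N a] by (simp add: power2_eq_square)
  finally show "(cmod (a n))\<^sup>2 \<le> (mass N a)\<^sup>2" .
qed (use mass_ge_1[of N a] in simp)

lemma has_real_derivative_norm_power2:
  assumes "(f has_vector_derivative f') (at t)"
  shows "((\<lambda>t. (cmod (f t))\<^sup>2) has_real_derivative 2 * (f t \<bullet> f')) (at t)"
proof -
  have "((\<lambda>t. f t \<bullet> f t) has_vector_derivative (f t \<bullet> f' + f' \<bullet> f t)) (at t)"
    by (rule bounded_bilinear.has_vector_derivative[OF bounded_bilinear_inner assms assms])
  then show ?thesis
    by (simp add: has_real_derivative_iff_has_vector_derivative power2_norm_eq_inner inner_commute)
qed

text \<open>Clipping never becomes active. While the product keeps its initial value, every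
  component is at most \<open>mass N a < R\<close>, and as long as the norm stays below
  \<open>R\<close> the product does not change; a connectedness argument in time closes the
  circle.\<close>

lemma clipped_flow_exists:
  fixes a :: "int \<Rightarrow> complex"
  assumes R: "mass N a < R"
  obtains u :: "real \<Rightarrow> int \<Rightarrow>\<^sub>C complex"
  where "u 0 = truncate N a"
    "\<And>t. (u has_vector_derivative (\<Sum>s\<leftarrow>sites N. clipped_field N R s (u t))) (at t)"
    "\<And>t n. \<bar>n\<bar> > int N \<Longrightarrow> apply_bcontfun (u t) n = 0"
    "\<And>t. mass N (apply_bcontfun (u t)) = mass N a"
proof -
  have R0: "0 < R" using R mass_ge_1[of N a] by simp
  let ?L = "2 * (1 + R\<^sup>2) + 4 * R\<^sup>2"
  let ?F = "\<lambda>x. \<Sum>s\<leftarrow>sites N. clipped_field N R s x"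
  have "norm (?F x - ?F y) \<le> (real (length (sites N)) * ?L) * norm (x - y)" for x y
  proof -
    have "norm (\<Sum>s\<leftarrow>sites N. clipped_field N R s x - clipped_field N R s y) \<le> real (length (sites N)) * (?L * norm (x - y))"
      using R0 by (intro norm_sum_list_le norm_clipped_field_diff_le) simp
    then show ?thesis by (simp only: sum_list_subtractf mult.assoc)
  qed
  from picard_global[of ?F, OF this] obtain u where u0: "u 0 = truncate N a"
    and u: "\<And>t. (u has_vector_derivative ?F (u t)) (at t)" by blast
  have un: "((\<lambda>t. apply_bcontfun (u t) n) has_vector_derivative apply_bcontfun (?F (u t)) n) (at t)" for n t
    by (rule bounded_linear.has_vector_derivative[OF bounded_linear_apply u])
  \<comment> \<open>Outside the box the field has no component, so the solution keeps its truncated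
    initial value 0 there.\<close>
  have zero: "apply_bcontfun (u t) n = 0" if n: "\<bar>n\<bar> > int N" for n t
  proof -
    have "((\<lambda>t. apply_bcontfun (u t) n) has_vector_derivative 0) (at t)" for t
      using un[of n t] n by (simp add: sum_clipped_fields)
    then have "(\<lambda>t. apply_bcontfun (u t) n) constant_on UNIV"
      by (intro has_derivative_zero_constant[THEN iffD1[OF constant_on_def[symmetric, THEN meta_eq_to_obj_eq]]])
         (auto simp: has_vector_derivative_def constant_on_def)
    then have "apply_bcontfun (u t) n = apply_bcontfun (u 0) n" by (auto simp: constant_on_def)
    then show ?thesis using n by (simp add: u0)
  qed
  \<comment> \<open>In the derivative of the logarithm of the product, the factor
    \<open>1 + |z|^2\<close> of the field cancels the denominator, and the telescoping sum
    remains.\<close>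
  define E where "E t = (\<Sum>n\<in>{- int N..int N}. ln (1 + (cmod (apply_bcontfun (u t) n))\<^sup>2))" for t
  have expE: "mass N (apply_bcontfun (u t)) = exp (E t)" for t
    unfolding E_def mass_def exp_sum[OF finite_atLeastAtMost_int]
    by (intro prod.cong refl exp_ln[symmetric]) (simp add: add_pos_nonneg)
  have mass0: "mass N (apply_bcontfun (u 0)) = mass N a"
    unfolding mass_def by (intro prod.cong) (auto simp: u0 abs_le_iff)
  have contu: "continuous_on UNIV u"
    using u has_vector_derivative_continuous by (intro continuous_at_imp_continuous_on) blast
  have E': "(E has_real_derivative 0) (at t)" if t: "norm (u t) < R" for t
  proof -
    let ?z = "apply_bcontfun (u t)"
    have clip: "clip R (?z n) = ?z n" for n
      using norm_apply_le[of "u t" n] t by (intro clip_eq) simp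
    have nb: "neighbours N ?z n = ?z (n + 1) + ?z (n - 1)" for n
      using zero by (auto simp: neighbours_def)
    have "(E has_real_derivative (\<Sum>n\<in>{- int N..int N}. 2 * (?z n \<bullet> apply_bcontfun (?F (u t)) n) / (1 + (cmod (?z n))\<^sup>2))) (at t)"
      unfolding E_def
    proof (rule DERIV_sum)
      fix n
      have pos: "1 + (cmod (?z n))\<^sup>2 > 0" by (simp add: add_pos_nonneg)
      have "((\<lambda>t. 1 + (cmod (apply_bcontfun (u t) n))\<^sup>2) has_real_derivative 2 * (?z n \<bullet> apply_bcontfun (?F (u t)) n)) (at t)"
        using DERIV_add[OF DERIV_const has_real_derivative_norm_power2[OF un]] by simp
      from DERIV_chain2[OF DERIV_ln[OF pos] this]
      show "((\<lambda>t. ln (1 + (cmod (apply_bcontfun (u t) n))\<^sup>2)) has_real_derivative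
          2 * (?z n \<bullet> apply_bcontfun (?F (u t)) n) / (1 + (cmod (?z n))\<^sup>2)) (at t)"
        by (simp add: divide_inverse mult.commute)
    qed
    also have "(\<Sum>n\<in>{- int N..int N}. 2 * (?z n \<bullet> apply_bcontfun (?F (u t)) n) / (1 + (cmod (?z n))\<^sup>2)) =
        (\<Sum>n\<in>{- int N..int N}. 2 * (?z n \<bullet> (\<i> * (?z (n + 1) + ?z (n - 1)))))"
    proof (intro sum.cong refl)
      fix n assume "n \<in> {- int N..int N}"
      then have n: "\<bar>n\<bar> \<le> int N" by auto
      have pos: "1 + (cmod (?z n))\<^sup>2 > 0" by (simp add: add_pos_nonneg)
      have "apply_bcontfun (?F (u t)) n = (1 + (cmod (?z n))\<^sup>2) *\<^sub>R (\<i> * (?z (n + 1) + ?z (n - 1)))"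
        using n by (simp add: sum_clipped_fields clip nb scaleR_conv_of_real)
      then show "2 * (?z n \<bullet> apply_bcontfun (?F (u t)) n) / (1 + (cmod (?z n))\<^sup>2) = 2 * (?z n \<bullet> (\<i> * (?z (n + 1) + ?z (n - 1))))"
        using pos by simp
    qed
    also have "\<dots> = 0"
      using inner_i_mult_neighbour_sum[of N ?z] zero by (simp add: sum_distrib_left[symmetric])
    finally show ?thesis .
  qed
  have "1 + (cmod z)\<^sup>2 \<noteq> 0" for z using zero_le_power2[of "cmod z"] by linarith
  then have contE: "continuous_on UNIV E"
    unfolding E_def
    by (intro continuous_intros continuous_on_compose2[OF bounded_linear.continuous_on[OF bounded_linear_apply continuous_on_id] contu])
       auto
  \<comment> \<open>This set of times is nonempty, closed and open, hence everything. Openness uses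
    the strict margin between \<open>mass N a\<close> and \<open>R\<close>.\<close>
  define Z where "Z = {t. E t = E 0}"
  have "closed Z" unfolding Z_def using contE by (intro closed_Collect_eq) auto
  moreover have "open Z"
  proof (rule openI)
    fix t assume "t \<in> Z"
    then have "mass N (apply_bcontfun (u t)) = mass N a" using mass0 by (simp add: expE Z_def)
    then have "cmod (apply_bcontfun (u t) n) \<le> mass N a" for n
      using norm_le_mass[of n N "apply_bcontfun (u t)"] zero[of n t] mass_ge_1[of N a]
      by (cases "\<bar>n\<bar> \<le> int N") auto
    then have "norm (u t) \<le> mass N a" by (rule norm_bound)
    then have "norm (u t) < R" using R by simp
    moreover have "open {t. norm (u t) < R}"
      using contu by (intro open_Collect_less continuous_intros) auto
    ultimately obtain e where e: "e > 0" "ball t e \<subseteq> {t. norm (u t) < R}"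
      by (metis (mono_tags, lifting) mem_Collect_eq open_contains_ball)
    have "\<exists>c. \<forall>x\<in>ball t e. E x = c"
    proof (rule has_derivative_zero_constant)
      fix x assume "x \<in> ball t e"
      then have "(E has_real_derivative 0) (at x)" using e(2) by (intro E') auto
      then show "(E has_derivative (\<lambda>h. 0)) (at x within ball t e)"
        unfolding has_field_derivative_def lambda_zero by (rule has_derivative_at_withinI)
    qed simp
    then have "ball t e \<subseteq> Z" using \<open>t \<in> Z\<close> e(1) unfolding Z_def
      by (metis (mono_tags, lifting) centre_in_ball mem_Collect_eq subsetI)
    then show "\<exists>e>0. ball t e \<subseteq> Z" using e(1) by blast
  qed
  moreover have "0 \<in> Z" by (simp add: Z_def)
  ultimately have "Z = UNIV" using clopen[of Z] by auto
  then have "E t = E 0" for t by (auto simp: Z_def)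
  then have "mass N (apply_bcontfun (u t)) = mass N a" for t using mass0 expE by metis
  from that[OF u0 u zero this] show ?thesis .
qed


section \<open>Discrete trajectories that never meet the clipping\<close>

fun confined :: "real \<Rightarrow> ('a::real_normed_vector \<Rightarrow> 'a) list \<Rightarrow> 'a \<Rightarrow> bool" where
  "confined R [] x \<longleftrightarrow> True"
| "confined R (f # fs) x \<longleftrightarrow> norm x \<le> R \<and> confined R fs (f x)"

lemma confined_append: "confined R (fs @ gs) x \<longleftrightarrow> confined R fs x \<and> confined R gs (fold id fs x)"
  by (induction fs arbitrary: x) auto

lemma fold_concat_replicate: "fold f (concat (replicate k xs)) x = (fold f xs ^^ k) x"
  by (induction k arbitrary: x) (simp_all add: funpow_swap1)

text \<open>Inside a single sweep the crude drift bound, number of steps times step length, is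
  enough; only the starting points of the sweeps need the Euler error estimate.\<close>

lemma confined_short:
  assumes step: "\<And>f y. f \<in> set fs \<Longrightarrow> norm (f y - y) \<le> d" and "norm x + real (length fs) * d \<le> R" "0 \<le> d"
  shows "confined R fs x"
  using assms
proof (induction fs arbitrary: x)
  case (Cons f fs)
  have "norm (f x) \<le> norm x + norm (f x - x)" using norm_triangle_ineq[of x "f x - x"] by simp
  also have "norm (f x - x) \<le> d" using Cons.prems by simp
  finally have "norm (f x) + real (length fs) * d \<le> R"
    using Cons.prems(2) by (simp add: algebra_simps)
  then have "confined R fs (f x)" using Cons.prems by (intro Cons.IH) auto
  moreover have "norm x \<le> R"
    using Cons.prems(2,3) mult_nonneg_nonneg[OF of_nat_0_le_iff[of "length (f # fs)"] Cons.prems(3)] by linarith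
  ultimately show ?case by simp
qed simp

lemma confined_replicate:
  assumes "\<And>j. j < k \<Longrightarrow> confined R fs ((fold id fs ^^ j) x)"
  shows "confined R (concat (replicate k fs)) x"
  using assms
proof (induction k)
  case (Suc k)
  have "concat (replicate (Suc k) fs) = concat (replicate k fs) @ fs"
    by (simp add: replicate_append_same[symmetric] del: replicate_append_same)
  moreover have "confined R (concat (replicate k fs)) x" using Suc by simp
  moreover have "confined R fs ((fold id fs ^^ k) x)" by (rule Suc.prems) simp
  ultimately show ?case by (simp only: confined_append fold_concat_replicate)
qed simp

text \<open>The unclipped moves act on arbitrary configurations, whereas the Euler steps of the clipped
  fields act on bounded sequences; along trajectories confined to the ball of radius \<open>R\<close> they agree.\<close>

lemma truncate_move:
  assumes "norm (truncate N a) \<le> R" "\<bar>fst s\<bar> \<le> int N" "\<sigma> \<in> {1, -1}"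
  shows "truncate N (move N (\<sigma> * h) s a) = euler_step h (\<lambda>x. \<sigma> *\<^sub>R clipped_field N R s x) (truncate N a)"
proof (rule bcontfun_eqI)
  fix m
  have "cmod (apply_bcontfun (truncate N a) n) \<le> R" for n
    using norm_apply_le[of "truncate N a" n] assms(1) by simp
  then have "clip R (apply_bcontfun (truncate N a) n) = apply_bcontfun (truncate N a) n" for n
    by (rule clip_eq)
  then have "velocity N s (\<lambda>n. clip R (apply_bcontfun (truncate N a) n)) = velocity N s a"
    using assms(2) by (intro velocity_cong) (auto simp del: apply_truncate, auto)
  then show "apply_bcontfun (truncate N (move N (\<sigma> * h) s a)) m =
      apply_bcontfun (euler_step h (\<lambda>x. \<sigma> *\<^sub>R clipped_field N R s x) (truncate N a)) m"
    using assms(2) by (auto simp: euler_step_def clipped_field_def move_eq_velocity)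
qed

fun bounded_path :: "nat \<Rightarrow> real \<Rightarrow> real \<Rightarrow> (int \<times> bool) list \<Rightarrow> (int \<Rightarrow> complex) \<Rightarrow> bool" where
  "bounded_path N h R [] a \<longleftrightarrow> True"
| "bounded_path N h R (s # ss) a \<longleftrightarrow> (\<forall>n. \<bar>n\<bar> \<le> int N \<longrightarrow> cmod (a n) \<le> R) \<and> bounded_path N h R ss (move N h s a)"

lemma truncate_fold_move:
  assumes "confined R (map (\<lambda>s. euler_step h (\<lambda>x. \<sigma> *\<^sub>R clipped_field N R s x)) ss) (truncate N a)"
    and "set ss \<subseteq> set (sites N)" "\<sigma> \<in> {1, -1}"
  shows "bounded_path N (\<sigma> * h) R ss a \<and> truncate N (fold (move N (\<sigma> * h)) ss a) =
      fold (euler_step h) (map (\<lambda>s x. \<sigma> *\<^sub>R clipped_field N R s x) ss) (truncate N a)"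
  using assms
proof (induction ss arbitrary: a)
  case (Cons s ss)
  then have norm: "norm (truncate N a) \<le> R" by simp
  have "\<bar>fst s\<bar> \<le> int N" using Cons.prems(2) by (auto simp: set_sites)
  then have *: "truncate N (move N (\<sigma> * h) s a) = euler_step h (\<lambda>x. \<sigma> *\<^sub>R clipped_field N R s x) (truncate N a)"
    using norm Cons.prems(3) by (intro truncate_move)
  have "cmod (a n) \<le> R" if "\<bar>n\<bar> \<le> int N" for n
    using norm_apply_le[of "truncate N a" n] norm that by simp
  then show ?case using Cons.IH[of "move N (\<sigma> * h) s a"] Cons.prems by (simp add: *)
qed simp

section \<open>Lower bounds for path weights\<close>

lemma mass_fun_upd:
  assumes "\<bar>n\<bar> \<le> int N"
  shows "mass N (a(n := z)) * (1 + (cmod (a n))\<^sup>2) = mass N a * (1 + (cmod z)\<^sup>2)"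
proof -
  have n: "n \<in> {- int N..int N}" using assms by auto
  have "(\<Prod>m\<in>{- int N..int N} - {n}. 1 + (cmod ((a(n := z)) m))\<^sup>2) = (\<Prod>m\<in>{- int N..int N} - {n}. 1 + (cmod (a m))\<^sup>2)"
    by (intro prod.cong) auto
  then show ?thesis unfolding mass_def
    by (simp add: prod.remove[OF _ n] del: fun_upd_apply) simp
qed

text \<open>The approximate invariance of \<open>dArea / (1 + |z|^2)\<close>. The terms linear in
  \<open>v\<close> agree in the Jacobian \<open>p\<close> and in the ratio of the new to the old
  \<open>1 + |z|^2\<close>, which is \<open>p + w\<close> with \<open>w = v^2 (1 + |z|^2)\<close>.
  The quotient \<open>p / (p + w)\<close> is thus at least \<open>1 - 2w\<close>, a quadratic error.
  The remaining power \<open>1 + 2\<beta>\<close> is left intact since it telescopes along a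
  path.\<close>

lemma shear_weight_ge:
  assumes v: "\<bar>v\<bar> \<le> 2 * R * \<bar>h\<bar>" and z: "cmod z \<le> R" and h: "8 * R\<^sup>2 * \<bar>h\<bar> \<le> 1"
  shows "(1 - 8 * R\<^sup>2 * (1 + R\<^sup>2) * h\<^sup>2) * ((1 + (cmod z)\<^sup>2) / (1 + (cmod (shear d v z))\<^sup>2)) powr (1 + 2 * \<beta>)
    \<le> shear_weight \<beta> d v z"
proof -
  let ?c = "coord d z" and ?s = "1 + (cmod z)\<^sup>2" and ?s' = "1 + (cmod (shear d v z))\<^sup>2"
  have R: "0 \<le> R" using z norm_ge_zero order_trans by blast
  have s: "?s > 0" "?s' > 0" by (simp_all add: add_pos_nonneg)
  have c: "\<bar>?c\<bar> \<le> R" using abs_coord_le[of d z] z by simp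
  have "\<bar>v\<bar> * \<bar>?c\<bar> \<le> (2 * R * \<bar>h\<bar>) * R" using v c R by (intro mult_mono) auto
  then have vc: "4 * \<bar>v\<bar> * \<bar>?c\<bar> \<le> 1" using h by (simp add: power2_eq_square algebra_simps)
  define p where "p = 1 + 2 * v * ?c"
  have "\<bar>v * ?c\<bar> \<le> 1 / 4" using vc by (simp add: abs_mult)
  then have p: "p \<ge> 1 / 2" using abs_ge_minus_self[of "v * ?c"] by (simp add: p_def)
  have s': "?s' = ?s * (p + v\<^sup>2 * ?s)"
  proof -
    have "(cmod (shear d v z))\<^sup>2 = (cmod z)\<^sup>2 + 2 * v * ?s * ?c + (v * ?s)\<^sup>2"
      by (cases d) (simp_all only: shear_def coord_def direction_def cmod_power2 if_True if_False,
        simp_all add: power2_eq_square algebra_simps)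
    then show ?thesis by (simp add: p_def power2_eq_square algebra_simps)
  qed
  define w where "w = v\<^sup>2 * ?s"
  have w0: "0 \<le> w" using s by (simp add: w_def)
  have "v\<^sup>2 \<le> (2 * R * \<bar>h\<bar>)\<^sup>2" using v by (metis abs_ge_zero power2_abs power_mono)
  moreover have "?s \<le> 1 + R\<^sup>2" using z by (simp add: power_mono)
  ultimately have w: "w \<le> (2 * R * \<bar>h\<bar>)\<^sup>2 * (1 + R\<^sup>2)" unfolding w_def using s by (intro mult_mono) auto
  have "1 - 8 * R\<^sup>2 * (1 + R\<^sup>2) * h\<^sup>2 \<le> 1 - 2 * w"
    using w by (simp add: power_mult_distrib algebra_simps)
  also have "\<dots> \<le> p / (p + w)"
  proof -
    \<comment> \<open>The cutoff gives \<open>p \<ge> 1/2\<close>, so \<open>2wp\<close> absorbs the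
      \<open>w\<close> on the left.\<close>
    have "(1 - 2 * w) * (p + w) \<le> p"
    proof -
      have "w * (1 / 2) \<le> w * p" using p w0 by (intro mult_left_mono)
      moreover have "(1 - 2 * w) * (p + w) = p + w - 2 * (w * p) - 2 * (w * w)" by (simp add: algebra_simps)
      moreover have "0 \<le> w * w" using w0 by simp
      ultimately show ?thesis by linarith
    qed
    then show ?thesis using p w0 by (simp add: pos_le_divide_eq)
  qed
  also have "\<dots> = p * (?s / ?s')"
    using s p w0 unfolding s' w_def[symmetric] by (simp add: field_simps)
  finally have "(1 - 8 * R\<^sup>2 * (1 + R\<^sup>2) * h\<^sup>2) * (?s / ?s') powr (1 + 2 * \<beta>) \<le> (p * (?s / ?s')) * (?s / ?s') powr (1 + 2 * \<beta>)"
    by (intro mult_right_mono) auto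
  also have "\<dots> = p * (?s / ?s') powr (1 + (1 + 2 * \<beta>))"
    using s by (subst powr_add) simp
  also have "\<dots> = shear_weight \<beta> d v z"
    using vc by (simp add: shear_weight_def p_def)
  finally show ?thesis .
qed

text \<open>Each move changes one factor of \<open>mass\<close>, so the ratio left over at that move
  is a ratio of consecutive masses. These telescope to the endpoints, while the quadratic errors are
  collected in a power.\<close>

lemma path_weight_ge:
  assumes "bounded_path N h R ss a" "set ss \<subseteq> set (sites N)"
    and R: "0 \<le> R" and h: "8 * R\<^sup>2 * \<bar>h\<bar> \<le> 1" "8 * R\<^sup>2 * (1 + R\<^sup>2) * h\<^sup>2 \<le> 1"
  shows "(1 - 8 * R\<^sup>2 * (1 + R\<^sup>2) * h\<^sup>2) ^ length ss * (mass N a / mass N (fold (move N h) ss a)) powr (1 + 2 * \<beta>)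
    \<le> path_weight \<beta> N h ss a"
  using assms(1,2)
proof (induction ss arbitrary: a)
  case Nil
  show ?case using mass_ge_1[of N a] by simp
next
  case (Cons s ss)
  let ?e = "1 - 8 * R\<^sup>2 * (1 + R\<^sup>2) * h\<^sup>2" and ?b = "move N h s a" and ?n = "fst s"
  let ?z' = "shear (snd s) (h * speed N s a) (a ?n)"
  have n: "\<bar>?n\<bar> \<le> int N" using Cons.prems(2) by (auto simp: set_sites)
  have a: "cmod (a m) \<le> R" if "\<bar>m\<bar> \<le> int N" for m using Cons.prems(1) that by simp
  have pos: "1 + (cmod (a ?n))\<^sup>2 > 0" "1 + (cmod ?z')\<^sup>2 > 0" by (simp_all add: add_pos_nonneg)
  have M: "mass N a > 0" "mass N ?b > 0" "mass N (fold (move N h) ss ?b) > 0"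
    using mass_ge_1 by (metis less_le_trans zero_less_one)+
  have "mass N ?b * (1 + (cmod (a ?n))\<^sup>2) = mass N a * (1 + (cmod ?z')\<^sup>2)"
    unfolding move_def by (rule mass_fun_upd[OF n])
  then have ratio: "(1 + (cmod (a ?n))\<^sup>2) / (1 + (cmod ?z')\<^sup>2) = mass N a / mass N ?b"
    using pos M by (simp add: field_simps)
  let ?A = "(mass N a / mass N ?b) powr (1 + 2 * \<beta>)"
  let ?B = "(mass N ?b / mass N (fold (move N h) ss ?b)) powr (1 + 2 * \<beta>)"
  have AB: "?A * ?B = (mass N a / mass N (fold (move N h) ss ?b)) powr (1 + 2 * \<beta>)"
    using M by (subst powr_mult[symmetric]) simp
  have "\<bar>h * speed N s a\<bar> \<le> \<bar>h\<bar> * (2 * R)"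
    unfolding abs_mult using a R by (intro mult_left_mono abs_speed_le) auto
  then have 1: "?e * ?A \<le> move_weight \<beta> N h s a"
    unfolding move_weight_def ratio[symmetric]
    by (intro shear_weight_ge a n h) (simp add: mult.commute)
  have 2: "?e ^ length ss * ?B \<le> path_weight \<beta> N h ss ?b"
    using Cons by simp
  have "?e ^ length (s # ss) * (mass N a / mass N (fold (move N h) (s # ss) a)) powr (1 + 2 * \<beta>) =
      ?e * ?e ^ length ss * (?A * ?B)"
    by (simp only: fold_Cons o_apply AB length_Cons power_Suc)
  also have "\<dots> = (?e * ?A) * (?e ^ length ss * ?B)" by (simp only: mult_ac)
  also have "\<dots> \<le> path_weight \<beta> N h (s # ss) a"
    unfolding path_weight.simps using h(2)
    by (intro mult_mono 1 2) (auto simp: move_weight_def shear_weight_nonneg)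
  finally show ?case .
qed

definition sweeps :: "nat \<Rightarrow> nat \<Rightarrow> (int \<times> bool) list" where
  "sweeps N k = concat (replicate k (sites N))"

lemma set_sweeps: "set (sweeps N k) \<subseteq> set (sites N)"
  by (auto simp: sweeps_def)

lemma length_sweeps: "length (sweeps N k) = k * length (sites N)"
  by (simp add: sweeps_def length_concat sum_list_replicate)

lemma scaleR_sum_list: "c *\<^sub>R (\<Sum>x\<leftarrow>xs. f x) = (\<Sum>x\<leftarrow>xs. c *\<^sub>R f x)"
  for f :: "'b \<Rightarrow> 'a::real_vector"
  by (induction xs) (simp_all add: scaleR_add_right)

abbreviation iterate :: "nat \<Rightarrow> real \<Rightarrow> nat \<Rightarrow> (int \<Rightarrow> complex) \<Rightarrow> (int \<Rightarrow> complex)" where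
  "iterate N t k a \<equiv> fold (move N (t / real k)) (sweeps N k) a"

text \<open>The margin 1 between \<open>R\<close> and the norm bound \<open>mass N a\<close> of the
  exact solution accommodates, for large \<open>k\<close>, both the Euler error and the drift within
  one sweep. The unclipped moves then coincide with the clipped Euler steps and inherit their
  convergence.\<close>

lemma clipped_flow_path:
  fixes a :: "int \<Rightarrow> complex" and u :: "real \<Rightarrow> int \<Rightarrow>\<^sub>C complex"
  assumes R_def: "R = mass N a + 1"
    and u0: "u 0 = truncate N a"
    and u: "\<And>t. (u has_vector_derivative (\<Sum>s\<leftarrow>sites N. clipped_field N R s (u t))) (at t)"
    and zero: "\<And>t n. \<bar>n\<bar> > int N \<Longrightarrow> apply_bcontfun (u t) n = 0"
    and mass: "\<And>t. mass N (apply_bcontfun (u t)) = mass N a"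
  shows "(\<lambda>k. truncate N (iterate N t k a)) \<longlonglongrightarrow> u t"
    and "\<forall>\<^sub>F k in sequentially. bounded_path N (t / real k) R (sweeps N k) a"
proof -
  define B where "B = mass N a"
  have B1: "1 \<le> B" by (simp add: B_def mass_ge_1)
  have R: "R = B + 1" "0 \<le> R" using B1 by (simp_all add: R_def B_def)
  \<comment> \<open>Negative times are treated by reversing the fields and running forward for
    \<open>\<tau> = |t|\<close>.\<close>
  define \<sigma> where "\<sigma> = (if t \<ge> 0 then 1 else -1 :: real)"
  define \<tau> where "\<tau> = \<bar>t\<bar>"
  have \<sigma>: "\<sigma> \<in> {1, -1}" "\<sigma> * \<tau> = t" "\<bar>\<sigma>\<bar> = 1" by (auto simp: \<sigma>_def \<tau>_def)
  define K where "K = 2 * R * (1 + R\<^sup>2)"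
  define L where "L = 2 * (1 + R\<^sup>2) + 4 * R\<^sup>2"
  have K0: "0 \<le> K" using R(2) by (simp add: K_def)
  have L0: "0 \<le> L" by (simp add: L_def)
  define V where "V s x = \<sigma> *\<^sub>R clipped_field N R s x" for s x
  define Vs where "Vs = map V (sites N)"
  have normV: "norm (V s x) \<le> K" for s x
    using norm_clipped_field_le[OF R(2)] by (simp add: V_def K_def \<sigma>(3))
  have lipV: "norm (V s x - V s y) \<le> L * norm (x - y)" for s x y
    using norm_clipped_field_diff_le[OF R(2)]
    by (simp add: V_def L_def scaleR_diff_right[symmetric] \<sigma>(3) del: scaleR_diff_right)
  define w where "w r = u (\<sigma> * r)" for r
  have w0: "w 0 = truncate N a" by (simp add: w_def u0)
  have w\<tau>: "w \<tau> = u t" by (simp add: w_def \<sigma>)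
  have w: "(w has_vector_derivative (\<Sum>V\<leftarrow>Vs. V (w r))) (at r)" for r
    using has_vector_derivative_scale_arg[OF u[of "\<sigma> * r"]]
    by (simp add: w_def[abs_def] Vs_def V_def[abs_def] scaleR_sum_list o_def)
  have norm_u: "norm (u r) \<le> B" for r
  proof (rule norm_bound)
    fix n show "cmod (apply_bcontfun (u r) n) \<le> B"
      using norm_le_mass[of n N "apply_bcontfun (u r)"] zero[of n r] mass[of r] B1
      by (cases "\<bar>n\<bar> \<le> int N") (auto simp: B_def)
  qed
  have KV: "norm (V x) \<le> K" if "V \<in> set Vs" for V x using that normV by (auto simp: Vs_def)
  have LV: "norm (V x - V y) \<le> L * norm (x - y)" if "V \<in> set Vs" for V x y using that lipV by (auto simp: Vs_def)
  obtain C where C0: "0 \<le> C" and C: "\<And>k j. \<lbrakk>0 < k; j \<le> k\<rbrakk> \<Longrightarrow>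
      norm ((fold (euler_step (\<tau> / real k)) Vs ^^ j) (w 0) - w (real j * (\<tau> / real k))) \<le> C / real k"
    using euler_sweep_converges[where Vs=Vs and u=w and K=K and L=L and t=\<tau>] K0 KV L0 LV w
    unfolding \<tau>_def by (metis abs_ge_zero)
  \<comment> \<open>Euler error at the start of a sweep plus drift inside it, both multiplied by
    \<open>k\<close>; \<open>E / k < 1\<close> is the confinement condition.\<close>
  define E where "E = C + real (length Vs) * (\<tau> * K)"
  have small: "\<forall>\<^sub>F k in sequentially. 0 < k \<and> E / real k < 1"
    using eventually_gt_at_top[of 0] order_tendstoD(2)[OF lim_const_over_n[of E] zero_less_one]
    by eventually_elim auto
  have main: "bounded_path N (t / real k) R (sweeps N k) a \<and>
      norm (truncate N (iterate N t k a) - u t) \<le> C / real k"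
    if k: "0 < k" "E / real k < 1" for k
  proof -
    define h where "h = \<tau> / real k"
    have h0: "0 \<le> h" by (simp add: h_def \<tau>_def)
    have \<sigma>h: "\<sigma> * h = t / real k" using \<sigma>(2) by (simp add: h_def)
    define fs where "fs = map (euler_step h) Vs"
    have fold_fs: "fold id fs = fold (euler_step h) Vs" by (simp add: fs_def fold_map)
    have "confined R (concat (replicate k fs)) (truncate N a)"
    proof (rule confined_replicate)
      fix j assume j: "j < k"
      let ?x = "(fold id fs ^^ j) (truncate N a)"
      have "norm (?x - w (real j * h)) \<le> C / real k"
        using C[OF k(1), of j] j by (simp add: fold_fs w0 h_def)
      moreover have "norm (w (real j * h)) \<le> B" by (simp add: w_def norm_u)
      ultimately have "norm ?x \<le> B + C / real k"
        using norm_triangle_sub[of ?x "w (real j * h)"] by linarith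
      moreover have "C / real k + real (length fs) * (h * K) = E / real k"
        using k by (simp add: E_def fs_def h_def add_divide_distrib)
      ultimately have "norm ?x + real (length fs) * (h * K) \<le> R" using k R by linarith
      then show "confined R fs ?x"
      proof (rule confined_short[rotated])
        fix f and y :: "int \<Rightarrow>\<^sub>C complex" assume "f \<in> set fs"
        then obtain V where "V \<in> set Vs" "f = euler_step h V" by (auto simp: fs_def)
        then show "norm (f y - y) \<le> h * K" using KV[of V y] h0 by (simp add: euler_step_def mult_left_mono)
      qed (use h0 K0 in auto)
    qed
    moreover have "concat (replicate k fs) = map (\<lambda>s. euler_step h (\<lambda>x. \<sigma> *\<^sub>R clipped_field N R s x)) (sweeps N k)"
      by (simp add: sweeps_def map_concat map_replicate fs_def Vs_def V_def[abs_def] o_def)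
    ultimately have conf: "confined R (map (\<lambda>s. euler_step h (\<lambda>x. \<sigma> *\<^sub>R clipped_field N R s x)) (sweeps N k)) (truncate N a)"
      by simp
    have "truncate N (fold (move N (\<sigma> * h)) (sweeps N k) a) =
        fold (euler_step h) (map (\<lambda>s x. \<sigma> *\<^sub>R clipped_field N R s x) (sweeps N k)) (truncate N a)"
      using truncate_fold_move[OF conf set_sweeps \<sigma>(1)] by (rule conjunct2)
    also have "map (\<lambda>s x. \<sigma> *\<^sub>R clipped_field N R s x) (sweeps N k) = concat (replicate k Vs)"
      by (simp add: sweeps_def map_concat map_replicate Vs_def V_def[abs_def])
    also have "fold (euler_step h) \<dots> (truncate N a) = (fold (euler_step h) Vs ^^ k) (w 0)"
      by (simp add: fold_concat_replicate w0)
    finally have "norm (truncate N (iterate N t k a) - u t) \<le> C / real k"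
      using C[OF k(1), of k] k(1) by (simp add: \<sigma>h h_def[symmetric] w\<tau>[symmetric]) (simp add: h_def)
    moreover have "bounded_path N (t / real k) R (sweeps N k) a"
      using truncate_fold_move[OF conf set_sweeps \<sigma>(1)] by (simp add: \<sigma>h)

    ultimately show ?thesis by simp
  qed
  from small show "\<forall>\<^sub>F k in sequentially. bounded_path N (t / real k) R (sweeps N k) a"
    by (rule eventually_mono) (use main in blast)
  have "(\<lambda>k. truncate N (iterate N t k a) - u t) \<longlonglongrightarrow> 0"
  proof (rule Lim_null_comparison)
    show "\<forall>\<^sub>F k in sequentially. norm (truncate N (iterate N t k a) - u t) \<le> C / real k"
      using small by (rule eventually_mono) (use main in blast)
  qed (rule lim_const_over_n)
  then show "(\<lambda>k. truncate N (iterate N t k a)) \<longlonglongrightarrow> u t"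
    by (rule LIM_zero_cancel)
qed

text \<open>A path of \<open>k\<close> sweeps has \<open>k * m\<close> moves, each losing a relative
  amount of order \<open>k^(-2)\<close>. By Bernoulli's inequality the total loss is of order
  \<open>1/k\<close>.\<close>

lemma one_minus_square_power_tendsto_1:
  "(\<lambda>k. (1 - c * (t / real k)\<^sup>2) ^ (k * m)) \<longlonglongrightarrow> 1" if c: "0 \<le> c"
proof (rule tendsto_sandwich[where f="\<lambda>k. 1 - (real m * c * t\<^sup>2) / real k" and h="\<lambda>k. 1"])
  have "(\<lambda>k. 1 - (real m * c * t\<^sup>2) / real k) \<longlonglongrightarrow> 1 - 0"
    by (intro tendsto_diff tendsto_const lim_const_over_n)
  then show "(\<lambda>k. 1 - (real m * c * t\<^sup>2) / real k) \<longlonglongrightarrow> 1" by simp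
  have "(\<lambda>k. c * t\<^sup>2 / real k) \<longlonglongrightarrow> 0" by (rule lim_const_over_n)
  then have "\<forall>\<^sub>F k in sequentially. c * t\<^sup>2 / real k < 1" by (rule order_tendstoD) simp
  then have ev: "\<forall>\<^sub>F k in sequentially. 0 < k \<and> c * (t / real k)\<^sup>2 \<le> 1"
    using eventually_gt_at_top[of 0]
  proof eventually_elim
    case (elim k)
    have "c * (t / real k)\<^sup>2 = (c * t\<^sup>2 / real k) / real k"
      by (simp add: power_divide power2_eq_square)
    also have "\<dots> \<le> c * t\<^sup>2 / real k"
      using elim c divide_left_mono[of 1 "real k" "c * t\<^sup>2 / real k"] by simp
    finally show ?case using elim by linarith
  qed
  show "\<forall>\<^sub>F k in sequentially. 1 - (real m * c * t\<^sup>2) / real k \<le> (1 - c * (t / real k)\<^sup>2) ^ (k * m)"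
    using ev
  proof eventually_elim
    case (elim k)
    have "1 + real (k * m) * (- (c * (t / real k)\<^sup>2)) \<le> (1 + - (c * (t / real k)\<^sup>2)) ^ (k * m)"
      using elim by (intro Bernoulli_inequality) simp
    moreover have "real (k * m) * (c * (t / real k)\<^sup>2) = (real m * c * t\<^sup>2) / real k"
      using elim by (simp add: power2_eq_square)
    ultimately show ?case by simp
  qed
  show "\<forall>\<^sub>F k in sequentially. (1 - c * (t / real k)\<^sup>2) ^ (k * m) \<le> 1"
    using ev by eventually_elim (use c in \<open>auto intro!: power_le_one\<close>)
qed auto

text \<open>The last two clauses retain the discretisation next to the solution: convergence of the
  moves gives measurability in the initial data, and asymptotic weights at least 1 give the moment
  inequality.\<close>

abbreviation truncated_flow :: "nat \<Rightarrow> (int \<Rightarrow> complex) \<Rightarrow> (int \<Rightarrow> real \<Rightarrow> complex) \<Rightarrow> bool" where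
  "truncated_flow N a u \<equiv>
    (\<forall>n. u n 0 = (if \<bar>n\<bar> \<le> int N then a n else 0)) \<and>
    (\<forall>n t. \<bar>n\<bar> \<le> int N \<longrightarrow> (u n has_vector_derivative
        \<i> * (1 + complex_of_real ((cmod (u n t))\<^sup>2)) * (u (n + 1) t + u (n - 1) t)) (at t)) \<and>
    (\<forall>n t. \<bar>n\<bar> > int N \<longrightarrow> u n t = 0) \<and>
    (\<forall>t. mass N (\<lambda>n. u n t) = mass N a) \<and>
    (\<forall>n t. \<bar>n\<bar> \<le> int N \<longrightarrow> (\<lambda>k. iterate N t k a n) \<longlonglongrightarrow> u n t) \<and>
    (\<forall>\<beta> t. \<exists>v. v \<longlonglongrightarrow> 1 \<and> (\<forall>\<^sub>F k in sequentially. v k \<le> path_weight \<beta> N (t / real k) (sweeps N k) a))"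

lemma truncated_flow_exists:
  shows "\<exists>u. truncated_flow N a u"
proof -
  define R where "R = mass N a + 1"
  have R0: "0 \<le> R" using mass_ge_1[of N a] by (simp add: R_def)
  obtain u :: "real \<Rightarrow> int \<Rightarrow>\<^sub>C complex" where u0: "u 0 = truncate N a"
    and u: "\<And>t. (u has_vector_derivative (\<Sum>s\<leftarrow>sites N. clipped_field N R s (u t))) (at t)"
    and zero: "\<And>t n. \<bar>n\<bar> > int N \<Longrightarrow> apply_bcontfun (u t) n = 0"
    and mass: "\<And>t. mass N (apply_bcontfun (u t)) = mass N a"
    by (rule clipped_flow_exists[of N a R]) (simp_all add: R_def)
  have sweeps: "(\<lambda>k. truncate N (iterate N t k a)) \<longlonglongrightarrow> u t"
      "\<forall>\<^sub>F k in sequentially. bounded_path N (t / real k) R (sweeps N k) a" for t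
    using clipped_flow_path[OF R_def u0 u] zero mass by blast+
  have norm_u: "cmod (apply_bcontfun (u t) n) \<le> R" for n t
    using norm_le_mass[of n N "apply_bcontfun (u t)"] zero[of n t] mass[of t] R0
    by (cases "\<bar>n\<bar> \<le> int N") (auto simp: R_def)
  have conv: "(\<lambda>k. iterate N t k a n) \<longlonglongrightarrow> apply_bcontfun (u t) n" if "\<bar>n\<bar> \<le> int N" for n t
    using bounded_linear.tendsto[OF bounded_linear_apply[of n] sweeps(1)[of t]] that by simp
  show ?thesis
  proof (intro exI[of _ "\<lambda>n t. apply_bcontfun (u t) n"] conjI allI impI conv zero mass)
    show "apply_bcontfun (u 0) n = (if \<bar>n\<bar> \<le> int N then a n else 0)" for n by (simp add: u0)
    fix n t assume n: "\<bar>n\<bar> \<le> int N"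
    have "((\<lambda>t. apply_bcontfun (u t) n) has_vector_derivative apply_bcontfun (\<Sum>s\<leftarrow>sites N. clipped_field N R s (u t)) n) (at t)"
      by (rule bounded_linear.has_vector_derivative[OF bounded_linear_apply u])
    also have "neighbours N (apply_bcontfun (u t)) n = apply_bcontfun (u t) (n + 1) + apply_bcontfun (u t) (n - 1)"
      using zero by (auto simp: neighbours_def)
    then have "apply_bcontfun (\<Sum>s\<leftarrow>sites N. clipped_field N R s (u t)) n =
        \<i> * (1 + complex_of_real ((cmod (apply_bcontfun (u t) n))\<^sup>2)) * (apply_bcontfun (u t) (n + 1) + apply_bcontfun (u t) (n - 1))"
      using n by (simp add: sum_clipped_fields clip_eq norm_u)
    finally show "((\<lambda>t. apply_bcontfun (u t) n) has_vector_derivative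
        \<i> * (1 + complex_of_real ((cmod (apply_bcontfun (u t) n))\<^sup>2)) * (apply_bcontfun (u t) (n + 1) + apply_bcontfun (u t) (n - 1))) (at t)" .
  next
    fix \<beta> t :: real
    define c where "c = 8 * R\<^sup>2 * (1 + R\<^sup>2)"
    define M where "M k = mass N (iterate N t k a)" for k
    \<comment> \<open>The lower bound on path weights: its error power tends to 1, and so does its
      mass ratio, because the limit flow conserves \<open>mass\<close>.\<close>
    define v where "v k = (1 - c * (t / real k)\<^sup>2) ^ length (sweeps N k) * (mass N a / M k) powr (1 + 2 * \<beta>)" for k
    have mpos: "mass N b > 0" for b using mass_ge_1[of N b] by simp
    have "M \<longlonglongrightarrow> mass N (apply_bcontfun (u t))"
      unfolding M_def mass_def using conv[of _ t] by (intro tendsto_intros) (auto simp: abs_le_iff)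
    then have "(\<lambda>k. (mass N a / M k) powr (1 + 2 * \<beta>)) \<longlonglongrightarrow> (mass N a / mass N a) powr (1 + 2 * \<beta>)"
      unfolding mass using mpos[of a] by (intro tendsto_intros) auto
    moreover have "(\<lambda>k. (1 - c * (t / real k)\<^sup>2) ^ length (sweeps N k)) \<longlonglongrightarrow> 1"
      unfolding length_sweeps by (rule one_minus_square_power_tendsto_1) (simp add: c_def)
    ultimately have "v \<longlonglongrightarrow> 1 * (mass N a / mass N a) powr (1 + 2 * \<beta>)"
      unfolding v_def by (rule tendsto_mult[rotated])
    then have "v \<longlonglongrightarrow> 1" using mpos[of a] by simp
    moreover have "\<forall>\<^sub>F k in sequentially. v k \<le> path_weight \<beta> N (t / real k) (sweeps N k) a"
    proof -
      have lim: "(\<lambda>k. t / real k) \<longlonglongrightarrow> 0" by (rule lim_const_over_n)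
      have "(\<lambda>k. 8 * R\<^sup>2 * \<bar>t / real k\<bar>) \<longlonglongrightarrow> 8 * R\<^sup>2 * \<bar>0\<bar>" by (intro tendsto_intros lim)
      then have 1: "\<forall>\<^sub>F k in sequentially. 8 * R\<^sup>2 * \<bar>t / real k\<bar> < 1" by (rule order_tendstoD) simp
      have "(\<lambda>k. c * (t / real k)\<^sup>2) \<longlonglongrightarrow> c * 0\<^sup>2" by (intro tendsto_intros lim)
      then have 2: "\<forall>\<^sub>F k in sequentially. c * (t / real k)\<^sup>2 < 1" by (rule order_tendstoD) simp
      from sweeps(2)[of t] 1 2 show ?thesis
      proof eventually_elim
        case (elim k)
        then show ?case unfolding v_def M_def c_def
          by (intro path_weight_ge[OF _ set_sweeps R0]) auto
      qed
    qed
    ultimately show "\<exists>v. v \<longlonglongrightarrow> 1 \<and> (\<forall>\<^sub>F k in sequentially. v k \<le> path_weight \<beta> N (t / real k) (sweeps N k) a)"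
      by blast
  qed
qed

section \<open>Moments of the truncated flows\<close>

lemma nn_integral_count_space_int:
  fixes f :: "int \<Rightarrow> ennreal"
  shows "(\<integral>\<^sup>+n. f n \<partial>count_space UNIV) = (\<Sum>k. f (int_decode k))"
  by (simp add: nn_integral_bij_count_space[symmetric, OF bij_int_decode] nn_integral_count_space_nat)

lemma nn_integral_int_powr_finite:
  fixes q :: real
  assumes q: "q > 1"
  shows "(\<integral>\<^sup>+n. ennreal ((1 + \<bar>real_of_int n\<bar>) powr (- q)) \<partial>count_space UNIV) < \<infinity>"
proof -
  let ?f = "\<lambda>n. ennreal ((1 + \<bar>real_of_int n\<bar>) powr (- q))"
  have "(\<integral>\<^sup>+n. ?f n \<partial>count_space UNIV) = (\<Sum>k. ?f (int_decode k))"
    by (rule nn_integral_count_space_int)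
  also have "\<dots> \<le> (\<Sum>k. ennreal (2 powr q * real (Suc k) powr (- q)))"
  proof (intro suminf_le ennreal_leI)
    fix k
    \<comment> \<open>\<open>int_decode\<close> alternates between nonnegative and negative
      integers, so its k-th value has absolute value about k/2.\<close>
    have "real (Suc k) / 2 \<le> 1 + \<bar>real_of_int (int_decode k)\<bar>"
      by (cases "even k") (auto simp: int_decode_def sum_decode_def elim!: evenE oddE)
    then have "(1 + \<bar>real_of_int (int_decode k)\<bar>) powr (- q) \<le> (real (Suc k) / 2) powr (- q)"
      using q by (intro powr_mono2') auto
    also have "\<dots> = 2 powr q * real (Suc k) powr (- q)"
      by (simp add: powr_divide powr_minus_divide)
    finally show "(1 + \<bar>real_of_int (int_decode k)\<bar>) powr (- q) \<le> 2 powr q * real (Suc k) powr (- q)" .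
  qed auto
  also have "\<dots> < \<infinity>"
  proof -
    have "summable (\<lambda>k. real (Suc k) powr (- q))"
      using q by (subst summable_Suc_iff) (simp add: summable_real_powr_iff)
    then have "summable (\<lambda>k. 2 powr q * real (Suc k) powr (- q))" by (rule summable_mult)
    then show ?thesis by (subst suminf_ennreal2) auto
  qed
  finally show ?thesis .
qed

lemma borel_measurable_nn_integral_count_space_int:
  fixes f :: "int \<Rightarrow> 'a \<Rightarrow> ennreal"
  assumes [measurable]: "\<And>n. f n \<in> borel_measurable M"
  shows "(\<lambda>x. \<integral>\<^sup>+n. f n x \<partial>count_space UNIV) \<in> borel_measurable M"
  unfolding nn_integral_count_space_int by measurable

lemma japanese_bracket_bounds:
  "(1 + \<bar>real_of_int n\<bar>) / 2 \<le> japanese_bracket n" "\<bar>real_of_int n\<bar> \<le> japanese_bracket n"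
  "japanese_bracket n \<le> 1 + \<bar>real_of_int n\<bar>" "1 \<le> japanese_bracket n"
proof -
  let ?x = "\<bar>real_of_int n\<bar>"
  have x2: "?x\<^sup>2 = (real_of_int n)\<^sup>2" by simp
  show 1: "\<bar>real_of_int n\<bar> \<le> japanese_bracket n" "1 \<le> japanese_bracket n"
    unfolding japanese_bracket_def by (auto intro!: real_le_rsqrt)
  then show "(1 + \<bar>real_of_int n\<bar>) / 2 \<le> japanese_bracket n" by simp
  show "japanese_bracket n \<le> 1 + \<bar>real_of_int n\<bar>"
    unfolding japanese_bracket_def
    by (rule real_le_lsqrt) (simp_all add: power2_eq_square algebra_simps)
qed

section \<open>The truncated flow as a function of time and initial data\<close>

definition flow :: "nat \<Rightarrow> (int \<Rightarrow> complex) \<Rightarrow> int \<Rightarrow> real \<Rightarrow> complex" where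
  "flow N a = (SOME u. truncated_flow N a u)"

lemma
  shows flow_0: "\<bar>n\<bar> \<le> int N \<Longrightarrow> flow N a n 0 = a n"
    and flow_derivative: "\<bar>n\<bar> \<le> int N \<Longrightarrow> (flow N a n has_vector_derivative
        \<i> * (1 + complex_of_real ((cmod (flow N a n t))\<^sup>2)) * (flow N a (n + 1) t + flow N a (n - 1) t)) (at t)"
    and flow_outside: "\<bar>n\<bar> > int N \<Longrightarrow> flow N a n t = 0"
    and mass_flow: "mass N (\<lambda>n. flow N a n t) = mass N a"
    and flow_path: "\<bar>n\<bar> \<le> int N \<Longrightarrow> (\<lambda>k. iterate N t k a n) \<longlonglongrightarrow> flow N a n t"
    and flow_weight: "\<exists>v. v \<longlonglongrightarrow> 1 \<and> (\<forall>\<^sub>F k in sequentially. v k \<le> path_weight \<beta> N (t / real k) (sweeps N k) a)"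
  using someI_ex[OF truncated_flow_exists[of N a], folded flow_def] by auto

lemma continuous_on_flow: "continuous_on S (flow N a n)"
proof (cases "\<bar>n\<bar> \<le> int N")
  case True
  then show ?thesis using has_vector_derivative_continuous[OF flow_derivative]
    by (intro continuous_at_imp_continuous_on) blast
next
  case False
  then have "flow N a n = (\<lambda>t. 0)" by (auto simp: flow_outside)
  then show ?thesis by simp
qed

text \<open>The flow is picked by \<open>SOME\<close> separately for each \<open>a\<close>, which
  carries no measurability; it is measurable as the pointwise limit of the explicit finite
  compositions of moves.\<close>

lemma measurable_flow[measurable]: "(\<lambda>a. flow N a n t) \<in> borel_measurable (white_noise \<beta>)"
proof (cases "\<bar>n\<bar> \<le> int N")
  case True
  show ?thesis
    by (rule borel_measurable_LIMSEQ_metric[OF _ flow_path[OF True]]) measurable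
qed (simp add: flow_outside)

lemma tendsto_floor_grid: "(\<lambda>k. real_of_int \<lfloor>real (Suc k) * t\<rfloor> / real (Suc k)) \<longlonglongrightarrow> t"
proof (rule tendsto_sandwich[where f="\<lambda>k. t - 1 / real (Suc k)" and h="\<lambda>k. t"])
  have "(\<lambda>k. 1 / real (Suc k)) \<longlonglongrightarrow> 0" using LIMSEQ_Suc[OF lim_const_over_n[of 1]] by simp
  then have "(\<lambda>k. t - 1 / real (Suc k)) \<longlonglongrightarrow> t - 0" by (intro tendsto_intros)
  then show "(\<lambda>k. t - 1 / real (Suc k)) \<longlonglongrightarrow> t" by simp
  show "\<forall>\<^sub>F k in sequentially. t - 1 / real (Suc k) \<le> real_of_int \<lfloor>real (Suc k) * t\<rfloor> / real (Suc k)"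
  proof (intro always_eventually allI)
    fix k
    have "(real (Suc k) * t - 1) / real (Suc k) \<le> real_of_int \<lfloor>real (Suc k) * t\<rfloor> / real (Suc k)"
      by (intro divide_right_mono) linarith+
    then show "t - 1 / real (Suc k) \<le> real_of_int \<lfloor>real (Suc k) * t\<rfloor> / real (Suc k)"
      by (simp add: diff_divide_distrib del: of_nat_Suc)
  qed
  show "\<forall>\<^sub>F k in sequentially. real_of_int \<lfloor>real (Suc k) * t\<rfloor> / real (Suc k) \<le> t"
  proof (intro always_eventually allI)
    fix k
    have "real_of_int \<lfloor>real (Suc k) * t\<rfloor> / real (Suc k) \<le> (real (Suc k) * t) / real (Suc k)"
      by (intro divide_right_mono of_int_floor_le) simp
    then show "real_of_int \<lfloor>real (Suc k) * t\<rfloor> / real (Suc k) \<le> t" by (simp del: of_nat_Suc)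
  qed
qed simp

text \<open>Measurable in the data for fixed time and continuous in time: time is rounded down to a
  grid with countably many values, and the grid is refined.\<close>

lemma measurable_flow_joint[measurable]: "(\<lambda>p. flow N (snd p) n (fst p)) \<in> borel_measurable (borel \<Otimes>\<^sub>M white_noise \<beta>)"
proof (rule borel_measurable_LIMSEQ_metric)
  fix p :: "real \<times> (int \<Rightarrow> complex)"
  have "isCont (flow N (snd p) n) (fst p)"
    using continuous_on_flow[of UNIV N "snd p" n] by (simp add: continuous_on_eq_continuous_at)
  then show "(\<lambda>k. flow N (snd p) n (real_of_int \<lfloor>real (Suc k) * fst p\<rfloor> / real (Suc k))) \<longlonglongrightarrow> flow N (snd p) n (fst p)"
    using tendsto_floor_grid by (rule isCont_tendsto_compose)
next
  fix k
  show "(\<lambda>p. flow N (snd p) n (real_of_int \<lfloor>real (Suc k) * fst p\<rfloor> / real (Suc k))) \<in> borel_measurable (borel \<Otimes>\<^sub>M white_noise \<beta>)"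
    by (rule measurable_compose_countable[where f="\<lambda>i p. flow N (snd p) n (real_of_int i / real (Suc k))"]) measurable
qed

text \<open>Only the inequality is needed; it follows from Fatou's lemma because the path weights tend to 1.\<close>

lemma nn_integral_flow_moment_le:
  fixes f :: "complex \<Rightarrow> real"
  assumes \<beta>: "\<beta> > 0" and n: "\<bar>n\<bar> \<le> int N" and f: "continuous_on UNIV f" "\<And>z. 0 \<le> f z"
  shows "(\<integral>\<^sup>+a. ennreal (f (flow N a n t)) \<partial>white_noise \<beta>) \<le> (\<integral>\<^sup>+z. ennreal (f z) \<partial>single_site \<beta>)"
proof -
  have [measurable]: "f \<in> borel_measurable borel" using f(1) by (rule borel_measurable_continuous_onI)
  define g where "g k a = ennreal (f (iterate N t k a n)) * ennreal (path_weight \<beta> N (t / real k) (sweeps N k) a)" for k a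
  have [measurable]: "g k \<in> borel_measurable (white_noise \<beta>)" for k unfolding g_def by measurable
  have "ennreal (f (flow N a n t)) \<le> liminf (\<lambda>k. g k a)" for a
  proof -
    obtain v where v: "v \<longlonglongrightarrow> 1" "\<forall>\<^sub>F k in sequentially. v k \<le> path_weight \<beta> N (t / real k) (sweeps N k) a"
      using flow_weight by blast
    have "isCont f (flow N a n t)" using f(1) by (simp add: continuous_on_eq_continuous_at)
    then have "(\<lambda>k. f (iterate N t k a n)) \<longlonglongrightarrow> f (flow N a n t)"
      using flow_path[OF n] by (rule isCont_tendsto_compose)
    then have "(\<lambda>k. f (iterate N t k a n) * v k) \<longlonglongrightarrow> f (flow N a n t) * 1"
      using v(1) by (rule tendsto_mult)
    then have "(\<lambda>k. ennreal (f (iterate N t k a n) * v k)) \<longlonglongrightarrow> ennreal (f (flow N a n t))"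
      by (intro tendsto_ennrealI) simp
    then have "ennreal (f (flow N a n t)) = liminf (\<lambda>k. ennreal (f (iterate N t k a n) * v k))"
      by (intro lim_imp_Liminf[symmetric]) auto
    also have "\<dots> \<le> liminf (\<lambda>k. g k a)"
    proof (rule Liminf_mono)
      show "\<forall>\<^sub>F k in sequentially. ennreal (f (iterate N t k a n) * v k) \<le> g k a"
        using v(2) unfolding g_def
        by eventually_elim (simp add: ennreal_mult[symmetric] f(2) path_weight_nonneg mult_left_mono ennreal_leI)
    qed
    finally show ?thesis .
  qed
  then have "(\<integral>\<^sup>+a. ennreal (f (flow N a n t)) \<partial>white_noise \<beta>) \<le> (\<integral>\<^sup>+a. liminf (\<lambda>k. g k a) \<partial>white_noise \<beta>)"
    by (intro nn_integral_mono)
  also have "\<dots> \<le> liminf (\<lambda>k. \<integral>\<^sup>+a. g k a \<partial>white_noise \<beta>)"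
    by (rule nn_integral_liminf) measurable
  also have "\<dots> \<le> liminf (\<lambda>k::nat. \<integral>\<^sup>+z. ennreal (f z) \<partial>single_site \<beta>)"
  proof (intro Liminf_mono always_eventually allI)
    fix k
    have "(\<integral>\<^sup>+a. g k a \<partial>white_noise \<beta>) \<le> (\<integral>\<^sup>+a. ennreal (f (a n)) \<partial>white_noise \<beta>)"
      unfolding g_def by (rule nn_integral_path_le[OF \<beta>, where F="\<lambda>a. ennreal (f (a n))"]) measurable
    also have "\<dots> = (\<integral>\<^sup>+z. ennreal (f z) \<partial>single_site \<beta>)"
      by (rule nn_integral_white_noise_component[OF \<beta>]) measurable
    finally show "(\<integral>\<^sup>+a. g k a \<partial>white_noise \<beta>) \<le> (\<integral>\<^sup>+z. ennreal (f z) \<partial>single_site \<beta>)" .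
  qed
  also have "\<dots> = (\<integral>\<^sup>+z. ennreal (f z) \<partial>single_site \<beta>)" by (simp add: Liminf_const)
  finally show ?thesis .
qed

abbreviation weighted_moment :: "real \<Rightarrow> real \<Rightarrow> (int \<Rightarrow> complex) \<Rightarrow> ennreal" where
  "weighted_moment p q z \<equiv> \<integral>\<^sup>+ n. ennreal (japanese_bracket n powr (- q) * cmod (z n) powr (2 * p)) \<partial>count_space UNIV"

definition spacetime :: "real \<Rightarrow> real \<Rightarrow> real \<Rightarrow> (int \<Rightarrow> real \<Rightarrow> complex) \<Rightarrow> ennreal" where
  "spacetime p q T u = (\<integral>\<^sup>+ t\<in>{-T..T}.
     weighted_moment p q (\<lambda>n. u n t) \<partial>lborel)"

lemma measurable_spacetime_integrand:
  "(\<lambda>(a, t). weighted_moment p q (\<lambda>n. flow N a n t)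
      * indicator {-T..T} t) \<in> borel_measurable (white_noise \<beta> \<Otimes>\<^sub>M lborel)"
  unfolding case_prod_beta
proof (intro borel_measurable_times_ennreal)
  show "(\<lambda>x. weighted_moment p q (\<lambda>n. flow N (fst x) n (snd x)))
    \<in> borel_measurable (white_noise \<beta> \<Otimes>\<^sub>M lborel)"
  proof (rule borel_measurable_nn_integral_count_space_int)
    fix n
    have "(\<lambda>x. (snd x, fst x)) \<in> white_noise \<beta> \<Otimes>\<^sub>M lborel \<rightarrow>\<^sub>M borel \<Otimes>\<^sub>M white_noise \<beta>" by measurable
    from measurable_compose[OF this measurable_flow_joint[of N n \<beta>]]
    have [measurable]: "(\<lambda>x. flow N (fst x) n (snd x)) \<in> borel_measurable (white_noise \<beta> \<Otimes>\<^sub>M lborel)" by simp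
    show "(\<lambda>x. ennreal (japanese_bracket n powr (- q) * cmod (flow N (fst x) n (snd x)) powr (2 * p)))
        \<in> borel_measurable (white_noise \<beta> \<Otimes>\<^sub>M lborel)" by measurable
  qed
qed measurable

lemma measurable_spacetime_flow[measurable]:
  "(\<lambda>a. spacetime p q T (flow N a)) \<in> borel_measurable (white_noise \<beta>)"
  unfolding spacetime_def
  by (rule lborel.borel_measurable_nn_integral) (rule measurable_spacetime_integrand)

text \<open>By Tonelli, expectation moves inside the time integral and the sum over sites. At every
  time each site contributes at most its stationary moment \<open>m\<close>, and
  \<open>q > 1\<close> makes the weights summable, so the bound \<open>2T S m\<close> does not
  depend on \<open>N\<close>.\<close>

lemma nn_integral_spacetime_flow_bounded:
  assumes \<beta>: "\<beta> > 0" and p: "p = 1 + \<beta>" and q: "q > 1" and T: "T \<ge> 0"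
  obtains C where "C < \<infinity>" "\<And>N. (\<integral>\<^sup>+a. spacetime p q T (flow N a) \<partial>white_noise \<beta>) \<le> C"
proof
  interpret W: prob_space "white_noise \<beta>" using \<beta> by (rule prob_space_white_noise)
  interpret P: pair_sigma_finite "white_noise \<beta>" "lborel :: real measure" ..
  define m where "m = (\<integral>\<^sup>+z. ennreal (cmod z powr (2 * p)) \<partial>single_site \<beta>)"
  define S where "S = (\<integral>\<^sup>+n. ennreal (japanese_bracket n powr (- q)) \<partial>count_space UNIV)"
  have "m \<le> (\<integral>\<^sup>+z. ennreal ((1 + (cmod z)\<^sup>2) powr (1 + \<beta>)) \<partial>single_site \<beta>)"
    unfolding m_def
  proof (intro nn_integral_mono ennreal_leI)
    fix z
    have "cmod z powr (2 * p) = ((cmod z)\<^sup>2) powr p"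
      by (cases "z = 0") (simp_all add: powr_powr[symmetric] powr_numeral)
    also have "\<dots> \<le> (1 + (cmod z)\<^sup>2) powr p" using p \<beta> by (intro powr_mono2) auto
    finally show "cmod z powr (2 * p) \<le> (1 + (cmod z)\<^sup>2) powr (1 + \<beta>)" by (simp add: p)
  qed
  then have m: "m < \<infinity>" using single_site_moment_finite[OF \<beta>] by (rule order_le_less_trans)
  have "S \<le> (\<integral>\<^sup>+n. ennreal (2 powr q) * ennreal ((1 + \<bar>real_of_int n\<bar>) powr (- q)) \<partial>count_space UNIV)"
    unfolding S_def
  proof (intro nn_integral_mono)
    fix n
    have "japanese_bracket n powr (- q) \<le> ((1 + \<bar>real_of_int n\<bar>) / 2) powr (- q)"
      using q japanese_bracket_bounds(1)[of n] by (intro powr_mono2') auto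
    also have "\<dots> = 2 powr q * (1 + \<bar>real_of_int n\<bar>) powr (- q)"
      by (simp add: powr_divide powr_minus_divide)
    finally show "ennreal (japanese_bracket n powr (- q)) \<le> ennreal (2 powr q) * ennreal ((1 + \<bar>real_of_int n\<bar>) powr (- q))"
      by (simp add: ennreal_mult[symmetric] ennreal_leI)
  qed
  also have "\<dots> = ennreal (2 powr q) * (\<integral>\<^sup>+n. ennreal ((1 + \<bar>real_of_int n\<bar>) powr (- q)) \<partial>count_space UNIV)"
    by (rule nn_integral_cmult) simp
  also have "\<dots> < \<infinity>" using nn_integral_int_powr_finite[OF q] by (simp add: ennreal_mult_less_top)
  finally have S: "S < \<infinity>" .
  show "ennreal (2 * T) * (S * m) < \<infinity>" using m S by (simp add: ennreal_mult_less_top)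
  fix N
  let ?g = "\<lambda>n t a. ennreal (japanese_bracket n powr (- q) * cmod (flow N a n t) powr (2 * p))"
  have p0: "0 < 2 * p" using p \<beta> by simp
  have g: "(\<integral>\<^sup>+a. ?g n t a \<partial>white_noise \<beta>) \<le> ennreal (japanese_bracket n powr (- q)) * m" for n t
  proof (cases "\<bar>n\<bar> \<le> int N")
    case True
    have "continuous_on UNIV (\<lambda>z :: complex. cmod z powr (2 * p))"
      using p0 by (intro continuous_on_powr' continuous_intros) auto
    then have "(\<integral>\<^sup>+a. ennreal (cmod (flow N a n t) powr (2 * p)) \<partial>white_noise \<beta>) \<le> m"
      unfolding m_def by (intro nn_integral_flow_moment_le[OF \<beta> True]) auto
    then show ?thesis by (simp add: ennreal_mult nn_integral_cmult mult_left_mono)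
  qed (use p0 in \<open>simp add: flow_outside\<close>)
  have "(\<integral>\<^sup>+a. spacetime p q T (flow N a) \<partial>white_noise \<beta>) =
      (\<integral>\<^sup>+t. \<integral>\<^sup>+a. (\<integral>\<^sup>+n. ?g n t a \<partial>count_space UNIV) * indicator {-T..T} t \<partial>white_noise \<beta> \<partial>lborel)"
    unfolding spacetime_def by (rule P.Fubini'[symmetric]) (rule measurable_spacetime_integrand)
  also have "\<dots> \<le> (\<integral>\<^sup>+t. (S * m) * indicator {-T..T} t \<partial>lborel)"
  proof (intro nn_integral_mono)
    fix t
    have "(\<integral>\<^sup>+a. (\<integral>\<^sup>+n. ?g n t a \<partial>count_space UNIV) \<partial>white_noise \<beta>) =
        (\<integral>\<^sup>+n. (\<integral>\<^sup>+a. ?g n t a \<partial>white_noise \<beta>) \<partial>count_space UNIV)"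
      by (rule nn_integral_count_space_nn_integral) auto
    also have "\<dots> \<le> (\<integral>\<^sup>+n. ennreal (japanese_bracket n powr (- q)) * m \<partial>count_space UNIV)"
      by (intro nn_integral_mono g)
    also have "\<dots> = S * m" unfolding S_def by (rule nn_integral_multc) simp
    finally show "(\<integral>\<^sup>+a. (\<integral>\<^sup>+n. ?g n t a \<partial>count_space UNIV) * indicator {-T..T} t \<partial>white_noise \<beta>) \<le> (S * m) * indicator {-T..T} t"
      by (auto simp: indicator_def)
  qed
  also have "\<dots> = (S * m) * emeasure lborel {-T..T}"
    by (subst nn_integral_cmult_indicator) auto
  also have "\<dots> = ennreal (2 * T) * (S * m)" using T by (simp add: mult.commute)
  finally show "(\<integral>\<^sup>+a. spacetime p q T (flow N a) \<partial>white_noise \<beta>) \<le> ennreal (2 * T) * (S * m)" .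
qed

text \<open>The series of all \<open>X k / w k\<close> has finite expectation, so almost surely it
  has a finite sum, and that sum serves as the constant for every \<open>k\<close>.\<close>

lemma AE_summable_bound:
  fixes X :: "nat \<Rightarrow> 'a \<Rightarrow> ennreal" and w :: "nat \<Rightarrow> real"
  assumes X[measurable]: "\<And>k. X k \<in> borel_measurable M" and w: "\<And>k. 0 < w k" "summable (\<lambda>k. b k / w k)"
    and b: "\<And>k. 0 \<le> b k" "\<And>k. (\<integral>\<^sup>+a. X k a \<partial>M) \<le> ennreal (b k)"
  shows "AE a in M. \<exists>C. \<forall>k. X k a \<le> ennreal (C * w k)"
proof -
  define Y where "Y a = (\<Sum>k. ennreal (1 / w k) * X k a)" for a
  have [measurable]: "Y \<in> borel_measurable M" unfolding Y_def by measurable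
  have "(\<integral>\<^sup>+a. Y a \<partial>M) = (\<Sum>k. ennreal (1 / w k) * (\<integral>\<^sup>+a. X k a \<partial>M))"
    unfolding Y_def by (subst nn_integral_suminf) (auto simp: nn_integral_cmult)
  also have "\<dots> \<le> (\<Sum>k. ennreal (b k / w k))"
  proof (intro suminf_le)
    fix k
    have "ennreal (1 / w k) * (\<integral>\<^sup>+a. X k a \<partial>M) \<le> ennreal (1 / w k) * ennreal (b k)"
      by (intro mult_left_mono b) simp
    then show "ennreal (1 / w k) * (\<integral>\<^sup>+a. X k a \<partial>M) \<le> ennreal (b k / w k)"
      using w(1)[of k] b(1)[of k] by (simp add: ennreal_mult[symmetric])
  qed auto
  also have "\<dots> < \<infinity>"
    using w b by (subst suminf_ennreal2) (auto simp: less_imp_le)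
  finally have "(\<integral>\<^sup>+a. Y a \<partial>M) \<noteq> \<infinity>" by simp
  then have "AE a in M. Y a \<noteq> \<infinity>" by (intro nn_integral_PInf_AE) auto
  then show ?thesis
  proof eventually_elim
    case (elim a)
    show ?case
    proof (intro exI allI)
      fix k
      have "ennreal (1 / w k) * X k a \<le> Y a"
        unfolding Y_def using sum_le_suminf[of "\<lambda>k. ennreal (1 / w k) * X k a" "{k}"] by simp
      then have "ennreal (w k) * (ennreal (1 / w k) * X k a) \<le> ennreal (w k) * Y a"
        by (rule mult_left_mono) simp
      also have "ennreal (w k) * (ennreal (1 / w k) * X k a) = X k a"
        using w(1)[of k] by (simp add: mult.assoc[symmetric] ennreal_mult[symmetric])
      also have "ennreal (w k) * Y a = ennreal (enn2real (Y a) * w k)"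
        using elim w(1)[of k] by (simp add: ennreal_mult less_top mult.commute)
      finally show "X k a \<le> ennreal (enn2real (Y a) * w k)" .
    qed
  qed
qed

text \<open>What the deterministic existence argument needs from the data. The bound with loss
  \<open>\<delta>\<close> holds at every scale and drives the comparison of consecutive truncations;
  the liminf bound has no loss and passes to the limit by Fatou; the last clause bounds differences
  at the boundary of a box. Integer times suffice and keep the exceptional sets countable.\<close>

abbreviation controlled :: "real \<Rightarrow> real \<Rightarrow> real \<Rightarrow> (int \<Rightarrow> complex) \<Rightarrow> bool" where
  "controlled p q \<delta> a \<equiv>
    (\<forall>j::nat. \<exists>C. \<forall>k. spacetime p q (real j) (flow (2 ^ k) a) \<le> ennreal (C * real (2 ^ k) powr \<delta>)) \<and>
    (\<forall>j::nat. liminf (\<lambda>k. spacetime p q (real j) (flow (2 ^ k) a)) < \<infinity>) \<and>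
    (\<exists>C c. \<forall>k. mass (2 ^ k) a \<le> C * exp (c * real (2 ^ k)))"

lemma AE_white_noise_bounds:
  assumes \<beta>: "\<beta> > 0" and p: "p = 1 + \<beta>" and q: "q > 1" and \<delta>: "\<delta> > 0"
  shows "AE a in white_noise \<beta>. controlled p q \<delta> a"
proof (intro AE_conjI)
  show "AE a in white_noise \<beta>. \<forall>j::nat. \<exists>C. \<forall>k. spacetime p q (real j) (flow (2 ^ k) a) \<le> ennreal (C * real (2 ^ k) powr \<delta>)"
  proof (intro AE_all_countable[THEN iffD2] allI)
    fix j :: nat
    obtain C where C: "C < \<infinity>" "\<And>N. (\<integral>\<^sup>+a. spacetime p q (real j) (flow N a) \<partial>white_noise \<beta>) \<le> C"
      using nn_integral_spacetime_flow_bounded[OF \<beta> p q] by (metis of_nat_0_le_iff)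
    have eq: "real (2 ^ k) powr \<delta> = (2 powr \<delta>) ^ k" for k
      by (simp add: powr_realpow[symmetric] powr_powr mult.commute)
    show "AE a in white_noise \<beta>. \<exists>C. \<forall>k. spacetime p q (real j) (flow (2 ^ k) a) \<le> ennreal (C * real (2 ^ k) powr \<delta>)"
    proof (rule AE_summable_bound)
      have "summable (\<lambda>k. enn2real C * (1 / 2 powr \<delta>) ^ k)"
        using \<delta> by (intro summable_mult summable_geometric) (simp add: divide_less_eq)
      then show "summable (\<lambda>k. enn2real C / real (2 ^ k) powr \<delta>)"
        by (simp only: eq power_one_over times_divide_eq_right mult_1_right)
      show "(\<integral>\<^sup>+a. spacetime p q (real j) (flow (2 ^ k) a) \<partial>white_noise \<beta>) \<le> ennreal (enn2real C)" for k
        using C by (simp add: less_top)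
    qed auto
  qed
  show "AE a in white_noise \<beta>. \<forall>j::nat. liminf (\<lambda>k. spacetime p q (real j) (flow (2 ^ k) a)) < \<infinity>"
  proof (intro AE_all_countable[THEN iffD2] allI)
    fix j :: nat
    obtain C where C: "C < \<infinity>" "\<And>N. (\<integral>\<^sup>+a. spacetime p q (real j) (flow N a) \<partial>white_noise \<beta>) \<le> C"
      using nn_integral_spacetime_flow_bounded[OF \<beta> p q] by (metis of_nat_0_le_iff)
    have "(\<integral>\<^sup>+a. liminf (\<lambda>k. spacetime p q (real j) (flow (2 ^ k) a)) \<partial>white_noise \<beta>) \<le>
        liminf (\<lambda>k. \<integral>\<^sup>+a. spacetime p q (real j) (flow (2 ^ k) a) \<partial>white_noise \<beta>)"
      by (rule nn_integral_liminf) measurable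
    also have "\<dots> \<le> liminf (\<lambda>k::nat. C)"
      by (intro Liminf_mono always_eventually allI C)
    also have "\<dots> = C" by (simp add: Liminf_const)
    finally have "(\<integral>\<^sup>+a. liminf (\<lambda>k. spacetime p q (real j) (flow (2 ^ k) a)) \<partial>white_noise \<beta>) \<noteq> \<infinity>"
      using C(1) by (auto simp: top_unique)
    then have "AE a in white_noise \<beta>. liminf (\<lambda>k. spacetime p q (real j) (flow (2 ^ k) a)) \<noteq> \<infinity>"
      by (intro nn_integral_PInf_AE) measurable
    then show "AE a in white_noise \<beta>. liminf (\<lambda>k. spacetime p q (real j) (flow (2 ^ k) a)) < \<infinity>"
      by (simp add: less_top)
  qed
  define m where "m = (\<integral>\<^sup>+z. ennreal (1 + (cmod z)\<^sup>2) \<partial>single_site \<beta>)"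
  have "m \<le> (\<integral>\<^sup>+z. ennreal ((1 + (cmod z)\<^sup>2) powr (1 + \<beta>)) \<partial>single_site \<beta>)"
    unfolding m_def
  proof (intro nn_integral_mono ennreal_leI)
    fix z
    have "(1 + (cmod z)\<^sup>2) powr 1 \<le> (1 + (cmod z)\<^sup>2) powr (1 + \<beta>)" using \<beta> by (intro powr_mono) auto
    then show "1 + (cmod z)\<^sup>2 \<le> (1 + (cmod z)\<^sup>2) powr (1 + \<beta>)" by simp
  qed
  then have m: "m < \<infinity>" using single_site_moment_finite[OF \<beta>] by (rule order_le_less_trans)
  \<comment> \<open>By independence the mass has expectation \<open>m^(2N+1)\<close>. Dominating
    \<open>m\<close> by \<open>r\<close> and comparing with \<open>(2r)^(2N+1)\<close> leaves the
    summable ratios \<open>2^(-(2N+1))\<close>.\<close>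
  define r where "r = enn2real m + 1"
  have r: "1 \<le> r" "m \<le> ennreal r" using m by (auto simp: r_def ennreal_plus less_top)
  have card_int: "card {- int N..int N} = 2 * N + 1" for N by simp
  have "AE a in white_noise \<beta>. \<exists>C. \<forall>k. ennreal (mass (2 ^ k) a) \<le> ennreal (C * (2 * r) ^ (2 * 2 ^ k + 1))"
  proof (rule AE_summable_bound)
    fix k
    show "(\<lambda>a. ennreal (mass (2 ^ k) a)) \<in> borel_measurable (white_noise \<beta>)"
      unfolding mass_def by measurable
    have "(\<integral>\<^sup>+a. ennreal (mass (2 ^ k) a) \<partial>white_noise \<beta>) =
        (\<integral>\<^sup>+a. (\<Prod>n\<in>{- int (2 ^ k)..int (2 ^ k)}. ennreal (1 + (cmod (a n))\<^sup>2)) \<partial>white_noise \<beta>)"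
      unfolding mass_def by (intro nn_integral_cong prod_ennreal[symmetric]) simp
    also have "\<dots> = m ^ card {- int (2 ^ k)..int (2 ^ k)}"
      unfolding m_def by (rule nn_integral_white_noise_prod[OF \<beta>]) auto
    also have "card {- int (2 ^ k)..int (2 ^ k)} = 2 * 2 ^ k + 1" by (rule card_int)
    also have "m ^ (2 * 2 ^ k + 1) \<le> ennreal r ^ (2 * 2 ^ k + 1)" by (intro power_mono r) simp
    also have "\<dots> = ennreal (r ^ (2 * 2 ^ k + 1))" using r by (intro ennreal_power) simp
    finally show "(\<integral>\<^sup>+a. ennreal (mass (2 ^ k) a) \<partial>white_noise \<beta>) \<le> ennreal (r ^ (2 * 2 ^ k + 1))" .
  next
    show "summable (\<lambda>k. r ^ (2 * 2 ^ k + 1) / (2 * r) ^ (2 * 2 ^ k + 1))"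
    proof (rule summable_comparison_test')
      show "summable (\<lambda>k. (1 / 2 :: real) ^ k)" by (intro summable_geometric) simp
      fix k :: nat
      have "k \<le> 2 * 2 ^ k + 1" using less_exp[of k] by linarith
      then have "(1 / 2 :: real) ^ (2 * 2 ^ k + 1) \<le> (1 / 2) ^ k" by (intro power_decreasing) auto
      then show "norm (r ^ (2 * 2 ^ k + 1) / (2 * r) ^ (2 * 2 ^ k + 1)) \<le> (1 / 2) ^ k"
        using r by (simp only: power_divide[symmetric]) simp
    qed
  qed (use r in auto)
  then show "AE a in white_noise \<beta>. \<exists>C c. \<forall>k. mass (2 ^ k) a \<le> C * exp (c * real (2 ^ k))"
  proof eventually_elim
    case (elim a)
    then obtain C where C: "\<And>k. ennreal (mass (2 ^ k) a) \<le> ennreal (C * (2 * r) ^ (2 * 2 ^ k + 1))" by blast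
    have "mass (2 ^ k) a \<le> (C * (2 * r)) * exp (2 * ln (2 * r) * real (2 ^ k))" for k
    proof -
      \<comment> \<open>\<open>ennreal\<close> sends negative reals to 0. The inequality descends to
        the reals once its right side is positive, which \<open>mass \<ge> 1\<close> forces.\<close>
      have "0 < C * (2 * r) ^ (2 * 2 ^ k + 1)"
        using C[of k] mass_ge_1[of "2 ^ k" a] by (metis ennreal_eq_0_iff ennreal_le_epsilon le_zero_eq not_le less_le_trans zero_less_one order_less_le)
      then have "mass (2 ^ k) a \<le> C * (2 * r) ^ (2 * 2 ^ k + 1)" using C[of k] by (simp add: ennreal_le_iff)
      also have "(2 * r) ^ (2 * 2 ^ k + 1) = (2 * r) * (2 * r) powr real (2 * 2 ^ k)"
        using r by (subst powr_realpow) auto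
      also have "(2 * r) powr real (2 * 2 ^ k) = exp (2 * ln (2 * r) * real (2 ^ k))"
        using r by (simp add: powr_def mult_ac)
      finally show ?thesis by (simp add: mult.assoc)
    qed
    then show ?case by blast
  qed
qed

section \<open>Comparison of solutions\<close>

text \<open>The right-hand side on the full lattice after the phase rotation has removed the linear
  term \<open>2 \<alpha>\<close>.\<close>

definition lattice_field :: "(int \<Rightarrow> complex) \<Rightarrow> int \<Rightarrow> complex" where
  "lattice_field z n = \<i> * (1 + complex_of_real ((cmod (z n))\<^sup>2)) * (z (n + 1) + z (n - 1))"

text \<open>The difference splits into \<open>1 + |z n|^2\<close> times the change of the neighbour
  sum, and the change of \<open>|.|^2\<close> times the neighbour sum of \<open>w\<close>. These
  contribute \<open>2(1 + A) D\<close> and \<open>4 A D\<close>.\<close>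

lemma lattice_field_diff_le:
  assumes A: "(cmod (z n))\<^sup>2 \<le> A" "\<And>m. \<bar>m - n\<bar> \<le> 1 \<Longrightarrow> (cmod (w m))\<^sup>2 \<le> A"
    and D: "\<And>m. \<bar>m - n\<bar> \<le> 1 \<Longrightarrow> cmod (z m - w m) \<le> D"
  shows "cmod (lattice_field z n - lattice_field w n) \<le> (2 + 6 * A) * D"
proof -
  have A0: "0 \<le> A" using A(1) zero_le_power2 order_trans by blast
  have "cmod (z n - w n) \<le> D" by (rule D) simp
  then have D0: "0 \<le> D" using norm_ge_zero[of "z n - w n"] by linarith
  have z: "cmod (z n) \<le> sqrt A" using A(1) by (rule real_le_rsqrt)
  have w: "cmod (w m) \<le> sqrt A" if "\<bar>m - n\<bar> \<le> 1" for m using A(2)[OF that] by (rule real_le_rsqrt)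
  let ?s = "\<lambda>z. z (n + 1) + z (n - 1) :: complex"
  have "lattice_field z n - lattice_field w n = \<i> * ((1 + complex_of_real ((cmod (z n))\<^sup>2)) * (?s z - ?s w)
      + complex_of_real ((cmod (z n))\<^sup>2 - (cmod (w n))\<^sup>2) * ?s w)"
    by (simp add: lattice_field_def algebra_simps)
  also have "cmod \<dots> \<le> (1 + (cmod (z n))\<^sup>2) * cmod (?s z - ?s w) + \<bar>(cmod (z n))\<^sup>2 - (cmod (w n))\<^sup>2\<bar> * cmod (?s w)"
  proof -
    have "cmod (1 + complex_of_real ((cmod (z n))\<^sup>2)) = 1 + (cmod (z n))\<^sup>2"
      by (metis abs_of_nonneg add_nonneg_nonneg norm_of_real of_real_1 of_real_add zero_le_one zero_le_power2)
    then show ?thesis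
      unfolding norm_mult by (intro order_trans[OF mult_left_mono[OF norm_triangle_ineq]])
        (simp_all only: norm_mult norm_of_real norm_ii, simp_all)
  qed
  also have "\<dots> \<le> (1 + A) * (2 * D) + (D * (2 * sqrt A)) * (2 * sqrt A)"
  proof (intro add_mono mult_mono)
    have "?s z - ?s w = (z (n + 1) - w (n + 1)) + (z (n - 1) - w (n - 1))" by simp
    also have "cmod \<dots> \<le> D + D" by (intro order_trans[OF norm_triangle_ineq] add_mono D) auto
    finally show "cmod (?s z - ?s w) \<le> 2 * D" by simp
    have "cmod (?s w) \<le> sqrt A + sqrt A" by (intro order_trans[OF norm_triangle_ineq] add_mono w) auto
    then show "cmod (?s w) \<le> 2 * sqrt A" by simp
    have "\<bar>(cmod (z n))\<^sup>2 - (cmod (w n))\<^sup>2\<bar> = \<bar>cmod (z n) - cmod (w n)\<bar> * (cmod (z n) + cmod (w n))"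
    proof -
      have "(cmod (z n))\<^sup>2 - (cmod (w n))\<^sup>2 = (cmod (z n) - cmod (w n)) * (cmod (z n) + cmod (w n))"
        by (simp add: power2_eq_square algebra_simps)
      then show ?thesis by (simp add: abs_mult)
    qed
    also have "\<dots> \<le> D * (sqrt A + sqrt A)"
    proof (intro mult_mono add_mono z w)
      show "\<bar>cmod (z n) - cmod (w n)\<bar> \<le> D" using norm_triangle_ineq3[of "z n" "w n"] D[of n] by simp
    qed (use D0 in auto)
    finally show "\<bar>(cmod (z n))\<^sup>2 - (cmod (w n))\<^sup>2\<bar> \<le> D * (2 * sqrt A)" by simp
  qed (use A A0 D0 in auto)
  also have "\<dots> = (2 + 6 * A) * D" using A0 by (simp add: algebra_simps)
  finally show ?thesis .
qed

text \<open>Each step away from the boundary of the box gains one time integration, hence the factorial.\<close>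

lemma comparison_aux:
  fixes u v :: "int \<Rightarrow> real \<Rightarrow> complex"
  assumes \<sigma>: "\<bar>\<sigma>\<bar> = 1"
    and u: "\<And>n t. \<bar>n\<bar> < int L \<Longrightarrow> (u n has_vector_derivative lattice_field (\<lambda>m. u m t) n) (at t)"
    and v: "\<And>n t. \<bar>n\<bar> < int L \<Longrightarrow> (v n has_vector_derivative lattice_field (\<lambda>m. v m t) n) (at t)"
    and init: "\<And>n. \<bar>n\<bar> < int L \<Longrightarrow> u n 0 = v n 0"
    and A: "\<And>n t. \<lbrakk>\<bar>n\<bar> \<le> int L; \<bar>t\<bar> \<le> T\<rbrakk> \<Longrightarrow> (cmod (u n t))\<^sup>2 \<le> A t" "\<And>n t. \<lbrakk>\<bar>n\<bar> \<le> int L; \<bar>t\<bar> \<le> T\<rbrakk> \<Longrightarrow> (cmod (v n t))\<^sup>2 \<le> A t"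
    and \<phi>: "\<phi> 0 = 0" "\<And>t. (\<phi> has_real_derivative 2 + 6 * A (\<sigma> * t)) (at t)"
    and M: "\<And>n t. \<lbrakk>\<bar>n\<bar> \<le> int L; \<bar>t\<bar> \<le> T\<rbrakk> \<Longrightarrow> cmod (u n t - v n t) \<le> M"
    and n: "\<bar>n\<bar> + int j \<le> int L" and t: "0 \<le> t" "t \<le> T"
  shows "cmod (u n (\<sigma> * t) - v n (\<sigma> * t)) \<le> M * (\<phi> t ^ j / fact j)"
  using n t
proof (induction j arbitrary: n t)
  case 0
  then show ?case using M[of n "\<sigma> * t"] \<sigma> by (simp add: abs_mult)
next
  case (Suc j)
  have n: "\<bar>n\<bar> < int L" using Suc.prems by simp
  have "cmod ((u n (\<sigma> * t) - v n (\<sigma> * t)) - (u n (\<sigma> * 0) - v n (\<sigma> * 0))) \<le> M * (\<phi> t ^ Suc j / fact (Suc j)) - M * (\<phi> 0 ^ Suc j / fact (Suc j))"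
  proof (rule norm_le_if_vector_derivative_le[OF Suc.prems(2)])
    fix s assume s: "0 \<le> s" "s \<le> t"
    have \<sigma>s: "\<bar>\<sigma> * s\<bar> \<le> T" using s Suc.prems \<sigma> by (simp add: abs_mult)
    show "((\<lambda>t. u n (\<sigma> * t) - v n (\<sigma> * t)) has_vector_derivative
        \<sigma> *\<^sub>R lattice_field (\<lambda>m. u m (\<sigma> * s)) n - \<sigma> *\<^sub>R lattice_field (\<lambda>m. v m (\<sigma> * s)) n) (at s)"
      by (intro has_vector_derivative_diff has_vector_derivative_scale_arg u v n)
    have fr: "real (Suc j) / fact (Suc j) = 1 / (fact j :: real)"
      by (simp only: fact_Suc of_nat_mult) simp
    have "((\<lambda>t. M * (\<phi> t ^ Suc j / fact (Suc j))) has_real_derivative M * (real (Suc j) * (\<phi> s ^ j * (2 + 6 * A (\<sigma> * s))) / fact (Suc j))) (at s)"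
      using DERIV_power_Suc[OF \<phi>(2), of j s] by (intro DERIV_cmult DERIV_cdivide) (simp add: mult_ac)
    also have "M * (real (Suc j) * (\<phi> s ^ j * (2 + 6 * A (\<sigma> * s))) / fact (Suc j)) =
        (real (Suc j) / fact (Suc j)) * (M * \<phi> s ^ j * (2 + 6 * A (\<sigma> * s)))"
      by (simp del: fact_Suc of_nat_Suc)
    also have "\<dots> = (2 + 6 * A (\<sigma> * s)) * (M * (\<phi> s ^ j / fact j))" unfolding fr by simp
    finally show "((\<lambda>t. M * (\<phi> t ^ Suc j / fact (Suc j))) has_real_derivative (2 + 6 * A (\<sigma> * s)) * (M * (\<phi> s ^ j / fact j))) (at s)" .
    have "cmod (lattice_field (\<lambda>m. u m (\<sigma> * s)) n - lattice_field (\<lambda>m. v m (\<sigma> * s)) n) \<le> (2 + 6 * A (\<sigma> * s)) * (M * (\<phi> s ^ j / fact j))"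
    proof (rule lattice_field_diff_le)
      show "(cmod (u n (\<sigma> * s)))\<^sup>2 \<le> A (\<sigma> * s)" using n \<sigma>s by (intro A) auto
      fix m assume m: "\<bar>m - n\<bar> \<le> 1"
      then show "(cmod (v m (\<sigma> * s)))\<^sup>2 \<le> A (\<sigma> * s)" using n \<sigma>s by (intro A) auto
      show "cmod (u m (\<sigma> * s) - v m (\<sigma> * s)) \<le> M * (\<phi> s ^ j / fact j)"
        using m s Suc.prems by (intro Suc.IH) auto
    qed
    then show "cmod (\<sigma> *\<^sub>R lattice_field (\<lambda>m. u m (\<sigma> * s)) n - \<sigma> *\<^sub>R lattice_field (\<lambda>m. v m (\<sigma> * s)) n) \<le> (2 + 6 * A (\<sigma> * s)) * (M * (\<phi> s ^ j / fact j))"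
      using \<sigma> by (simp add: scaleR_diff_right[symmetric] del: scaleR_diff_right)
  qed
  then show ?case using init[OF n] \<phi>(1) by simp
qed

text \<open>Integrating the pointwise rate \<open>2 + 6A\<close> over time gives the base of the
  power. Only the time integral of \<open>A\<close> enters, which is why a bound on \<open>A\<close>
  at each fixed time is unnecessary.\<close>

lemma comparison:
  fixes u v :: "int \<Rightarrow> real \<Rightarrow> complex"
  assumes u: "\<And>n t. \<bar>n\<bar> < int L \<Longrightarrow> (u n has_vector_derivative lattice_field (\<lambda>m. u m t) n) (at t)"
    and v: "\<And>n t. \<bar>n\<bar> < int L \<Longrightarrow> (v n has_vector_derivative lattice_field (\<lambda>m. v m t) n) (at t)"
    and init: "\<And>n. \<bar>n\<bar> < int L \<Longrightarrow> u n 0 = v n 0"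
    and A: "\<And>n t. \<lbrakk>\<bar>n\<bar> \<le> int L; \<bar>t\<bar> \<le> T\<rbrakk> \<Longrightarrow> (cmod (u n t))\<^sup>2 \<le> A t" "\<And>n t. \<lbrakk>\<bar>n\<bar> \<le> int L; \<bar>t\<bar> \<le> T\<rbrakk> \<Longrightarrow> (cmod (v n t))\<^sup>2 \<le> A t"
    and contA: "continuous_on UNIV A" and intA: "(\<integral>\<^sup>+ t\<in>{-T..T}. ennreal (A t) \<partial>lborel) \<le> ennreal \<Lambda>" and \<Lambda>: "0 \<le> \<Lambda>"
    and A0: "\<And>t. 0 \<le> A t"
    and M: "\<And>n t. \<lbrakk>\<bar>n\<bar> \<le> int L; \<bar>t\<bar> \<le> T\<rbrakk> \<Longrightarrow> cmod (u n t - v n t) \<le> M"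
    and n: "\<bar>n\<bar> + int j \<le> int L" and t: "\<bar>t\<bar> \<le> T"
  shows "cmod (u n t - v n t) \<le> M * ((2 * T + 6 * \<Lambda>) ^ j / fact j)"
proof -
  have T: "0 \<le> T" using t by simp
  have M0: "0 \<le> M" using M[of n t] n t by (intro order_trans[OF norm_ge_zero]) auto
  obtain \<Phi> where \<Phi>: "\<Phi> 0 = 0" "\<And>t. (\<Phi> has_real_derivative A t) (at t)"
    by (rule antiderivative_UNIV[OF contA, of 0]) (simp add: has_real_derivative_iff_has_vector_derivative)
  have mono: "\<Phi> x \<le> \<Phi> y" if "x \<le> y" for x y
  proof (rule DERIV_nonneg_imp_nondecreasing[OF that])
    fix r show "\<exists>d. (\<Phi> has_real_derivative d) (at r) \<and> 0 \<le> d"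
      using \<Phi>(2)[of r] A0[of r] by blast
  qed
  have "(\<integral>\<^sup>+ t\<in>{-T..T}. ennreal (A t) \<partial>lborel) = ennreal (\<Phi> T - \<Phi> (- T))"
    using T A0 contA \<Phi>(2)
    by (intro nn_integral_FTC_Icc) (auto intro: borel_measurable_continuous_onI)
  then have \<Phi>T: "\<Phi> T - \<Phi> (- T) \<le> \<Lambda>" using intA \<Lambda> by (simp add: ennreal_le_iff)
  define \<sigma> where "\<sigma> = (if t \<ge> 0 then 1 else -1 :: real)"
  have \<sigma>: "\<bar>\<sigma>\<bar> = 1" "\<sigma> * \<sigma> = 1" "\<sigma> * \<bar>t\<bar> = t" by (auto simp: \<sigma>_def)
  \<comment> \<open>The term \<open>\<sigma> * \<Phi> (\<sigma> * s)\<close> is the integral of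
    \<open>A\<close> over the interval between 0 and \<open>\<sigma> * s\<close>, nonnegative for
    either sign of time.\<close>
  define \<phi> where "\<phi> s = 2 * s + 6 * (\<sigma> * \<Phi> (\<sigma> * s))" for s
  have \<phi>': "(\<phi> has_real_derivative 2 + 6 * A (\<sigma> * s)) (at s)" for s
  proof -
    have "((\<lambda>s. \<Phi> (\<sigma> * s)) has_real_derivative A (\<sigma> * s) * \<sigma>) (at s)"
      by (rule DERIV_chain2[OF \<Phi>(2) DERIV_cmult_Id])
    then have "(\<phi> has_real_derivative 2 * 1 + 6 * (\<sigma> * (A (\<sigma> * s) * \<sigma>))) (at s)"
      unfolding \<phi>_def by (intro DERIV_add DERIV_cmult DERIV_ident)
    then show ?thesis using \<sigma>(2) by (simp add: mult.assoc[symmetric] mult.commute)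
  qed
  have "cmod (u n (\<sigma> * \<bar>t\<bar>) - v n (\<sigma> * \<bar>t\<bar>)) \<le> M * (\<phi> \<bar>t\<bar> ^ j / fact j)"
    by (rule comparison_aux[where A=A and \<phi>=\<phi> and L=L and T=T, OF \<sigma>(1) u v init A _ \<phi>' M n])
      (use t \<Phi>(1) in \<open>auto simp: \<phi>_def\<close>)
  also have "\<dots> \<le> M * ((2 * T + 6 * \<Lambda>) ^ j / fact j)"
  proof (intro mult_left_mono divide_right_mono power_mono M0)
    have "\<sigma> * \<Phi> t \<le> \<Phi> T - \<Phi> (- T)"
      using mono[of "-T" t] mono[of t T] mono[of "-T" 0] mono[of 0 T] t \<Phi>(1) by (auto simp: \<sigma>_def)
    then show "\<phi> \<bar>t\<bar> \<le> 2 * T + 6 * \<Lambda>" using \<Phi>T t by (simp add: \<phi>_def \<sigma>)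
    have "0 \<le> \<sigma> * \<Phi> t" using mono[of 0 t] mono[of t 0] \<Phi>(1) by (auto simp: \<sigma>_def)
    then show "0 \<le> \<phi> \<bar>t\<bar>" by (simp add: \<phi>_def \<sigma>)
  qed simp
  finally show ?thesis by (simp add: \<sigma>)
qed

text \<open>The weak Stirling bound: \<open>j^j / j!\<close> is a single term of the series for
  \<open>exp j\<close>.\<close>

lemma power_div_fact_le:
  fixes x :: real
  assumes "0 \<le> x" "0 < j"
  shows "x ^ j / fact j \<le> (exp 1 * x / real j) ^ j"
proof -
  have "real j ^ j / fact j \<le> exp (real j)"
  proof -
    have s: "(\<lambda>n. real j ^ n /\<^sub>R fact n) sums exp (real j)" by (rule exp_converges)
    have "sum (\<lambda>n. real j ^ n /\<^sub>R fact n) {j} \<le> (\<Sum>n. real j ^ n /\<^sub>R fact n)"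
      by (rule sum_le_suminf) (use s in \<open>auto simp: sums_iff\<close>)
    then show ?thesis using s by (simp add: sums_iff divide_inverse mult.commute)
  qed
  then have "1 / fact j \<le> exp (real j) / real j ^ j"
    using assms(2) by (simp add: field_simps)
  then have "x ^ j * (1 / fact j) \<le> x ^ j * (exp (real j) / real j ^ j)"
    using assms(1) by (intro mult_left_mono) auto
  also have "exp (real j) = exp 1 ^ j" using exp_of_nat_mult[of j "1::real"] by simp
  finally show ?thesis by (simp add: power_mult_distrib power_divide mult_ac)
qed

text \<open>For \<open>j \<ge> L/2\<close> the base \<open>C L^r / j\<close> is of order
  \<open>L^(r-1)\<close> and tends to 0, so its j-th power beats any prescribed exponential in
  \<open>L\<close>.\<close>

lemma factorial_decay:
  fixes C c r :: real
  assumes r: "r < 1" and C: "0 \<le> C"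
  shows "\<exists>L0. \<forall>L\<ge>L0. \<forall>j. L \<le> 2 * j \<longrightarrow>
    (C * exp (c * real L)) * ((C * real L powr r) ^ j / fact j) \<le> exp (- real L)"
proof -
  \<comment> \<open>With \<open>2j \<ge> L\<close> this gives
    \<open>\<eta>^j \<le> exp (-(|c|+2) L)\<close>: the part \<open>|c| L\<close> cancels the
    exponential factor, one \<open>L\<close> absorbs \<open>C \<le> exp L\<close>, and one is
    left.\<close>
  define \<eta> where "\<eta> = exp (- (2 * (\<bar>c\<bar> + 2)))"
  have "((\<lambda>x::real. x powr (r - 1)) \<longlongrightarrow> 0) at_top" using r by (intro tendsto_neg_powr filterlim_ident) auto
  then have "(\<lambda>L. real L powr (r - 1)) \<longlonglongrightarrow> 0" by (rule filterlim_compose[OF _ filterlim_real_sequentially])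
  then have "(\<lambda>L. (2 * exp 1 * C) * real L powr (r - 1)) \<longlonglongrightarrow> 0" by (rule tendsto_mult_right_zero)
  then have 1: "\<forall>\<^sub>F L in sequentially. (2 * exp 1 * C) * real L powr (r - 1) < \<eta>"
    by (rule order_tendstoD) (simp add: \<eta>_def)
  have "\<forall>\<^sub>F L in sequentially. 0 < L \<and> C \<le> real L \<and> (2 * exp 1 * C) * real L powr (r - 1) < \<eta>"
    using 1 eventually_gt_at_top[of 0] eventually_ge_at_top[of "nat \<lceil>C\<rceil>"]
    by eventually_elim (auto simp: nat_ceiling_le_eq)
  then obtain L0 where L0: "\<And>L. L \<ge> L0 \<Longrightarrow> 0 < L \<and> C \<le> real L \<and> (2 * exp 1 * C) * real L powr (r - 1) < \<eta>"
    by (auto simp: eventually_sequentially)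
  show ?thesis
  proof (intro exI[of _ L0] allI impI)
    fix L j assume L: "L \<ge> L0" and j: "L \<le> 2 * j"
    note L0 = L0[OF L]
    have j0: "0 < j" using j L0 by simp
    have "exp 1 * (C * real L powr r) / real j \<le> exp 1 * (C * real L powr r) / (real L / 2)"
      using j j0 L0 C by (intro divide_left_mono) auto
    also have "\<dots> = (2 * exp 1 * C) * real L powr (r - 1)"
      using L0 by (simp add: powr_diff)
    also have "\<dots> \<le> \<eta>" using L0 by simp
    finally have base: "exp 1 * (C * real L powr r) / real j \<le> \<eta>" .
    have "(C * real L powr r) ^ j / fact j \<le> (exp 1 * (C * real L powr r) / real j) ^ j"
      using C j0 by (intro power_div_fact_le) auto
    also have "\<dots> \<le> \<eta> ^ j" using base C by (intro power_mono) auto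
    also have "\<dots> = exp (- ((\<bar>c\<bar> + 2) * real (2 * j)))"
      unfolding \<eta>_def exp_of_nat_mult[symmetric] by (simp add: algebra_simps)
    also have "\<dots> \<le> exp (- ((\<bar>c\<bar> + 2) * real L))" using j by (simp add: mult_left_mono)
    finally have p: "(C * real L powr r) ^ j / fact j \<le> exp (- ((\<bar>c\<bar> + 2) * real L))" .
    have "C * exp (c * real L) \<le> exp (real L) * exp (\<bar>c\<bar> * real L)"
    proof (intro mult_mono)
      show "C \<le> exp (real L)" using L0 exp_ge_add_one_self[of "real L"] by linarith
      show "exp (c * real L) \<le> exp (\<bar>c\<bar> * real L)" by (simp add: mult_right_mono)
    qed auto
    then have "(C * exp (c * real L)) * ((C * real L powr r) ^ j / fact j) \<le>
        (exp (real L) * exp (\<bar>c\<bar> * real L)) * exp (- ((\<bar>c\<bar> + 2) * real L))"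
      using p by (rule mult_mono) (use C in auto)
    also have "\<dots> = exp (- real L)" by (simp add: mult_exp_exp algebra_simps)
    finally show "(C * exp (c * real L)) * ((C * real L powr r) ^ j / fact j) \<le> exp (- real L)" .
  qed
qed

text \<open>Either \<open>|u|\<^sup>2 \<le> \<theta>\<close>, or \<open>|u|\<^sup>2 \<le> \<theta>\<^bsup>1-p\<^esup> |u|\<^bsup>2p\<^esup>\<close>.\<close>

definition sup_bound :: "real \<Rightarrow> real \<Rightarrow> nat \<Rightarrow> (int \<Rightarrow> real \<Rightarrow> complex) \<Rightarrow> real \<Rightarrow> real" where
  "sup_bound p \<theta> L u t = \<theta> + \<theta> powr (1 - p) * (\<Sum>n\<in>{- int L..int L}. cmod (u n t) powr (2 * p))"

lemma sup_bound_nonneg: "0 \<le> \<theta> \<Longrightarrow> 0 \<le> sup_bound p \<theta> L u t"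
  by (simp add: sup_bound_def sum_nonneg)

lemma norm_power2_le_sup_bound:
  assumes \<theta>: "0 < \<theta>" and p: "1 \<le> p" and n: "\<bar>n\<bar> \<le> int L"
  shows "(cmod (u n t))\<^sup>2 \<le> sup_bound p \<theta> L u t"
proof -
  let ?x = "(cmod (u n t))\<^sup>2"
  have "n \<in> {- int L..int L}" using n by auto
  then have s: "cmod (u n t) powr (2 * p) \<le> (\<Sum>n\<in>{- int L..int L}. cmod (u n t) powr (2 * p))"
    by (rule member_le_sum) auto
  show ?thesis
  proof (cases "?x \<le> \<theta>")
    case True
    then show ?thesis unfolding sup_bound_def using \<theta> s
      by (intro order_trans[OF True]) (simp add: sum_nonneg)
  next
    case False
    then have x: "0 < ?x" "\<theta> \<le> ?x" using \<theta> by auto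
    then have nz: "cmod (u n t) > 0" by simp
    have "?x = ?x powr (1 - p) * ?x powr p" using x by (simp add: powr_add[symmetric])
    also have "?x powr (1 - p) \<le> \<theta> powr (1 - p)" using x \<theta> p by (intro powr_mono2') auto
    also have "?x powr p = cmod (u n t) powr (2 * p)"
      using nz by (simp add: powr_powr[symmetric] powr_numeral)
    also have "\<theta> powr (1 - p) * cmod (u n t) powr (2 * p) \<le> \<theta> powr (1 - p) * (\<Sum>n\<in>{- int L..int L}. cmod (u n t) powr (2 * p))"
      by (intro mult_left_mono s) simp
    finally show ?thesis using \<theta> by (simp add: sup_bound_def mult_right_mono)
  qed
qed

lemma continuous_on_sup_bound:
  assumes "\<And>n. continuous_on UNIV (u n)" "0 < p"
  shows "continuous_on UNIV (sup_bound p \<theta> L u)"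
  unfolding sup_bound_def
  by (intro continuous_intros continuous_on_powr' assms) (use assms(2) in auto)

text \<open>On the box the weight \<open>japanese_bracket n powr (-q)\<close> is at least
  \<open>(1+L)^(-q)\<close>, so dropping it costs the factor \<open>(1+L)^q\<close>.\<close>

lemma nn_integral_sup_bound_le:
  assumes cont: "\<And>n. continuous_on UNIV (u n)" and p: "1 \<le> p" and q: "0 \<le> q" and T: "0 \<le> T" and \<theta>: "0 < \<theta>"
    and X: "spacetime p q T u \<le> ennreal X" "0 \<le> X"
  shows "(\<integral>\<^sup>+ t\<in>{-T..T}. ennreal (sup_bound p \<theta> L u t) \<partial>lborel)
    \<le> ennreal (2 * T * \<theta> + \<theta> powr (1 - p) * ((1 + real L) powr q * X))"
proof -
  let ?S = "\<lambda>t. \<Sum>n\<in>{- int L..int L}. cmod (u n t) powr (2 * p)"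
  let ?I = "\<lambda>t. weighted_moment p q (\<lambda>n. u n t)"
  have [measurable]: "u n \<in> borel_measurable borel" for n using cont by (rule borel_measurable_continuous_onI)
  have S: "ennreal (?S t) \<le> ennreal ((1 + real L) powr q) * ?I t" for t
  proof -
    have "ennreal (?S t) = (\<Sum>n\<in>{- int L..int L}. ennreal (cmod (u n t) powr (2 * p)))"
      by (rule sum_ennreal[symmetric]) simp
    also have "\<dots> \<le> (\<Sum>n\<in>{- int L..int L}. ennreal ((1 + real L) powr q) * ennreal (japanese_bracket n powr (- q) * cmod (u n t) powr (2 * p)))"
    proof (intro sum_mono)
      fix n assume "n \<in> {- int L..int L}"
      then have "\<bar>real_of_int n\<bar> \<le> real L" by auto
      then have "japanese_bracket n \<le> 1 + real L" using japanese_bracket_bounds(3)[of n] by linarith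
      then have "japanese_bracket n powr q \<le> (1 + real L) powr q"
        using q japanese_bracket_bounds(4)[of n] by (intro powr_mono2) auto
      then have "1 \<le> (1 + real L) powr q * japanese_bracket n powr (- q)"
        using japanese_bracket_bounds(4)[of n] by (simp add: powr_minus field_simps)
      then have "1 * cmod (u n t) powr (2 * p) \<le> ((1 + real L) powr q * japanese_bracket n powr (- q)) * cmod (u n t) powr (2 * p)"
        by (intro mult_right_mono) auto
      then show "ennreal (cmod (u n t) powr (2 * p)) \<le> ennreal ((1 + real L) powr q) * ennreal (japanese_bracket n powr (- q) * cmod (u n t) powr (2 * p))"
        by (simp add: ennreal_mult[symmetric] mult.assoc ennreal_leI)
    qed
    also have "\<dots> = ennreal ((1 + real L) powr q) * (\<Sum>n\<in>{- int L..int L}. ennreal (japanese_bracket n powr (- q) * cmod (u n t) powr (2 * p)))"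
      by (rule sum_distrib_left[symmetric])
    also have "(\<Sum>n\<in>{- int L..int L}. ennreal (japanese_bracket n powr (- q) * cmod (u n t) powr (2 * p))) =
        (\<integral>\<^sup>+ n. ennreal (japanese_bracket n powr (- q) * cmod (u n t) powr (2 * p)) * indicator {- int L..int L} n \<partial>count_space UNIV)"
      by (simp add: nn_integral_count_space_indicator[symmetric] nn_integral_count_space_finite del: sum_ennreal)
    also have "\<dots> \<le> ?I t" by (intro nn_integral_mono) (simp add: indicator_def)
    finally have "ennreal (?S t) \<le> ennreal ((1 + real L) powr q) * ?I t" by (simp add: mult_left_mono)
    then show ?thesis .
  qed
  have "(\<integral>\<^sup>+ t\<in>{-T..T}. ennreal (sup_bound p \<theta> L u t) \<partial>lborel) \<le>
      (\<integral>\<^sup>+ t. ennreal \<theta> * indicator {-T..T} t + ennreal (\<theta> powr (1 - p) * (1 + real L) powr q) * (?I t * indicator {-T..T} t) \<partial>lborel)"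
  proof (intro nn_integral_mono)
    fix t
    have "ennreal (sup_bound p \<theta> L u t) = ennreal \<theta> + ennreal (\<theta> powr (1 - p)) * ennreal (?S t)"
      unfolding sup_bound_def using \<theta> by (simp add: ennreal_plus ennreal_mult sum_nonneg)
    also have "\<dots> \<le> ennreal \<theta> + ennreal (\<theta> powr (1 - p)) * (ennreal ((1 + real L) powr q) * ?I t)"
      by (intro add_left_mono mult_left_mono S) simp
    finally show "ennreal (sup_bound p \<theta> L u t) * indicator {-T..T} t \<le>
        ennreal \<theta> * indicator {-T..T} t + ennreal (\<theta> powr (1 - p) * (1 + real L) powr q) * (?I t * indicator {-T..T} t)"
      by (auto simp: indicator_def ennreal_mult mult.assoc)
  qed
  also have "\<dots> = ennreal \<theta> * ennreal (2 * T) + ennreal (\<theta> powr (1 - p) * (1 + real L) powr q) * spacetime p q T u"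
  proof -
    have [measurable]: "?I \<in> borel_measurable borel"
      by (rule borel_measurable_nn_integral_count_space_int) measurable
    show ?thesis unfolding spacetime_def using T
      by (subst nn_integral_add) (auto simp: nn_integral_cmult nn_integral_cmult_indicator)
  qed
  also have "\<dots> \<le> ennreal \<theta> * ennreal (2 * T) + ennreal (\<theta> powr (1 - p) * (1 + real L) powr q) * ennreal X"
    by (intro add_left_mono mult_left_mono X) simp
  also have "\<dots> = ennreal (2 * T * \<theta> + \<theta> powr (1 - p) * ((1 + real L) powr q * X))"
    using \<theta> T X(2) by (simp add: ennreal_mult[symmetric] ennreal_plus[symmetric] mult_ac del: ennreal_plus)
  finally show ?thesis .
qed

section \<open>Uniqueness\<close>

text \<open>The threshold \<open>\<theta> = L^((q+\<delta>)/p)\<close> solves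
  \<open>\<theta>^(1-p) L^(q+\<delta>) = \<theta>\<close>, so the two contributions have the same
  size.\<close>

lemma nn_integral_sup_bound_powr_le:
  assumes cont: "\<And>n. continuous_on UNIV (u n)" and p: "1 \<le> p" and q: "0 \<le> q" and T: "0 \<le> T" and L: "1 \<le> L" and C: "0 \<le> C"
    and X: "spacetime p q T u \<le> ennreal (C * real L powr \<delta>)"
  shows "(\<integral>\<^sup>+ t\<in>{-T..T}. ennreal (sup_bound p (real L powr ((q + \<delta>) / p)) L u t) \<partial>lborel)
    \<le> ennreal ((2 * T + 2 powr q * C) * real L powr ((q + \<delta>) / p))"
proof -
  let ?\<rho> = "(q + \<delta>) / p" and ?x = "real L"
  have x: "1 \<le> ?x" using L by simp
  have "(\<integral>\<^sup>+ t\<in>{-T..T}. ennreal (sup_bound p (?x powr ?\<rho>) L u t) \<partial>lborel)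
      \<le> ennreal (2 * T * ?x powr ?\<rho> + (?x powr ?\<rho>) powr (1 - p) * ((1 + ?x) powr q * (C * ?x powr \<delta>)))"
    using L C by (intro nn_integral_sup_bound_le[OF cont p q T _ X]) auto
  also have "\<dots> \<le> ennreal ((2 * T + 2 powr q * C) * ?x powr ?\<rho>)"
  proof (rule ennreal_leI)
    have "(1 + ?x) powr q \<le> (2 * ?x) powr q" using x q by (intro powr_mono2) auto
    also have "\<dots> = 2 powr q * ?x powr q" by (rule powr_mult)
    finally have "(?x powr ?\<rho>) powr (1 - p) * ((1 + ?x) powr q * (C * ?x powr \<delta>)) \<le>
        (?x powr ?\<rho>) powr (1 - p) * ((2 powr q * ?x powr q) * (C * ?x powr \<delta>))"
      using C by (intro mult_left_mono mult_right_mono) auto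
    also have "\<dots> = (2 powr q * C) * (?x powr (?\<rho> * (1 - p)) * ?x powr q * ?x powr \<delta>)"
      by (simp add: powr_powr)
    also have "?x powr (?\<rho> * (1 - p)) * ?x powr q * ?x powr \<delta> = ?x powr (?\<rho> * (1 - p) + q + \<delta>)"
      by (simp add: powr_add)
    also have "?\<rho> * (1 - p) + q + \<delta> = ?\<rho>" using p by (simp add: field_simps)
    finally show "2 * T * ?x powr ?\<rho> + (?x powr ?\<rho>) powr (1 - p) * ((1 + ?x) powr q * (C * ?x powr \<delta>))
        \<le> (2 * T + 2 powr q * C) * ?x powr ?\<rho>"
      by (simp add: algebra_simps)
  qed
  finally show ?thesis .
qed

text \<open>The equation is imposed only at interior sites, whose neighbours still lie in the box.
  Solutions on the whole lattice and truncations of size at least \<open>L - 1\<close> both qualify,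
  whatever they do at the boundary.\<close>

definition box_solution :: "nat \<Rightarrow> (int \<Rightarrow> real \<Rightarrow> complex) \<Rightarrow> bool" where
  "box_solution L u \<longleftrightarrow> (\<forall>n. continuous_on UNIV (u n)) \<and>
    (\<forall>n t. \<bar>n\<bar> < int L \<longrightarrow> (u n has_vector_derivative lattice_field (\<lambda>m. u m t) n) (at t))"

text \<open>Two pairs of exponents occur because the definition of a good solution lets
  \<open>p\<close> and \<open>q\<close> depend on the solution.\<close>

abbreviation differences_decay ::
    "real \<Rightarrow> real \<Rightarrow> real \<Rightarrow> real \<Rightarrow> real \<Rightarrow> real \<Rightarrow> real \<Rightarrow> real \<Rightarrow> nat \<Rightarrow> bool" where
  "differences_decay p q p' q' \<delta> T C c L0 \<equiv> \<forall>L\<ge>L0. \<forall>u v. box_solution L u \<longrightarrow> box_solution L v \<longrightarrow>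
    (\<forall>n. \<bar>n\<bar> < int L \<longrightarrow> u n 0 = v n 0) \<longrightarrow>
    spacetime p q T u \<le> ennreal (C * real L powr \<delta>) \<longrightarrow> spacetime p' q' T v \<le> ennreal (C * real L powr \<delta>) \<longrightarrow>
    (\<forall>n t. \<bar>n\<bar> \<le> int L \<longrightarrow> \<bar>t\<bar> \<le> T \<longrightarrow> cmod (u n t - v n t) \<le> C * exp (c * real L)) \<longrightarrow>
    (\<forall>n t. 2 * \<bar>n\<bar> \<le> int L \<longrightarrow> \<bar>t\<bar> \<le> T \<longrightarrow> cmod (u n t - v n t) \<le> exp (- real L))"

text \<open>The time-integrated supremum over a box of size \<open>L\<close> grows sublinearly in \<open>L\<close>, so the factorial
  of the comparison estimate beats it together with any exponential bound at the boundary.\<close>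

lemma difference_decay:
  fixes p q p' q' \<delta> T C c :: real
  assumes p: "1 \<le> p" "0 \<le> q" "q + \<delta> < p" and p': "1 \<le> p'" "0 \<le> q'" "q' + \<delta> < p'"
    and T: "0 \<le> T" and C: "0 \<le> C"
  shows "\<exists>L0. differences_decay p q p' q' \<delta> T C c L0"
proof -
  define \<rho> where "\<rho> = (q + \<delta>) / p"
  define \<rho>' where "\<rho>' = (q' + \<delta>) / p'"
  \<comment> \<open>Including 0 ensures \<open>L^r \<ge> 1\<close>, so that the constant
    \<open>2T\<close> can be absorbed into a multiple of \<open>L^r\<close>.\<close>
  define r where "r = max 0 (max \<rho> \<rho>')"
  have r: "r < 1" "0 \<le> r" "\<rho> \<le> r" "\<rho>' \<le> r" using p p' by (auto simp: r_def \<rho>_def \<rho>'_def divide_less_eq)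
  define K where "K = (2 * T + 2 powr q * C) + (2 * T + 2 powr q' * C)"
  have K0: "0 \<le> K" using T C by (simp add: K_def)
  define C' where "C' = C + (2 * T + 6 * K)"
  have C': "C \<le> C'" "2 * T + 6 * K \<le> C'" "0 \<le> C'" using T K0 C by (auto simp: C'_def)
  obtain L0 where L0: "\<And>L j. \<lbrakk>L0 \<le> L; L \<le> 2 * j\<rbrakk> \<Longrightarrow>
      (C' * exp (c * real L)) * ((C' * real L powr r) ^ j / fact j) \<le> exp (- real L)"
    using factorial_decay[OF r(1) C'(3), of c] by blast
  show ?thesis
  proof (intro exI[of _ "max 1 L0"] allI impI)
    fix L :: nat and u v :: "int \<Rightarrow> real \<Rightarrow> complex" and n :: int and t :: real
    assume L: "max 1 L0 \<le> L" and u: "box_solution L u" and v: "box_solution L v"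
      and init: "\<forall>n. \<bar>n\<bar> < int L \<longrightarrow> u n 0 = v n 0"
      and su: "spacetime p q T u \<le> ennreal (C * real L powr \<delta>)" and sv: "spacetime p' q' T v \<le> ennreal (C * real L powr \<delta>)"
      and M: "\<forall>n t. \<bar>n\<bar> \<le> int L \<longrightarrow> \<bar>t\<bar> \<le> T \<longrightarrow> cmod (u n t - v n t) \<le> C * exp (c * real L)"
      and n: "2 * \<bar>n\<bar> \<le> int L" and t: "\<bar>t\<bar> \<le> T"
    have cu: "continuous_on UNIV (u n)" and cv: "continuous_on UNIV (v n)" for n
      using u v by (auto simp: box_solution_def)
    have du: "(u n has_vector_derivative lattice_field (\<lambda>m. u m t) n) (at t)"
      and dv: "(v n has_vector_derivative lattice_field (\<lambda>m. v m t) n) (at t)" if "\<bar>n\<bar> < int L" for n t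
      using u v that by (auto simp: box_solution_def)
    let ?x = "real L"
    have x: "1 \<le> ?x" using L by simp
    define Au where "Au = sup_bound p (?x powr \<rho>) L u"
    define Av where "Av = sup_bound p' (?x powr \<rho>') L v"
    have th: "0 < ?x powr \<rho>" "0 < ?x powr \<rho>'" using x by auto
    have A0: "0 \<le> Au t" "0 \<le> Av t" for t unfolding Au_def Av_def by (intro sup_bound_nonneg; simp)+
    define A where "A t = Au t + Av t" for t
    \<comment> \<open>The number of steps from site \<open>n\<close> to the boundary; at least
      \<open>L/2\<close> for sites in the half box.\<close>
    define j where "j = L - nat \<bar>n\<bar>"
    have j: "\<bar>n\<bar> + int j \<le> int L" "L \<le> 2 * j" using n by (auto simp: j_def)
    have le: "?x powr \<rho> \<le> ?x powr r" "?x powr \<rho>' \<le> ?x powr r" using x r by (auto intro: powr_mono)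
    have cA: "continuous_on UNIV Au" "continuous_on UNIV Av"
      unfolding Au_def Av_def using p p' by (intro continuous_on_sup_bound cu cv; simp)+
    have [measurable]: "Au \<in> borel_measurable borel" "Av \<in> borel_measurable borel"
      using cA by (auto intro: borel_measurable_continuous_onI)
    have "(\<integral>\<^sup>+ t\<in>{-T..T}. ennreal (A t) \<partial>lborel) =
        (\<integral>\<^sup>+ t\<in>{-T..T}. ennreal (Au t) \<partial>lborel) + (\<integral>\<^sup>+ t\<in>{-T..T}. ennreal (Av t) \<partial>lborel)"
      unfolding A_def using A0 by (subst nn_integral_add[symmetric]) (auto simp: distrib_right)
    also have "\<dots> \<le> ennreal ((2 * T + 2 powr q * C) * ?x powr \<rho>) + ennreal ((2 * T + 2 powr q' * C) * ?x powr \<rho>')"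
      unfolding Au_def Av_def \<rho>_def \<rho>'_def using p p' T C L
      by (intro add_mono nn_integral_sup_bound_powr_le cu cv su sv) auto
    also have "\<dots> = ennreal ((2 * T + 2 powr q * C) * ?x powr \<rho> + (2 * T + 2 powr q' * C) * ?x powr \<rho>')"
      using T C by (intro ennreal_plus[symmetric]) auto
    also have "\<dots> \<le> ennreal (K * ?x powr r)"
      using T C le unfolding K_def
      by (subst distrib_right, intro ennreal_leI add_mono mult_left_mono) auto
    finally have intA: "(\<integral>\<^sup>+ t\<in>{-T..T}. ennreal (A t) \<partial>lborel) \<le> ennreal (K * ?x powr r)" .
    have "cmod (u n t - v n t) \<le> (C * exp (c * ?x)) * ((2 * T + 6 * (K * ?x powr r)) ^ j / fact j)"
    proof (rule comparison[where A=A and L=L and T=T, OF du dv init[rule_format] _ _ _ intA _ _ M[rule_format] j(1) t])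
      show "(cmod (u n t))\<^sup>2 \<le> A t" if "\<bar>n\<bar> \<le> int L" for n t
        using norm_power2_le_sup_bound[OF th(1) p(1) that, of u t] A0[of t] by (simp add: A_def Au_def)
      show "(cmod (v n t))\<^sup>2 \<le> A t" if "\<bar>n\<bar> \<le> int L" for n t
        using norm_power2_le_sup_bound[OF th(2) p'(1) that, of v t] A0[of t] by (simp add: A_def Av_def)
      show "continuous_on UNIV A" unfolding A_def by (intro continuous_intros cA)
    qed (use K0 A0 in \<open>auto simp: A_def\<close>)
    also have "\<dots> \<le> (C' * exp (c * ?x)) * ((C' * ?x powr r) ^ j / fact j)"
    proof -
      have "1 \<le> ?x powr r" using x r by (simp add: ge_one_powr_ge_zero)
      then have "2 * T * 1 \<le> 2 * T * ?x powr r" using T by (intro mult_left_mono) auto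
      then have "2 * T + 6 * (K * ?x powr r) \<le> (2 * T + 6 * K) * ?x powr r" by (simp add: algebra_simps)
      also have "\<dots> \<le> C' * ?x powr r" using C' by (intro mult_right_mono) auto
      finally have *: "2 * T + 6 * (K * ?x powr r) \<le> C' * ?x powr r" .
      show ?thesis
        by (rule mult_mono) (use * C' C T K0 in \<open>auto intro!: divide_right_mono power_mono mult_right_mono\<close>)
    qed
    also have "\<dots> \<le> exp (- ?x)" using L j(2) by (intro L0) auto
    finally show "cmod (u n t - v n t) \<le> exp (- ?x)" .
  qed
qed

section \<open>Removal of the linear term by a phase rotation\<close>

definition phase_shift :: "real \<Rightarrow> (int \<Rightarrow> real \<Rightarrow> complex) \<Rightarrow> int \<Rightarrow> real \<Rightarrow> complex" where
  "phase_shift s u n t = exp (\<i> * complex_of_real (s * t)) * u n t"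

lemma norm_phase_shift[simp]: "cmod (phase_shift s u n t) = cmod (u n t)"
  by (simp add: phase_shift_def norm_mult)

lemma phase_shift_at_0[simp]: "phase_shift s u n 0 = u n 0"
  by (simp add: phase_shift_def)

lemma phase_shift_derivative:
  assumes "(u n has_vector_derivative u') (at t)"
  shows "(phase_shift s u n has_vector_derivative
    \<i> * complex_of_real s * phase_shift s u n t + exp (\<i> * complex_of_real (s * t)) * u') (at t)"
proof -
  have lin: "((\<lambda>t. \<i> * complex_of_real (s * t)) has_vector_derivative \<i> * complex_of_real s) (at t)"
    by (auto intro!: derivative_eq_intros has_vector_derivative_of_real)
  have "((\<lambda>t. exp (\<i> * complex_of_real (s * t))) has_vector_derivative \<i> * complex_of_real s * exp (\<i> * complex_of_real (s * t))) (at t)"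
    using field_vector_diff_chain_at[OF lin DERIV_exp] by (simp add: o_def)
  from has_vector_derivative_mult[OF this assms] show ?thesis
    by (simp add: phase_shift_def[abs_def] algebra_simps)
qed

text \<open>Gauge covariance: apart from moduli, the field is linear in \<open>z\<close>.\<close>

lemma lattice_field_phase_shift: "lattice_field (\<lambda>m. phase_shift s u m t) n = exp (\<i> * complex_of_real (s * t)) * lattice_field (\<lambda>m. u m t) n"
  unfolding lattice_field_def norm_phase_shift by (simp add: phase_shift_def algebra_simps)

lemma AL_solution_imp_phase_shifted:
  assumes "AL_solution \<alpha>"
  shows "(phase_shift 2 \<alpha> n has_vector_derivative lattice_field (\<lambda>m. phase_shift 2 \<alpha> m t) n) (at t)"
proof -
  let ?d = "vector_derivative (\<alpha> n) (at t)"
  have d: "(\<alpha> n has_vector_derivative ?d) (at t)"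
    using assms by (simp add: AL_solution_def vector_derivative_works)
  have eq: "\<i> * ?d = - (1 + complex_of_real ((cmod (\<alpha> n t))\<^sup>2)) * (\<alpha> (n + 1) t + \<alpha> (n - 1) t) + 2 * \<alpha> n t"
    using assms by (simp add: AL_solution_def)
  have "?d = - \<i> * (\<i> * ?d)" by simp
  also have "\<dots> = lattice_field (\<lambda>m. \<alpha> m t) n - 2 * \<i> * \<alpha> n t"
    unfolding eq lattice_field_def by (simp add: algebra_simps)
  finally have D: "?d = lattice_field (\<lambda>m. \<alpha> m t) n - 2 * \<i> * \<alpha> n t" .
  have "\<i> * complex_of_real 2 * phase_shift 2 \<alpha> n t + exp (\<i> * complex_of_real (2 * t)) * ?d = lattice_field (\<lambda>m. phase_shift 2 \<alpha> m t) n"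
    unfolding lattice_field_phase_shift D by (simp add: phase_shift_def algebra_simps)
  then show ?thesis using phase_shift_derivative[where u=\<alpha> and n=n and t=t, OF d, of 2] by simp
qed

lemma phase_shifted_imp_AL_solution:
  assumes "\<And>n t. (u n has_vector_derivative lattice_field (\<lambda>m. u m t) n) (at t)"
  shows "AL_solution (phase_shift (-2) u)"
  unfolding AL_solution_def
proof (intro allI conjI)
  fix n t
  let ?\<alpha> = "phase_shift (-2) u"
  have d: "(?\<alpha> n has_vector_derivative lattice_field (\<lambda>m. ?\<alpha> m t) n - \<i> * 2 * ?\<alpha> n t) (at t)"
    using phase_shift_derivative[where u=u and n=n and t=t, OF assms, of "-2"] by (simp add: lattice_field_phase_shift)
  then show "?\<alpha> n differentiable at t" by (rule differentiableI_vector)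
  show "\<i> * vector_derivative (?\<alpha> n) (at t) =
      - (1 + complex_of_real ((cmod (?\<alpha> n t))\<^sup>2)) * (?\<alpha> (n + 1) t + ?\<alpha> (n - 1) t) + 2 * ?\<alpha> n t"
    unfolding vector_derivative_at[OF d] lattice_field_def by (simp add: algebra_simps)
qed

lemma spacetime_phase_shift[simp]: "spacetime p q T (phase_shift s u) = spacetime p q T u"
  by (simp add: spacetime_def)

lemma spacetime_mono: "T \<le> T' \<Longrightarrow> spacetime p q T u \<le> spacetime p q T' u"
  unfolding spacetime_def by (intro nn_integral_mono) (auto simp: indicator_def)

abbreviation weighted_mass :: "real \<Rightarrow> (int \<Rightarrow> complex) \<Rightarrow> ennreal" where
  "weighted_mass c z \<equiv> \<integral>\<^sup>+ n. ennreal (exp (- c * japanese_bracket n) * (cmod (z n))\<^sup>2) \<partial>count_space UNIV"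

text \<open>A single term of the weighted sum is at most the supremum. This turns the second
  defining condition into the exponential boundary bound that the comparison starts from.\<close>

lemma good_solution_pointwise_bound:
  fixes \<alpha> :: "int \<Rightarrow> real \<Rightarrow> complex"
  assumes c: "c > 0" and fin: "(SUP t\<in>{-T..T}. weighted_mass c (\<lambda>n. \<alpha> n t)) < \<infinity>"
  obtains B where "0 \<le> B" "\<And>n t (L :: nat). \<lbrakk>\<bar>n\<bar> \<le> int L; \<bar>t\<bar> \<le> T\<rbrakk> \<Longrightarrow> cmod (\<alpha> n t) \<le> B * exp (c * real L)"
proof -
  define S where "S = (SUP t\<in>{-T..T}. weighted_mass c (\<lambda>n. \<alpha> n t))"
  define s where "s = enn2real S"
  have S: "S = ennreal s" using fin by (simp add: s_def S_def less_top)
  have s0: "0 \<le> s" by (simp add: s_def)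
  show ?thesis
  proof (rule that)
    show "0 \<le> sqrt (s * exp c)" using s0 by simp
    fix n t and L :: nat assume n: "\<bar>n\<bar> \<le> int L" and t: "\<bar>t\<bar> \<le> T"
    let ?g = "\<lambda>n. ennreal (exp (- c * japanese_bracket n) * (cmod (\<alpha> n t))\<^sup>2)"
    have "?g n = (\<integral>\<^sup>+ m. ?g m * indicator {n} m \<partial>count_space UNIV)" by simp
    also have "\<dots> \<le> (\<integral>\<^sup>+ m. ?g m \<partial>count_space UNIV)" by (intro nn_integral_mono) (simp add: indicator_def)
    also have "\<dots> \<le> S" unfolding S_def using t by (intro SUP_upper) auto
    finally have "exp (- c * japanese_bracket n) * (cmod (\<alpha> n t))\<^sup>2 \<le> s" using s0 by (simp add: S ennreal_le_iff)
    then have "(cmod (\<alpha> n t))\<^sup>2 \<le> s * exp (c * japanese_bracket n)"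
      by (simp add: exp_minus field_simps)
    also have "\<dots> \<le> s * exp (c + c * real L)"
    proof -
      have "\<bar>real_of_int n\<bar> \<le> real L" using n by (metis of_int_abs of_int_le_iff of_int_of_nat_eq)
      then have "japanese_bracket n \<le> 1 + real L" using japanese_bracket_bounds(3)[of n] by simp
      then have "c * japanese_bracket n \<le> c * (1 + real L)" using c by (intro mult_left_mono) auto
      then show ?thesis using s0 by (intro mult_left_mono) (auto simp: algebra_simps)
    qed
    also have "\<dots> \<le> (s * exp c) * (exp (c * real L))\<^sup>2"
    proof -
      have "1 * exp (c * real L) \<le> exp (c * real L) * exp (c * real L)" using c by (intro mult_right_mono) auto
      then show ?thesis using s0 by (simp add: exp_add power2_eq_square mult.assoc mult_left_mono)
    qed
    finally have "cmod (\<alpha> n t) \<le> sqrt ((s * exp c) * (exp (c * real L))\<^sup>2)" by (rule real_le_rsqrt)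
    then show "cmod (\<alpha> n t) \<le> sqrt (s * exp c) * exp (c * real L)" by (simp add: real_sqrt_mult)
  qed
qed

text \<open>A deterministic statement. A fixed good solution has one finite space-time integral, so
  the decay result applies with \<open>\<delta> = 0\<close>; the difference at a given site is at
  most \<open>exp (-L)\<close> for all large \<open>L\<close>.\<close>

lemma good_solution_unique:
  assumes "good_solution \<alpha>" "good_solution \<alpha>'" and init: "\<And>n. \<alpha> n 0 = \<alpha>' n 0"
  shows "\<alpha> = \<alpha>'"
proof (intro ext)
  fix n :: int and t :: real
  define T where "T = \<bar>t\<bar> + 1"
  have T: "T > 0" "\<bar>t\<bar> \<le> T" by (auto simp: T_def)
  obtain p q c where p: "p > q" "q > 1" "spacetime p q T \<alpha> < \<infinity>" and c: "c > 0"
      "(SUP t\<in>{-T..T}. weighted_mass c (\<lambda>n. \<alpha> n t)) < \<infinity>"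
    using assms(1) T unfolding good_solution_def spacetime_def by blast
  obtain p' q' c' where p': "p' > q'" "q' > 1" "spacetime p' q' T \<alpha>' < \<infinity>" and c': "c' > 0"
      "(SUP t\<in>{-T..T}. weighted_mass c' (\<lambda>n. \<alpha>' n t)) < \<infinity>"
    using assms(2) T unfolding good_solution_def spacetime_def by blast
  obtain B where B: "0 \<le> B" "\<And>n t (L :: nat). \<lbrakk>\<bar>n\<bar> \<le> int L; \<bar>t\<bar> \<le> T\<rbrakk> \<Longrightarrow> cmod (\<alpha> n t) \<le> B * exp (c * real L)"
    using good_solution_pointwise_bound[OF c] by metis
  obtain B' where B': "0 \<le> B'" "\<And>n t (L :: nat). \<lbrakk>\<bar>n\<bar> \<le> int L; \<bar>t\<bar> \<le> T\<rbrakk> \<Longrightarrow> cmod (\<alpha>' n t) \<le> B' * exp (c' * real L)"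
    using good_solution_pointwise_bound[OF c'] by metis
  define X where "X = enn2real (spacetime p q T \<alpha>) + enn2real (spacetime p' q' T \<alpha>')"
  define C where "C = X + B + B'"
  define d where "d = max c c'"
  have C: "0 \<le> C" using B B' by (simp add: C_def X_def)
  let ?u = "phase_shift 2 \<alpha>" and ?v = "phase_shift 2 \<alpha>'"
  have du: "(?u n has_vector_derivative lattice_field (\<lambda>m. ?u m t) n) (at t)"
    "(?v n has_vector_derivative lattice_field (\<lambda>m. ?v m t) n) (at t)" for n t
    using assms by (auto simp: good_solution_def intro: AL_solution_imp_phase_shifted)
  have cont: "continuous_on UNIV (?u n)" "continuous_on UNIV (?v n)" for n
    using has_vector_derivative_continuous[OF du(1)] has_vector_derivative_continuous[OF du(2)]
    by (auto intro!: continuous_at_imp_continuous_on)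
  have pq: "1 \<le> p" "0 \<le> q" "q + 0 < p" "1 \<le> p'" "0 \<le> q'" "q' + 0 < p'" using p p' by auto
  note decay = difference_decay[OF pq less_imp_le[OF T(1)] C, of d]
  obtain L0 where L0: "differences_decay p q p' q' 0 T C d L0"
    using decay by (rule exE)
  have "cmod (?u n t - ?v n t) \<le> exp (- real L)" if L: "max (max 1 L0) (nat (2 * \<bar>n\<bar>)) \<le> L" for L
  proof (rule L0[rule_format])
    show "box_solution L ?u" "box_solution L ?v" using cont du by (auto simp: box_solution_def)
    have "spacetime p q T \<alpha> \<le> ennreal C" "spacetime p' q' T \<alpha>' \<le> ennreal C"
      using p(3) p'(3) B B' unfolding C_def X_def
      by (subst ennreal_enn2real[symmetric]; simp add: ennreal_leI less_top)+
    then show "spacetime p q T ?u \<le> ennreal (C * real L powr 0)" "spacetime p' q' T ?v \<le> ennreal (C * real L powr 0)"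
      using L by auto
    fix n t assume n: "\<bar>n\<bar> \<le> int L" "\<bar>t\<bar> \<le> T"
    have "cmod (?u n t - ?v n t) \<le> cmod (\<alpha> n t) + cmod (\<alpha>' n t)"
      using norm_triangle_ineq4[of "?u n t" "?v n t"] by simp
    also have "\<dots> \<le> B * exp (c * real L) + B' * exp (c' * real L)" by (intro add_mono B B' n)
    also have "\<dots> \<le> B * exp (d * real L) + B' * exp (d * real L)"
      using B(1) B'(1) by (intro add_mono mult_left_mono) (auto simp: d_def mult_right_mono)
    also have "\<dots> \<le> C * exp (d * real L)" by (simp add: C_def X_def algebra_simps)
    finally show "cmod (?u n t - ?v n t) \<le> C * exp (d * real L)" .
  qed (use L T init in auto)
  then have "\<forall>\<^sub>F L in sequentially. cmod (?u n t - ?v n t) \<le> exp (- real L)"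
    using eventually_ge_at_top by (rule eventually_mono[rotated])
  moreover have "(\<lambda>L. exp (- real L)) \<longlonglongrightarrow> 0"
    by (rule filterlim_compose[OF exp_at_bot]) (intro filterlim_uminus_at_bot_at_top[THEN filterlim_compose] filterlim_real_sequentially)
  ultimately have "cmod (?u n t - ?v n t) \<le> 0" by (intro tendsto_lowerbound[rotated]) auto
  then have "?u n t = ?v n t" by simp
  then show "\<alpha> n t = \<alpha>' n t" by (simp add: phase_shift_def)
qed

section \<open>Existence\<close>

lemma geometric_increments_tail:
  fixes f :: "nat \<Rightarrow> 'a::banach"
  assumes f: "\<And>k. k \<ge> K \<Longrightarrow> norm (f k - f (Suc k)) \<le> (1 / 2) ^ k"
  shows "f \<longlonglongrightarrow> lim f" "\<And>k. k \<ge> K \<Longrightarrow> norm (f k - lim f) \<le> 2 * (1 / 2) ^ k"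
proof -
  \<comment> \<open>The subtracted term is what makes the induction on \<open>d\<close>
    close.\<close>
  have tail: "norm (f k - f (k + d)) \<le> 2 * (1 / 2) ^ k - 2 * (1 / 2) ^ (k + d)" if "k \<ge> K" for k d
  proof (induction d)
    case (Suc d)
    have "norm (f k - f (k + Suc d)) \<le> norm (f k - f (k + d)) + norm (f (k + d) - f (Suc (k + d)))"
      using norm_triangle_ineq[of "f k - f (k + d)" "f (k + d) - f (Suc (k + d))"] by simp
    then show ?case using Suc f[of "k + d"] that by simp
  qed simp
  have "Cauchy f"
  proof (rule metric_CauchyI)
    fix e :: real assume "e > 0"
    then obtain n where n: "(1 / 2) ^ n < e / 4" using real_arch_pow_inv[of "e / 4" "1 / 2"] by auto
    define N where "N = max K n"
    have N: "K \<le> N" "n \<le> N" by (auto simp: N_def)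
    have *: "norm (f N - f i) \<le> 2 * (1 / 2) ^ N" if "N \<le> i" for i
    proof -
      have "norm (f N - f i) \<le> 2 * (1 / 2) ^ N - 2 * (1 / 2) ^ i"
        using tail[OF N(1), of "i - N"] that by simp
      moreover have "(0::real) \<le> (1 / 2) ^ i" by simp
      ultimately show ?thesis by linarith
    qed
    have "(1 / 2 :: real) ^ N \<le> (1 / 2) ^ n" using N(2) by (intro power_decreasing) auto
    with n have N4: "4 * (1 / 2) ^ N < e" by linarith
    have "dist (f i) (f j) < e" if "N \<le> i" "N \<le> j" for i j
    proof -
      have "norm (f i - f j) \<le> norm (f N - f i) + norm (f N - f j)"
        using dist_triangle3[of "f i" "f j" "f N"] by (simp only: dist_norm)
      then show ?thesis using *[OF that(1)] *[OF that(2)] N4 unfolding dist_norm by linarith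
    qed
    then show "\<exists>M. \<forall>m\<ge>M. \<forall>n\<ge>M. dist (f m) (f n) < e" by blast
  qed
  then show lim: "f \<longlonglongrightarrow> lim f" by (simp add: Cauchy_convergent convergent_LIMSEQ_iff[symmetric])
  fix k assume k: "k \<ge> K"
  have "(\<lambda>d. norm (f k - f (d + k))) \<longlonglongrightarrow> norm (f k - lim f)"
    by (intro tendsto_intros LIMSEQ_ignore_initial_segment lim)
  moreover have "norm (f k - f (d + k)) \<le> 2 * (1 / 2) ^ k" for d
  proof -
    have "(0::real) \<le> (1 / 2) ^ (k + d)" by simp
    then show ?thesis using tail[OF k, of d] by (simp only: add.commute[of d k])
  qed
  ultimately show "norm (f k - lim f) \<le> 2 * (1 / 2) ^ k" by (intro tendsto_upperbound) auto
qed

lemma box_solution_flow: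
  assumes "L \<le> Suc N"
  shows "box_solution L (flow N a)"
  unfolding box_solution_def lattice_field_def
  using assms by (intro conjI allI impI continuous_on_flow flow_derivative) auto

lemma norm_flow_le_mass: "cmod (flow N a n t) \<le> mass N a"
proof (cases "\<bar>n\<bar> \<le> int N")
  case True
  then show ?thesis using norm_le_mass[OF True, of "\<lambda>n. flow N a n t"] by (simp add: mass_flow)
next
  case False
  then show ?thesis using mass_ge_1[of N a] by (simp add: flow_outside)
qed

lemma exp_neg_le_powr: "exp (- x) \<le> 4 * (1 + x) powr (- 2)" if "0 \<le> x" for x :: real
proof -
  define y where "y = x / 2"
  have y: "x = 2 * y" by (simp add: y_def)
  have "1 + y \<le> exp y" by (rule exp_ge_add_one_self)
  then have "(1 + x) / 2 \<le> exp y" using that y by argo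
  then have "((1 + x) / 2)\<^sup>2 \<le> (exp y)\<^sup>2" using that by (intro power_mono) auto
  also have "(exp y)\<^sup>2 = exp x" unfolding y by (rule exp_double[symmetric])
  finally have "(1 + x)\<^sup>2 \<le> 4 * exp x" by (simp add: power_divide)
  moreover have "(1 + x) powr (- 2) = 1 / (1 + x)\<^sup>2" using that by (simp add: powr_minus_divide powr_numeral)
  moreover have "exp (- x) = 1 / exp x" by (simp add: exp_minus divide_inverse)
  ultimately show ?thesis using that by (simp only:) (simp add: field_simps)
qed

lemma le_power2_mono: "m \<le> int (2 ^ l)" if "m \<le> int (2 ^ k)" "k \<le> l"
  using that(1) by (rule order_trans) (use that(2) in simp)

text \<open>A scale beyond \<open>k0\<close> whose half box contains \<open>n\<close>, yet no larger
  than a constant plus \<open>4|n|\<close>. It converts bounds exponential in the box size into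
  bounds exponential in \<open>|n|\<close>.\<close>

lemma exists_power2_between:
  fixes n :: int
  obtains k where "k0 \<le> k" "2 * \<bar>n\<bar> \<le> int (2 ^ k)" "real (2 ^ k) \<le> real (2 ^ k0) + 4 * \<bar>real_of_int n\<bar>"
proof (cases "2 * \<bar>n\<bar> \<le> int (2 ^ k0)")
  case True
  then show ?thesis using that[of k0] by simp
next
  case False
  define m where "m = nat (2 * \<bar>n\<bar>)"
  define k where "k = (LEAST k. m \<le> 2 ^ k)"
  have "m \<le> 2 ^ m" using less_exp[of m] by simp
  then have k: "m \<le> 2 ^ k" unfolding k_def by (rule LeastI)
  have "2 ^ k0 < m" using False by (simp add: m_def)
  then have "(2::nat) ^ k0 < 2 ^ k" using k by linarith
  then have kk: "k0 < k" by simp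
  then have "\<not> m \<le> 2 ^ (k - 1)" unfolding k_def using not_less_Least[of "k - 1" "\<lambda>k. m \<le> 2 ^ k"] k_def by simp
  moreover have "(2::nat) ^ k = 2 * 2 ^ (k - 1)" using kk by (cases k) auto
  ultimately have "2 ^ k < 2 * m" by simp
  then have "real (2 ^ k) < real (2 * m)" by (rule of_nat_less_iff[THEN iffD2])
  also have "\<dots> = 4 * \<bar>real_of_int n\<bar>" by (simp add: m_def)
  finally have "real (2 ^ k) < 4 * \<bar>real_of_int n\<bar>" .
  then have "real (2 ^ k) \<le> real (2 ^ k0) + 4 * \<bar>real_of_int n\<bar>"
    using of_nat_0_le_iff[where 'a=real, of "2 ^ k0"] by linarith
  moreover have "2 * \<bar>n\<bar> \<le> int (2 ^ k)" using k unfolding m_def by linarith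
  ultimately show ?thesis using that[of k] kk by simp
qed

text \<open>Truncations at \<open>2^k\<close> and \<open>2^(k+1)\<close> solve the same equation
  inside the smaller box with the same data, so on half of it they differ by at most
  \<open>2^(-k)\<close> for large \<open>k\<close>. The truncations thus converge at each site,
  uniformly on bounded time intervals.\<close>

lemma good_solution_exists:
  fixes p q \<delta> :: real
  assumes p: "1 < q" "0 < \<delta>" "q + \<delta> < p"
    and X: "\<forall>j::nat. \<exists>C. \<forall>k. spacetime p q (real j) (flow (2 ^ k) a) \<le> ennreal (C * real (2 ^ k) powr \<delta>)"
    and lim: "\<forall>j::nat. liminf (\<lambda>k. spacetime p q (real j) (flow (2 ^ k) a)) < \<infinity>"
    and mass: "\<exists>C c. \<forall>k. mass (2 ^ k) a \<le> C * exp (c * real (2 ^ k))"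
  shows "\<exists>\<alpha>. good_solution \<alpha> \<and> (\<forall>n. \<alpha> n 0 = a n)"
proof -
  obtain B0 c0 where B0: "\<And>k. mass (2 ^ k) a \<le> B0 * exp (c0 * real (2 ^ k))" using mass by blast
  define B where "B = \<bar>B0\<bar>"
  define c where "c = \<bar>c0\<bar>"
  have Bc: "0 \<le> B" "0 \<le> c" by (auto simp: B_def c_def)
  have B: "cmod (flow (2 ^ k) a n t) \<le> B * exp (c * real (2 ^ k))" for k n t
  proof -
    have "cmod (flow (2 ^ k) a n t) \<le> B0 * exp (c0 * real (2 ^ k))"
      using norm_flow_le_mass B0 by (rule order_trans)
    also have "\<dots> \<le> B * exp (c * real (2 ^ k))"
      by (intro mult_mono) (auto simp: B_def c_def mult_right_mono)
    finally show ?thesis .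
  qed
  have decay: "\<exists>k0. \<forall>k\<ge>k0. \<forall>n t. 2 * \<bar>n\<bar> \<le> int (2 ^ k) \<longrightarrow> \<bar>t\<bar> \<le> real j \<longrightarrow>
      cmod (flow (2 ^ k) a n t - flow (2 ^ Suc k) a n t) \<le> (1 / 2) ^ k" for j
  proof -
    obtain C0 where C0: "\<And>k. spacetime p q (real j) (flow (2 ^ k) a) \<le> ennreal (C0 * real (2 ^ k) powr \<delta>)"
      using X by blast
    \<comment> \<open>One constant for both scales: \<open>2 powr \<delta>\<close> transfers the
      bound at \<open>2^(k+1)\<close> to \<open>2^k\<close>, and \<open>2 * B\<close> adds the two
      sup bounds. For the same reason the exponential rate is \<open>2 * c\<close>.\<close>
    define C where "C = \<bar>C0\<bar> * 2 powr \<delta> + 2 * B"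
    have C: "0 \<le> C" "2 * B \<le> C" "\<bar>C0\<bar> * 2 powr \<delta> \<le> C" using Bc by (auto simp: C_def)
    have "1 \<le> 2 powr \<delta>" using p by (simp add: ge_one_powr_ge_zero)
    then have C1: "\<bar>C0\<bar> \<le> C" using C(3) mult_left_mono[of 1 "2 powr \<delta>" "\<bar>C0\<bar>"] by simp
    obtain L0 where L0: "differences_decay p q p q \<delta> (real j) C (2 * c) L0"
      using difference_decay[of p q \<delta> p q "real j" C "2 * c"] p C by fastforce
    show ?thesis
    proof (intro exI[of _ L0] allI impI)
      fix k n t assume k: "L0 \<le> k" and n: "2 * \<bar>n\<bar> \<le> int (2 ^ k)" and t: "\<bar>t\<bar> \<le> real j"
      let ?L = "2 ^ k :: nat"
      have kL: "k \<le> ?L" using less_exp[of k] by simp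
      have "cmod (flow (2 ^ k) a n t - flow (2 ^ Suc k) a n t) \<le> exp (- real ?L)"
      proof (rule L0[rule_format])
        show "L0 \<le> ?L" using k kL by (rule order_trans)
        show "box_solution ?L (flow (2 ^ k) a)" "box_solution ?L (flow (2 ^ Suc k) a)"
          by (auto intro!: box_solution_flow)
        show "flow (2 ^ k) a n 0 = flow (2 ^ Suc k) a n 0" if "\<bar>n\<bar> < int ?L" for n
          using that by (simp add: flow_0)
        show "spacetime p q (real j) (flow (2 ^ k) a) \<le> ennreal (C * real ?L powr \<delta>)"
          using C1 by (intro order_trans[OF C0] ennreal_leI mult_right_mono) auto
        have "C0 * real (2 ^ Suc k) powr \<delta> = (C0 * 2 powr \<delta>) * real ?L powr \<delta>"
          by (simp add: powr_mult)
        also have "\<dots> \<le> C * real ?L powr \<delta>"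
        proof (rule mult_right_mono)
          have "C0 * 2 powr \<delta> \<le> \<bar>C0\<bar> * 2 powr \<delta>" by (intro mult_right_mono) auto
          then show "C0 * 2 powr \<delta> \<le> C" using C(3) by linarith
        qed simp
        finally show "spacetime p q (real j) (flow (2 ^ Suc k) a) \<le> ennreal (C * real ?L powr \<delta>)"
          by (intro order_trans[OF C0] ennreal_leI)
        fix n t
        have "cmod (flow (2 ^ k) a n t - flow (2 ^ Suc k) a n t) \<le> B * exp (c * real ?L) + B * exp (c * real (2 ^ Suc k))"
          by (intro order_trans[OF norm_triangle_ineq4] add_mono B)
        also have "\<dots> \<le> B * exp (2 * c * real ?L) + B * exp (2 * c * real ?L)"
          using Bc by (intro add_mono mult_left_mono) (auto simp: mult_right_mono)
        also have "\<dots> \<le> C * exp (2 * c * real ?L)" using C(2) by (simp add: mult_right_mono)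
        finally show "cmod (flow (2 ^ k) a n t - flow (2 ^ Suc k) a n t) \<le> C * exp (2 * c * real ?L)" .
      qed (use n t in auto)
      also have "\<dots> \<le> exp (- real k)" using kL by simp
      also have "\<dots> = exp (- 1) ^ k" by (simp add: exp_of_nat_mult[symmetric])
      also have "\<dots> \<le> (1 / 2) ^ k"
        using exp_ge_add_one_self[of 1] by (intro power_mono) (auto simp: exp_minus field_simps)
      finally show "cmod (flow (2 ^ k) a n t - flow (2 ^ Suc k) a n t) \<le> (1 / 2) ^ k" .
    qed
  qed
  then obtain k0 where k0: "\<And>j k n t. \<lbrakk>k0 j \<le> k; 2 * \<bar>n\<bar> \<le> int (2 ^ k); \<bar>t\<bar> \<le> real j\<rbrakk> \<Longrightarrow>
      cmod (flow (2 ^ k) a n t - flow (2 ^ Suc k) a n t) \<le> (1 / 2) ^ k" by metis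
  define \<gamma> where "\<gamma> n t = lim (\<lambda>k. flow (2 ^ k) a n t)" for n t
  have tail: "cmod (flow (2 ^ k) a n t - \<gamma> n t) \<le> 2 * (1 / 2) ^ k"
    if "k0 j \<le> k" "2 * \<bar>n\<bar> \<le> int (2 ^ k)" "\<bar>t\<bar> \<le> real j" for j k n t
    unfolding \<gamma>_def
  proof (rule geometric_increments_tail(2)[where K=k and f="\<lambda>k. flow (2 ^ k) a n t"])
    fix l assume l: "k \<le> l"
    show "cmod (flow (2 ^ l) a n t - flow (2 ^ Suc l) a n t) \<le> (1 / 2) ^ l"
      by (rule k0[OF order_trans[OF that(1) l] le_power2_mono[OF that(2) l] that(3)])
  qed simp
  have conv: "(\<lambda>k. flow (2 ^ k) a n t) \<longlonglongrightarrow> \<gamma> n t" for n t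
  proof -
    obtain j where j: "\<bar>t\<bar> \<le> real j" using real_arch_simple by blast
    obtain k where k: "k0 j \<le> k" "2 * \<bar>n\<bar> \<le> int (2 ^ k)" by (rule exists_power2_between)
    show ?thesis unfolding \<gamma>_def
    proof (rule geometric_increments_tail(1)[where K=k])
      fix l assume l: "k \<le> l"
      show "cmod (flow (2 ^ l) a n t - flow (2 ^ Suc l) a n t) \<le> (1 / 2) ^ l"
        by (rule k0[OF order_trans[OF k(1) l] le_power2_mono[OF k(2) l] j])
    qed
  qed
  \<comment> \<open>At site \<open>n\<close> the limit is compared with the truncation at a scale of
    order \<open>|n|\<close>, for which the conserved mass gives the bound; the tail adds at most
    2.\<close>
  have growth: "\<exists>D\<ge>0. \<forall>n t. \<bar>t\<bar> \<le> real j \<longrightarrow> cmod (\<gamma> n t) \<le> D * exp (4 * c * \<bar>real_of_int n\<bar>)" for j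
  proof (intro exI[of _ "B * exp (c * real (2 ^ k0 j)) + 2"] conjI allI impI)
    show "0 \<le> B * exp (c * real (2 ^ k0 j)) + 2" using Bc by simp
    fix n t assume t: "\<bar>t\<bar> \<le> real j"
    obtain k where k: "k0 j \<le> k" "2 * \<bar>n\<bar> \<le> int (2 ^ k)" "real (2 ^ k) \<le> real (2 ^ k0 j) + 4 * \<bar>real_of_int n\<bar>"
      by (rule exists_power2_between)
    have "cmod (\<gamma> n t) \<le> cmod (flow (2 ^ k) a n t) + cmod (flow (2 ^ k) a n t - \<gamma> n t)"
      using norm_triangle_sub[of "\<gamma> n t" "flow (2 ^ k) a n t"] by (simp add: norm_minus_commute)
    also have "\<dots> \<le> B * exp (c * real (2 ^ k)) + 2 * (1 / 2) ^ k"
      by (intro add_mono B tail[OF k(1,2) t])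
    also have "\<dots> \<le> B * exp (c * (real (2 ^ k0 j) + 4 * \<bar>real_of_int n\<bar>)) + 2 * 1"
      using k(3) Bc by (intro add_mono mult_left_mono power_le_one iffD2[OF exp_le_cancel_iff]) auto
    also have "\<dots> \<le> (B * exp (c * real (2 ^ k0 j)) + 2) * exp (4 * c * \<bar>real_of_int n\<bar>)"
    proof -
      have "1 \<le> exp (4 * c * \<bar>real_of_int n\<bar>)" using Bc by simp
      moreover have "exp (c * (real (2 ^ k0 j) + 4 * \<bar>real_of_int n\<bar>)) = exp (c * real (2 ^ k0 j)) * exp (4 * c * \<bar>real_of_int n\<bar>)"
        by (simp add: exp_add[symmetric] algebra_simps)
      ultimately show ?thesis by (simp add: algebra_simps)
    qed
    finally show "cmod (\<gamma> n t) \<le> (B * exp (c * real (2 ^ k0 j)) + 2) * exp (4 * c * \<bar>real_of_int n\<bar>)" .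
  qed
  have sol: "(\<gamma> n has_vector_derivative lattice_field (\<lambda>m. \<gamma> m t) n) (at t)" for n t
  proof -
    \<comment> \<open>Shifting the index places \<open>n\<close> inside every box of the sequence,
      so that the equation at \<open>n\<close> holds for all \<open>k\<close>.\<close>
    define K where "K = nat \<bar>n\<bar>"
    have K: "\<bar>n\<bar> \<le> int (2 ^ (k + K))" for k
    proof -
      have "K < 2 ^ K" by (rule less_exp)
      also have "(2::nat) ^ K \<le> 2 ^ (k + K)" by (intro power_increasing) auto
      finally show ?thesis unfolding K_def by linarith
    qed
    show ?thesis
    proof (rule has_vector_derivative_uniform_limit[where f="\<lambda>k. flow (2 ^ (k + K)) a n"
          and g="\<lambda>k t. lattice_field (\<lambda>m. flow (2 ^ (k + K)) a m t) n"])
      show "(flow (2 ^ (k + K)) a n has_vector_derivative lattice_field (\<lambda>m. flow (2 ^ (k + K)) a m t) n) (at t)" for k t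
        unfolding lattice_field_def using K by (intro flow_derivative) simp
      show "(\<lambda>k. flow (2 ^ (k + K)) a n t) \<longlonglongrightarrow> \<gamma> n t" for t
        using conv by (rule LIMSEQ_ignore_initial_segment)
      fix T :: real
      obtain j where j: "T \<le> real j" using real_arch_simple by blast
      obtain D where D: "0 \<le> D" "\<And>n t. \<bar>t\<bar> \<le> real j \<Longrightarrow> cmod (\<gamma> n t) \<le> D * exp (4 * c * \<bar>real_of_int n\<bar>)"
        using growth[of j] by blast
      \<comment> \<open>A common bound for the limit at \<open>n\<close> and its neighbours and for
        the truncations at \<open>n\<close>, which lie within 2 of the limit.\<close>
      define A where "A = (D * exp (4 * c * (\<bar>real_of_int n\<bar> + 1)) + 2)\<^sup>2"
      obtain k1 where k1: "k0 j \<le> k1" "2 * \<bar>\<bar>n\<bar> + 1\<bar> \<le> int (2 ^ k1)" by (rule exists_power2_between)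
      have est: "cmod (lattice_field (\<lambda>m. flow (2 ^ (k + K)) a m t) n - lattice_field (\<lambda>m. \<gamma> m t) n) \<le> (2 + 6 * A) * (2 * (1 / 2) ^ k)"
        if k: "k1 \<le> k" and t: "t \<in> {-T..T}" for k t
      proof (rule lattice_field_diff_le)
        have tj: "\<bar>t\<bar> \<le> real j" using t j by auto
        have close: "cmod (flow (2 ^ (k + K)) a m t - \<gamma> m t) \<le> 2 * (1 / 2) ^ (k + K)" if m: "\<bar>m - n\<bar> \<le> 1" for m
        proof (rule tail[OF _ _ tj])
          show "k0 j \<le> k + K" using k k1(1) by simp
          have "2 * \<bar>m\<bar> \<le> 2 * \<bar>\<bar>n\<bar> + 1\<bar>" using m by arith
          then have "2 * \<bar>m\<bar> \<le> int (2 ^ k1)" using k1(2) by (rule order_trans)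
          then show "2 * \<bar>m\<bar> \<le> int (2 ^ (k + K))" by (rule le_power2_mono) (use k in simp)
        qed
        have \<gamma>: "cmod (\<gamma> m t) \<le> D * exp (4 * c * (\<bar>real_of_int n\<bar> + 1))" if m: "\<bar>m - n\<bar> \<le> 1" for m
        proof -
          have "\<bar>real_of_int m\<bar> \<le> \<bar>real_of_int n\<bar> + 1" using m by linarith
          then have "4 * c * \<bar>real_of_int m\<bar> \<le> 4 * c * (\<bar>real_of_int n\<bar> + 1)" using Bc by (intro mult_left_mono) auto
          then have "D * exp (4 * c * \<bar>real_of_int m\<bar>) \<le> D * exp (4 * c * (\<bar>real_of_int n\<bar> + 1))"
            using D(1) by (intro mult_left_mono) auto
          then show ?thesis using D(2)[OF tj, of m] by linarith
        qed
        have "(1 / 2 :: real) ^ (k + K) \<le> (1 / 2) ^ k" by (intro power_decreasing) auto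
        then show "cmod (flow (2 ^ (k + K)) a m t - \<gamma> m t) \<le> 2 * (1 / 2) ^ k" if "\<bar>m - n\<bar> \<le> 1" for m
          using close[OF that] by linarith
        show "(cmod (\<gamma> m t))\<^sup>2 \<le> A" if "\<bar>m - n\<bar> \<le> 1" for m
          unfolding A_def using \<gamma>[OF that] by (intro power_mono) auto
        have "(1 / 2 :: real) ^ (k + K) \<le> 1" by (intro power_le_one) auto
        then have "cmod (flow (2 ^ (k + K)) a n t) \<le> D * exp (4 * c * (\<bar>real_of_int n\<bar> + 1)) + 2"
          using close[of n] \<gamma>[of n] norm_triangle_sub[of "flow (2 ^ (k + K)) a n t" "\<gamma> n t"] by simp
        then show "(cmod (flow (2 ^ (k + K)) a n t))\<^sup>2 \<le> A"
          unfolding A_def by (intro power_mono) auto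
      qed
      show "uniform_limit {-T..T} (\<lambda>k t. lattice_field (\<lambda>m. flow (2 ^ (k + K)) a m t) n) (\<lambda>t. lattice_field (\<lambda>m. \<gamma> m t) n) sequentially"
      proof (rule uniform_limitI)
        fix e :: real assume "e > 0"
        have "(\<lambda>k. (2 + 6 * A) * (2 * (1 / 2) ^ k)) \<longlonglongrightarrow> (2 + 6 * A) * (2 * 0)"
          by (intro tendsto_intros LIMSEQ_realpow_zero) auto
        then have "\<forall>\<^sub>F k in sequentially. (2 + 6 * A) * (2 * (1 / 2) ^ k) < e"
          using \<open>e > 0\<close> by (intro order_tendstoD) auto
        then show "\<forall>\<^sub>F k in sequentially. \<forall>t\<in>{-T..T}.
            dist (lattice_field (\<lambda>m. flow (2 ^ (k + K)) a m t) n) (lattice_field (\<lambda>m. \<gamma> m t) n) < e"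
          using eventually_ge_at_top[of k1]
          by eventually_elim (auto simp: dist_norm intro: order_le_less_trans[OF est])
      qed
    qed
  qed
  have contg: "continuous_on UNIV (\<gamma> n)" for n
    using has_vector_derivative_continuous[OF sol] by (intro continuous_at_imp_continuous_on) blast
  \<comment> \<open>The bounds at all scales grow like \<open>2^(k\<delta>)\<close> and give nothing
    in the limit; here the liminf hypothesis enters, after Fatou in the sites and again in
    time.\<close>
  have fatou: "spacetime p q (real j) \<gamma> < \<infinity>" for j
  proof -
    let ?g = "\<lambda>n z. japanese_bracket n powr (- q) * cmod z powr (2 * p)"
    have p0: "0 < 2 * p" using p by simp
    have contz: "continuous_on UNIV (?g n)" for n
      using p0 by (intro continuous_intros continuous_on_powr') auto
    have pt: "(\<integral>\<^sup>+n. ennreal (?g n (\<gamma> n t)) \<partial>count_space UNIV) \<le>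
        liminf (\<lambda>k. \<integral>\<^sup>+n. ennreal (?g n (flow (2 ^ k) a n t)) \<partial>count_space UNIV)" for t
    proof -
      have "ennreal (?g n (\<gamma> n t)) = liminf (\<lambda>k. ennreal (?g n (flow (2 ^ k) a n t)))" for n
      proof (rule lim_imp_Liminf[symmetric])
        have "isCont (?g n) (\<gamma> n t)" using contz[of n] by (simp add: continuous_on_eq_continuous_at)
        then show "(\<lambda>k. ennreal (?g n (flow (2 ^ k) a n t))) \<longlonglongrightarrow> ennreal (?g n (\<gamma> n t))"
          by (intro tendsto_ennrealI isCont_tendsto_compose[OF _ conv])
      qed simp
      then show ?thesis by (simp add: nn_integral_liminf)
    qed
    have [measurable]: "flow N a n \<in> borel_measurable borel" for N n
      by (intro borel_measurable_continuous_onI continuous_on_flow)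
    have [measurable]: "(\<lambda>t. \<integral>\<^sup>+n. ennreal (?g n (flow (2 ^ k) a n t)) \<partial>count_space UNIV) \<in> borel_measurable borel" for k
      by (rule borel_measurable_nn_integral_count_space_int) measurable
    have "spacetime p q (real j) \<gamma> \<le> (\<integral>\<^sup>+t. liminf (\<lambda>k. (\<integral>\<^sup>+n. ennreal (?g n (flow (2 ^ k) a n t)) \<partial>count_space UNIV)
        * indicator {- real j..real j} t) \<partial>lborel)"
      unfolding spacetime_def
    proof (intro nn_integral_mono)
      fix t
      show "(\<integral>\<^sup>+n. ennreal (?g n (\<gamma> n t)) \<partial>count_space UNIV) * indicator {- real j..real j} t \<le>
          liminf (\<lambda>k. (\<integral>\<^sup>+n. ennreal (?g n (flow (2 ^ k) a n t)) \<partial>count_space UNIV) * indicator {- real j..real j} t)"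
        using pt[of t] by (cases "t \<in> {- real j..real j}") auto
    qed
    also have "\<dots> \<le> liminf (\<lambda>k. spacetime p q (real j) (flow (2 ^ k) a))"
      unfolding spacetime_def by (rule nn_integral_liminf) measurable
    also have "\<dots> < \<infinity>" using lim by blast
    finally show ?thesis .
  qed
  let ?\<alpha> = "phase_shift (-2) \<gamma>"
  have "good_solution ?\<alpha>"
    unfolding good_solution_def
  proof (intro conjI)
    show "AL_solution ?\<alpha>" using sol by (rule phase_shifted_imp_AL_solution)
    show "\<exists>p q :: real. p > q \<and> q > 1 \<and> (\<forall>T>0. (\<integral>\<^sup>+ t\<in>{-T..T}.
        weighted_moment p q (\<lambda>n. ?\<alpha> n t) \<partial>lborel) < \<infinity>)"
    proof -
      have "spacetime p q T ?\<alpha> < \<infinity>" for T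
      proof -
        obtain j where "T \<le> real j" using real_arch_simple by blast
        then show ?thesis unfolding spacetime_phase_shift
          using order_le_less_trans[OF spacetime_mono fatou] by blast
      qed
      then show ?thesis
        using p unfolding spacetime_def by (intro exI[of _ p] exI[of _ q] conjI allI impI) auto
    qed
    show "\<exists>c::real. c > 0 \<and> (\<forall>T>0. (SUP t\<in>{-T..T}.
        weighted_mass c (\<lambda>n. ?\<alpha> n t)) < \<infinity>)"
    \<comment> \<open>The squared limit grows at most like \<open>exp (8c|n|)\<close>; the extra 1
      leaves a summable \<open>exp (-|n|)\<close>.\<close>
    proof (intro exI[of _ "8 * c + 1"] conjI allI impI)
      show "0 < 8 * c + 1" using Bc by simp
      fix T :: real
      obtain j where j: "T \<le> real j" using real_arch_simple by blast
      obtain D where D: "0 \<le> D" "\<And>n t. \<bar>t\<bar> \<le> real j \<Longrightarrow> cmod (\<gamma> n t) \<le> D * exp (4 * c * \<bar>real_of_int n\<bar>)"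
        using growth[of j] by blast
      let ?S = "\<integral>\<^sup>+n. ennreal ((1 + \<bar>real_of_int n\<bar>) powr (- 2)) \<partial>count_space UNIV"
      have "(SUP t\<in>{-T..T}. weighted_mass (8 * c + 1) (\<lambda>n. ?\<alpha> n t))
          \<le> ennreal (4 * D\<^sup>2) * ?S"
      proof (rule SUP_least)
        fix t assume t: "t \<in> {-T..T}"
        have "exp (- (8 * c + 1) * japanese_bracket n) * (cmod (?\<alpha> n t))\<^sup>2 \<le> (4 * D\<^sup>2) * (1 + \<bar>real_of_int n\<bar>) powr (- 2)" for n
        proof -
          let ?x = "\<bar>real_of_int n\<bar>"
          have "cmod (\<gamma> n t) \<le> D * exp (4 * c * ?x)" using t j by (intro D) auto
          then have "(cmod (?\<alpha> n t))\<^sup>2 \<le> (D * exp (4 * c * ?x))\<^sup>2" by (simp add: power_mono)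
          also have "\<dots> = D\<^sup>2 * exp (8 * c * ?x)"
            by (simp add: power_mult_distrib exp_double[symmetric])
          finally have 1: "(cmod (?\<alpha> n t))\<^sup>2 \<le> D\<^sup>2 * exp (8 * c * ?x)" .
          have "(8 * c + 1) * ?x \<le> (8 * c + 1) * japanese_bracket n"
            using japanese_bracket_bounds(2)[of n] Bc by (intro mult_left_mono) auto
          then have "exp (- (8 * c + 1) * japanese_bracket n) \<le> exp (- ((8 * c + 1) * ?x))"
            by (simp only: exp_le_cancel_iff mult_minus_left neg_le_iff_le)
          then have "exp (- (8 * c + 1) * japanese_bracket n) * (cmod (?\<alpha> n t))\<^sup>2 \<le> exp (- ((8 * c + 1) * ?x)) * (D\<^sup>2 * exp (8 * c * ?x))"
            using 1 by (rule mult_mono) auto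
          also have "\<dots> = D\<^sup>2 * exp (- ?x)" by (simp add: mult_exp_exp algebra_simps)
          also have "\<dots> \<le> D\<^sup>2 * (4 * (1 + ?x) powr (- 2))" by (intro mult_left_mono exp_neg_le_powr) auto
          finally show ?thesis by (simp add: mult_ac)
        qed
        then have "weighted_mass (8 * c + 1) (\<lambda>n. ?\<alpha> n t) \<le>
            (\<integral>\<^sup>+ n. ennreal ((4 * D\<^sup>2) * (1 + \<bar>real_of_int n\<bar>) powr (- 2)) \<partial>count_space UNIV)"
          by (intro nn_integral_mono ennreal_leI)
        also have "\<dots> = ennreal (4 * D\<^sup>2) * ?S"
          by (simp add: ennreal_mult nn_integral_cmult)
        finally show "weighted_mass (8 * c + 1) (\<lambda>n. ?\<alpha> n t) \<le> ennreal (4 * D\<^sup>2) * ?S" .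
      qed
      also have "\<dots> < \<infinity>" using nn_integral_int_powr_finite[of 2] by (simp add: ennreal_mult_less_top)
      finally show "(SUP t\<in>{-T..T}. weighted_mass (8 * c + 1) (\<lambda>n. ?\<alpha> n t)) < \<infinity>" .
    qed
  qed
  moreover have "?\<alpha> n 0 = a n" for n
  proof -
    obtain k where k: "0 \<le> k" "2 * \<bar>n\<bar> \<le> int (2 ^ k)" by (rule exists_power2_between)
    have "\<forall>\<^sub>F l in sequentially. flow (2 ^ l) a n 0 = a n"
      using eventually_ge_at_top[of k]
    proof eventually_elim
      case (elim l)
      have "2 * \<bar>n\<bar> \<le> int (2 ^ l)" by (rule le_power2_mono[OF k(2) elim])
      then show ?case by (intro flow_0) linarith
    qed
    then have "(\<lambda>k. flow (2 ^ k) a n 0) \<longlonglongrightarrow> a n" by (rule tendsto_eventually)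
    then have "\<gamma> n 0 = a n" using conv LIMSEQ_unique by blast
    then show ?thesis by simp
  qed
  ultimately show ?thesis by blast
qed

theorem theorem4p3:
  fixes \<beta> :: real
  assumes "\<beta> > 0"
  shows "AE a in white_noise \<beta>.
           \<exists>!\<alpha> :: int \<Rightarrow> real \<Rightarrow> complex. good_solution \<alpha> \<and> (\<forall>n. \<alpha> n 0 = a n)"
proof -
  \<comment> \<open>Any \<open>p\<close> below \<open>1 + 2\<beta>\<close> has finite moments; with
    \<open>p = 1 + \<beta>\<close>, the values of \<open>q\<close> and \<open>\<delta>\<close> give
    \<open>q + \<delta> = 1 + 3\<beta>/4 < p\<close>.\<close>
  define p where "p = 1 + \<beta>"
  define q where "q = 1 + \<beta> / 2"
  define \<delta> where "\<delta> = \<beta> / 4"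
  have p: "1 < q" "0 < \<delta>" "q + \<delta> < p" using assms by (auto simp: p_def q_def \<delta>_def)
  have "AE a in white_noise \<beta>. controlled p q \<delta> a"
    by (rule AE_white_noise_bounds[OF assms p_def p(1,2)])
  then show ?thesis
  proof eventually_elim
    case (elim a)
    then obtain \<alpha> where \<alpha>: "good_solution \<alpha>" "\<And>n. \<alpha> n 0 = a n"
      using good_solution_exists[OF p, of a] by blast
    then show ?case by (intro ex1I[of _ \<alpha>]) (auto intro: good_solution_unique)
  qed
qed

end
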